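(* Let $P\subseteq D$ be a non-empty poset ideal, let $a$ be a maximal element of $P$, let $Q=P\setminus\{a\}$ (which is again a poset ideal of $D$) and let $b=a-(1,1,\dots,1)$. Then: (1) $J_P$ has a linear resolution. (2) If $f_a\notin I_b$ then $J_Q:(f_a)=I_b$; and if $f_a\in I_b$ then $f_a\in J_Q$, i.e. $J_Q:(f_a)=S$.
   Context: $K$ is an infinite field, $V$ a $K$-vector space of finite dimension $d$, and $S=\mathrm{Sym}_K(V)$, a polynomial ring in $d$ variables with the standard grading. $\mathcal V=V_1,\dots,V_n$ is a subspace arrangement, i.e. a finite collection of non-zero $K$-subspaces of $V$ (inclusions and equalities allowed); $d_i=\dim_K V_i$. $\mathbb N$ contains $0$ and $[u]=\{1,\dots,u\}$. A collection of bases of $\mathcal V$ is a family $\{f_{ij}: i\in[n], j\in[d_i]\}$ such that for each $i$, $f_{i1},\dots,f_{id_i}$ is an ordered $K$-basis of $V_i$. For $a\in\mathbb N^n$ with $a_i\le d_i$ for all $i$, put $W_a=\langle f_{ij}: i\in[n],\ j\in[a_i]\rangle\subseteq V$ and let $I_a$ be the ideal of $S$ generated by $W_a$. We fix a collection of bases satisfying the following genericity assumption: for all $a\in\mathbb N^n$ with $a_i\le d_i$, the dimension of $W_a$ is the largest possible among all collections of bases of $\mathcal V$ (such collections exist since $K$ is infinite). $D=[d_1]\times\cdots\times[d_n]\subset\mathbb N^n$ with the componentwise partial order. A poset ideal of $D$ is a subset $P\subseteq D$ such that $a\in D$, $b\in P$, $a\le b$ imply $a\in P$. For $a\in D$ put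 $f_a=\prod_{i=1}^n f_{ia_i}\in S$, and for a poset ideal $P$ put $J_P=(f_a: a\in P)\subseteq S$ (so $J_\emptyset=0$). The ideal $J_P$, generated in degree $n$, has a linear resolution if its graded Betti numbers satisfy $\beta_{i,j}(J_P)=0$ for $j\ne i+n$. *)

theory Defs
  imports Complex_Main "HOL-Library.Poly_Mapping" "HOL-Library.FuncSet" "HOL-Algebra.Ideal"
begin

section \<open>The symmetric algebra as a graded polynomial ring\<close>

text \<open>Polynomials with coefficients in \<open>'k\<close>: finitely supported functions on monomials, which are
  themselves finitely supported exponent functions on (indices of) variables.\<close>

type_synonym 'k mpol = "(nat \<Rightarrow>\<^sub>0 nat) \<Rightarrow>\<^sub>0 'k"

text \<open>\<open>poly_ring d\<close> is \<open>K[x\<^sub>1,\<dots>,x\<^sub>d]\<close>.\<close>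

definition poly_ring :: "nat \<Rightarrow> ('k::field mpol) ring" where
  "poly_ring d =
     \<lparr>carrier = {p. \<forall>m\<in>Poly_Mapping.keys p. Poly_Mapping.keys m \<subseteq> {1..d}},
      mult = (*), one = 1, zero = 0, add = (+)\<rparr>"

lemma cring_poly_ring: "cring (poly_ring d :: ('k::field mpol) ring)"
proof -
  let ?S = "{p::'k mpol. \<forall>m\<in>Poly_Mapping.keys p. Poly_Mapping.keys m \<subseteq> {1..d}}"
  have A: "x + y \<in> ?S" if "x \<in> ?S" "y \<in> ?S" for x y
    using that keys_add[of x y] by blast
  have M: "x * y \<in> ?S" if "x \<in> ?S" "y \<in> ?S" for x y
  proof -
    have "Poly_Mapping.keys m \<subseteq> {1..d}" if m: "m \<in> Poly_Mapping.keys (x*y)" for m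
    proof -
      from m obtain p q where "p \<in> Poly_Mapping.keys x" "q \<in> Poly_Mapping.keys y" "m = p + q" using keys_mult[of x y] by blast
      then show ?thesis using \<open>x \<in> ?S\<close> \<open>y \<in> ?S\<close> keys_add[of p q] by blast
    qed
    then show ?thesis by blast
  qed
  have N: "- x \<in> ?S" if "x \<in> ?S" for x using that by (auto simp: Poly_Mapping.in_keys_iff)
  have O: "1 \<in> ?S" "0 \<in> ?S" by (auto simp: Poly_Mapping.in_keys_iff lookup_one when_def)
  have "abelian_group (poly_ring d :: ('k mpol) ring)"
    unfolding poly_ring_def
    apply (rule abelian_groupI; unfold ring.simps partial_object.simps monoid.simps)
    subgoal by (rule A)
    subgoal by (rule O)
    subgoal by (rule add.assoc)
    subgoal by (rule add.commute)
    subgoal by (rule add_0)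
    subgoal for x by (rule bexI[of _ "-x"]) (use N in simp_all)
    done
  moreover have "comm_monoid (poly_ring d :: ('k mpol) ring)"
    unfolding poly_ring_def
    apply (rule comm_monoidI; unfold ring.simps partial_object.simps monoid.simps)
    subgoal by (rule M)
    subgoal by (rule O)
    subgoal by (rule mult.assoc)
    subgoal by (rule mult_1)
    subgoal by (rule mult.commute)
    done
  ultimately show ?thesis
    by (rule cringI) (simp add: poly_ring_def distrib_right)
qed

definition monom_degree :: "(nat \<Rightarrow>\<^sub>0 nat) \<Rightarrow> nat" where
  "monom_degree m = (\<Sum>k\<in>Poly_Mapping.keys m. Poly_Mapping.lookup m k)"

text \<open>Degrees are integers; in particular \<open>0\<close> is the only element that is homogeneous of a
  negative degree.\<close>

definition homogeneous :: "'k::field mpol \<Rightarrow> int \<Rightarrow> bool" where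
  "homogeneous p j \<longleftrightarrow> (\<forall>m\<in>Poly_Mapping.keys p. int (monom_degree m) = j)"

definition colon :: "nat \<Rightarrow> 'k::field mpol set \<Rightarrow> 'k mpol \<Rightarrow> 'k mpol set" where
  "colon d J g = {s \<in> carrier (poly_ring d). s * g \<in> J}"

definition ordered_basis ::
  "('k::field \<Rightarrow> 'v::ab_group_add \<Rightarrow> 'v) \<Rightarrow> nat \<Rightarrow> (nat \<Rightarrow> 'v) \<Rightarrow> 'v set \<Rightarrow> bool" where
  "ordered_basis scale m e U \<longleftrightarrow>
     inj_on e {1..m} \<and> \<not> module.dependent scale (e ` {1..m}) \<and> module.span scale (e ` {1..m}) = U"

text \<open>An ordered basis \<open>e\<^sub>1,\<dots>,e\<^sub>d\<close> of \<open>V\<close> identifies \<open>Sym\<^sub>K(V)\<close> with \<open>K[x\<^sub>1,\<dots>,x\<^sub>d]\<close>. Under this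
  identification the inclusion of \<open>V\<close> in \<open>Sym\<^sub>K(V)\<close> sends a vector with coordinates \<open>c\<^sub>k\<close> to the
  linear form \<open>c\<^sub>1 x\<^sub>1 + \<dots> + c\<^sub>d x\<^sub>d\<close>.\<close>

definition sym_incl ::
  "('k::field \<Rightarrow> 'v::ab_group_add \<Rightarrow> 'v) \<Rightarrow> nat \<Rightarrow> (nat \<Rightarrow> 'v) \<Rightarrow> 'v \<Rightarrow> 'k mpol" where
  "sym_incl scale d e v =
     (\<Sum>k\<in>{1..d}. Poly_Mapping.single (Poly_Mapping.single k 1)
        (module.representation scale (e ` {1..d}) v (e k)))"

section \<open>Minimal graded free resolutions and graded Betti numbers\<close>

text \<open>Data of a complex \<open>\<dots> \<rightarrow> F\<^sub>1 \<rightarrow> F\<^sub>0 \<rightarrow> S\<close> with \<open>F\<^sub>p\<close> the direct sum of the \<open>S(-shift p k)\<close>,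
  \<open>k < rk p\<close>. The map \<open>F\<^sub>0 \<rightarrow> S\<close> sends the \<open>l\<close>-th basis vector to \<open>aug l\<close>, and \<open>dif p\<close> is the
  matrix of \<open>F\<^sub>p\<^sub>+\<^sub>1 \<rightarrow> F\<^sub>p\<close> (rows indexed by the basis of \<open>F\<^sub>p\<close>).\<close>

record 'r free_complex =
  rk :: "nat \<Rightarrow> nat"
  shift :: "nat \<Rightarrow> nat \<Rightarrow> int"
  aug :: "nat \<Rightarrow> 'r"
  dif :: "nat \<Rightarrow> nat \<Rightarrow> nat \<Rightarrow> 'r"

definition free_mod :: "nat \<Rightarrow> nat \<Rightarrow> (nat \<Rightarrow> 'k::field mpol) set" where
  "free_mod d r = ({..<r} \<rightarrow>\<^sub>E carrier (poly_ring d))"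

definition aug_map :: "'k::field mpol free_complex \<Rightarrow> (nat \<Rightarrow> 'k mpol) \<Rightarrow> 'k mpol" where
  "aug_map F u = (\<Sum>l<rk F 0. aug F l * u l)"

definition dif_map ::
  "'k::field mpol free_complex \<Rightarrow> nat \<Rightarrow> (nat \<Rightarrow> 'k mpol) \<Rightarrow> (nat \<Rightarrow> 'k mpol)" where
  "dif_map F p u = (\<lambda>k\<in>{..<rk F p}. \<Sum>l<rk F (Suc p). dif F p k l * u l)"

definition graded_free_resolution ::
  "nat \<Rightarrow> 'k::field mpol set \<Rightarrow> 'k mpol free_complex \<Rightarrow> bool" where
  "graded_free_resolution d J F \<longleftrightarrow>
     (\<forall>l<rk F 0. aug F l \<in> carrier (poly_ring d) \<and> homogeneous (aug F l) (shift F 0 l)) \<and>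
     (\<forall>p. \<forall>k<rk F p. \<forall>l<rk F (Suc p).
        dif F p k l \<in> carrier (poly_ring d) \<and>
        homogeneous (dif F p k l) (shift F (Suc p) l - shift F p k)) \<and>
     aug_map F ` free_mod d (rk F 0) = J \<and>
     dif_map F 0 ` free_mod d (rk F 1) = {u \<in> free_mod d (rk F 0). aug_map F u = 0} \<and>
     (\<forall>p. dif_map F (Suc p) ` free_mod d (rk F (Suc (Suc p))) =
        {u \<in> free_mod d (rk F (Suc p)). \<forall>k<rk F p. dif_map F p u k = 0})"

text \<open>Minimality: all matrix entries lie in the homogeneous maximal ideal \<open>(x\<^sub>1,\<dots>,x\<^sub>d)\<close>, i.e. have
  zero constant term.\<close>

definition minimal_graded_free_resolution ::
  "nat \<Rightarrow> 'k::field mpol set \<Rightarrow> 'k mpol free_complex \<Rightarrow> bool" where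
  "minimal_graded_free_resolution d J F \<longleftrightarrow>
     graded_free_resolution d J F \<and>
     (\<forall>p. \<forall>k<rk F p. \<forall>l<rk F (Suc p). Poly_Mapping.lookup (dif F p k l) 0 = 0)"

text \<open>The number of summands \<open>S(-j)\<close> in homological degree \<open>i\<close> of the minimal graded free
  resolution. That resolution exists for every homogeneous ideal and is unique up to isomorphism,
  so the number does not depend on the one that is chosen.\<close>

definition graded_betti :: "nat \<Rightarrow> 'k::field mpol set \<Rightarrow> nat \<Rightarrow> int \<Rightarrow> nat" where
  "graded_betti d J i j =
     (let F = (SOME F. minimal_graded_free_resolution d J F)
      in card {k. k < rk F i \<and> shift F i k = j})"

definition linear_resolution :: "nat \<Rightarrow> 'k::field mpol set \<Rightarrow> nat \<Rightarrow> bool" where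
  "linear_resolution d J n \<longleftrightarrow> (\<forall>i j. j \<noteq> int i + int n \<longrightarrow> graded_betti d J i j = 0)"

section \<open>Subspace arrangements\<close>

text \<open>The arrangement is \<open>V 1, \<dots>, V n\<close>; a collection of bases is given by the vectors \<open>f i j\<close>.\<close>

definition subspace_arrangement ::
  "('k::field \<Rightarrow> 'v::ab_group_add \<Rightarrow> 'v) \<Rightarrow> nat \<Rightarrow> (nat \<Rightarrow> 'v set) \<Rightarrow> bool" where
  "subspace_arrangement scale n V \<longleftrightarrow>
     (\<forall>i\<in>{1..n}. module.subspace scale (V i) \<and> V i \<noteq> {0})"

definition collection_of_bases ::
  "('k::field \<Rightarrow> 'v::ab_group_add \<Rightarrow> 'v) \<Rightarrow> nat \<Rightarrow> (nat \<Rightarrow> 'v set) \<Rightarrow> (nat \<Rightarrow> nat \<Rightarrow> 'v) \<Rightarrow> bool" where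
  "collection_of_bases scale n V f \<longleftrightarrow>
     (\<forall>i\<in>{1..n}. ordered_basis scale (vector_space.dim scale (V i)) (f i) (V i))"

definition W_span ::
  "('k::field \<Rightarrow> 'v::ab_group_add \<Rightarrow> 'v) \<Rightarrow> nat \<Rightarrow> (nat \<Rightarrow> nat \<Rightarrow> 'v) \<Rightarrow> (nat \<Rightarrow> nat) \<Rightarrow> 'v set" where
  "W_span scale n f a = module.span scale {f i j | i j. i \<in> {1..n} \<and> j \<in> {1..a i}}"

definition generic_bases ::
  "('k::field \<Rightarrow> 'v::ab_group_add \<Rightarrow> 'v) \<Rightarrow> nat \<Rightarrow> (nat \<Rightarrow> 'v set) \<Rightarrow> (nat \<Rightarrow> nat \<Rightarrow> 'v) \<Rightarrow> bool" where
  "generic_bases scale n V f \<longleftrightarrow>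
     collection_of_bases scale n V f \<and>
     (\<forall>a. (\<forall>i\<in>{1..n}. a i \<le> vector_space.dim scale (V i)) \<longrightarrow>
        (\<forall>g. collection_of_bases scale n V g \<longrightarrow>
           vector_space.dim scale (W_span scale n g a) \<le> vector_space.dim scale (W_span scale n f a)))"

definition I_ideal ::
  "('k::field \<Rightarrow> 'v::ab_group_add \<Rightarrow> 'v) \<Rightarrow> nat \<Rightarrow> (nat \<Rightarrow> 'v) \<Rightarrow> nat \<Rightarrow> (nat \<Rightarrow> nat \<Rightarrow> 'v) \<Rightarrow>
     (nat \<Rightarrow> nat) \<Rightarrow> 'k mpol set" where
  "I_ideal scale d e n f a = genideal (poly_ring d) (sym_incl scale d e ` W_span scale n f a)"

definition D_poset ::
  "('k::field \<Rightarrow> 'v::ab_group_add \<Rightarrow> 'v) \<Rightarrow> nat \<Rightarrow> (nat \<Rightarrow> 'v set) \<Rightarrow> (nat \<Rightarrow> nat) set" where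
  "D_poset scale n V = (\<Pi>\<^sub>E i\<in>{1..n}. {1..vector_space.dim scale (V i)})"

definition cw_le :: "nat \<Rightarrow> (nat \<Rightarrow> nat) \<Rightarrow> (nat \<Rightarrow> nat) \<Rightarrow> bool" where
  "cw_le n a b \<longleftrightarrow> (\<forall>i\<in>{1..n}. a i \<le> b i)"

definition poset_ideal :: "nat \<Rightarrow> (nat \<Rightarrow> nat) set \<Rightarrow> (nat \<Rightarrow> nat) set \<Rightarrow> bool" where
  "poset_ideal n D P \<longleftrightarrow> P \<subseteq> D \<and> (\<forall>a\<in>D. \<forall>b\<in>P. cw_le n a b \<longrightarrow> a \<in> P)"

definition maximal_element :: "nat \<Rightarrow> (nat \<Rightarrow> nat) set \<Rightarrow> (nat \<Rightarrow> nat) \<Rightarrow> bool" where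
  "maximal_element n P a \<longleftrightarrow> a \<in> P \<and> (\<forall>c\<in>P. cw_le n a c \<longrightarrow> c = a)"

definition f_prod ::
  "('k::field \<Rightarrow> 'v::ab_group_add \<Rightarrow> 'v) \<Rightarrow> nat \<Rightarrow> (nat \<Rightarrow> 'v) \<Rightarrow> nat \<Rightarrow> (nat \<Rightarrow> nat \<Rightarrow> 'v) \<Rightarrow>
     (nat \<Rightarrow> nat) \<Rightarrow> 'k mpol" where
  "f_prod scale d e n f a = (\<Prod>i\<in>{1..n}. sym_incl scale d e (f i (a i)))"

definition J_ideal ::
  "('k::field \<Rightarrow> 'v::ab_group_add \<Rightarrow> 'v) \<Rightarrow> nat \<Rightarrow> (nat \<Rightarrow> 'v) \<Rightarrow> nat \<Rightarrow> (nat \<Rightarrow> nat \<Rightarrow> 'v) \<Rightarrow>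
     (nat \<Rightarrow> nat) set \<Rightarrow> 'k mpol set" where
  "J_ideal scale d e n f P = genideal (poly_ring d) (f_prod scale d e n f ` P)"

end

theory Submission
  imports Defs
begin

text \<open>
  Put \<open>g = f\<^sub>a\<close>, \<open>J = J\<^sub>Q\<close> and \<open>I = I\<^sub>b\<close>. Replacing the factor \<open>f\<^bsub>i,a\<^sub>i\<^esub>\<close> of \<open>g\<close> by \<open>f\<^bsub>ij\<^esub>\<close> with
  \<open>j < a\<^sub>i\<close> gives a generator of \<open>J\<close>, so \<open>I g \<subseteq> J\<close>. Conversely every \<open>c \<in> Q\<close> has an index with
  \<open>c\<^sub>i < a\<^sub>i\<close> because \<open>a\<close> is maximal, so \<open>J \<subseteq> I\<close>. The ideal \<open>I\<close> is generated by linear forms, hence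
  prime, and \<open>g \<notin> I\<close> forces \<open>J : g = I\<close> (lemma \<open>colon_J\<close>).

  The other half of the colon statement, that \<open>g \<in> I\<close> implies \<open>g \<in> J\<close>, is where genericity enters.
  As \<open>I\<close> is prime, some \<open>f\<^bsub>i,a\<^sub>i\<^esub>\<close> lies in \<open>W\<^sub>b\<close>. A dimension count (\<open>generic_tight\<close>) produces a nonempty
  set \<open>T\<close> of indices such that \<open>W = \<langle>f\<^bsub>ij\<^esub> : i \<in> T, j < a\<^sub>i\<rangle>\<close> contains even the vectors \<open>f\<^bsub>i,a\<^sub>i\<^esub>\<close>,
  \<open>i \<in> T\<close>. It suffices to treat the subarrangement indexed by \<open>T\<close>, since the remaining factors of \<open>g\<close>
  can be multiplied back afterwards. There every \<open>f\<^sub>c\<close> with \<open>c \<le> a\<close> lies in \<open>Sym W\<close>, and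
  \<open>h = f\<^sub>a\<close> is multiplied into \<open>J\<close> by all linear forms from \<open>W\<close>. That such an \<open>h\<close>, of the degree of the
  generators, must lie in \<open>J\<close> is a statement about local cohomology: the ideal \<open>J\<close> is reached from \<open>0\<close> by adding
  generators one at a time, \<open>Sym W\<close> has no zeroth local cohomology, and each step divides out a shifted polynomial
  ring, whose first local cohomology vanishes in the degree of the generator.
  Concretely (\<open>annihilated_in_J\<close>), with \<open>g\<close> the last generator of \<open>J\<close> and \<open>J'\<close> generated by the others,
  one writes \<open>y h \<equiv> \<gamma>\<^sub>y g\<close> modulo \<open>J'\<close>; the resulting relation
  \<open>x \<gamma>\<^sub>y \<equiv> y \<gamma>\<^sub>x\<close> modulo the prime ideal \<open>J' : g\<close> means that \<open>\<gamma>\<^sub>y \<equiv> \<lambda> y\<close> for one scalar \<open>\<lambda>\<close>, and one passes from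
  \<open>h\<close>, \<open>J\<close> to \<open>h - \<lambda> g\<close>, \<open>J'\<close>. The argument is run by induction on the size of the poset ideal, simultaneously
  for all subarrangements (\<open>redundancy_holds\<close>).

  For the linear resolution one adds the generators of \<open>J\<^sub>P\<close> one at a time. By the colon statement, a new
  generator \<open>g\<close> either changes nothing or gives an exact sequence
  \<open>0 \<rightarrow> J\<^sub>Q \<rightarrow> J\<^sub>P \<rightarrow> (S/I\<^sub>b)(-n) \<rightarrow> 0\<close>. Splicing a linear resolution of \<open>J\<^sub>Q\<close> with one of \<open>S/I\<^sub>b\<close> yields
  a linear resolution of \<open>J\<^sub>P\<close> (\<open>lin_res_cone\<close>). The same lemma, applied to \<open>J = I\<close> and a linear form outside
  \<open>I\<close>, builds the Koszul resolution of an ideal of linear forms (\<open>lin_ideal_lin_res\<close>).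
  Graded Betti numbers are read off from an arbitrary minimal graded free resolution, so one also needs
  that every such resolution has the shifts of a linear one (\<open>min_res_shifts\<close>).
\<close>

section \<open>Polynomials and their homogeneous components\<close>

abbreviation PR :: "nat \<Rightarrow> 'k::field mpol set" where
  "PR d \<equiv> carrier (poly_ring d)"

lemma PR_iff: "p \<in> PR d \<longleftrightarrow> (\<forall>m\<in>Poly_Mapping.keys p. Poly_Mapping.keys m \<subseteq> {1..d})"
  by (simp add: poly_ring_def)

lemma PR_add [intro]: "x \<in> PR d \<Longrightarrow> y \<in> PR d \<Longrightarrow> x + y \<in> PR d"
  using cring.cring_simprules(1)[OF cring_poly_ring, of x d y] by (simp add: poly_ring_def)

lemma PR_mult [intro]: "x \<in> PR d \<Longrightarrow> y \<in> PR d \<Longrightarrow> x * y \<in> PR d"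
  using cring.cring_simprules(5)[OF cring_poly_ring, of x d y] by (simp add: poly_ring_def)

lemma PR_0 [simp, intro]: "0 \<in> PR d" and PR_1 [simp, intro]: "1 \<in> PR d"
  by (auto simp: PR_iff Poly_Mapping.in_keys_iff lookup_one when_def)

lemma PR_single_0 [simp, intro]: "Poly_Mapping.single 0 c \<in> PR d"
  by (auto simp: PR_iff Poly_Mapping.in_keys_iff lookup_single when_def)

lemma PR_uminus [intro]: "x \<in> PR d \<Longrightarrow> - x \<in> PR d"
  by (simp add: PR_iff)

lemma PR_diff [intro]: "x \<in> PR d \<Longrightarrow> y \<in> PR d \<Longrightarrow> x - y \<in> PR d"
  using PR_add[of x d "-y"] PR_uminus[of y d] by simp

lemma PR_sum [intro]: "(\<And>i. i \<in> A \<Longrightarrow> f i \<in> PR d) \<Longrightarrow> sum f A \<in> PR d"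
  by (induction A rule: infinite_finite_induct) auto

lemma PR_prod [intro]: "(\<And>i. i \<in> A \<Longrightarrow> f i \<in> PR d) \<Longrightarrow> prod f A \<in> PR d"
  by (induction A rule: infinite_finite_induct) auto

lemma monom_degree_superset:
  assumes "finite A" "Poly_Mapping.keys m \<subseteq> A"
  shows "monom_degree m = (\<Sum>k\<in>A. Poly_Mapping.lookup m k)"
  unfolding monom_degree_def
  by (rule sum.mono_neutral_left) (use assms in \<open>auto simp: Poly_Mapping.in_keys_iff\<close>)

lemma monom_degree_add: "monom_degree (m + n) = monom_degree m + monom_degree n"
proof -
  let ?A = "Poly_Mapping.keys m \<union> Poly_Mapping.keys n"
  have "Poly_Mapping.keys (m + n) \<subseteq> ?A" by (rule keys_add)
  then show ?thesis
    by (subst (1 2 3) monom_degree_superset[of ?A]) (auto simp: lookup_add sum.distrib)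
qed

lemma monom_degree_0 [simp]: "monom_degree 0 = 0"
  by (simp add: monom_degree_def)

lemma monom_degree_single [simp]: "monom_degree (Poly_Mapping.single k j) = j"
  by (simp add: monom_degree_def)

lemma monom_degree_eq_0_iff: "monom_degree m = 0 \<longleftrightarrow> m = 0"
  by (auto simp: monom_degree_def Poly_Mapping.in_keys_iff intro!: poly_mapping_eqI)

lemma homogeneous_0 [simp]: "homogeneous 0 j"
  by (simp add: homogeneous_def)

lemma homogeneous_mult:
  assumes "homogeneous x i" "homogeneous y j" shows "homogeneous (x * y) (i + j)"
  unfolding homogeneous_def
proof
  fix m assume "m \<in> Poly_Mapping.keys (x * y)"
  then obtain a b where "a \<in> Poly_Mapping.keys x" "b \<in> Poly_Mapping.keys y" "m = a + b"
    using keys_mult[of x y] by blast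
  then show "int (monom_degree m) = i + j"
    using assms by (simp add: homogeneous_def monom_degree_add)
qed

lemma homogeneous_add: "homogeneous x i \<Longrightarrow> homogeneous y i \<Longrightarrow> homogeneous (x + y) i"
  using keys_add[of x y] by (auto simp: homogeneous_def)

lemma homogeneous_uminus: "homogeneous x i \<Longrightarrow> homogeneous (- x) i"
  by (simp add: homogeneous_def)

lemma homogeneous_diff: "homogeneous x i \<Longrightarrow> homogeneous y i \<Longrightarrow> homogeneous (x - y) i"
  using homogeneous_add[of x i "-y"] homogeneous_uminus[of y i] by simp

lemma homogeneous_sum: "(\<And>a. a \<in> A \<Longrightarrow> homogeneous (f a) i) \<Longrightarrow> homogeneous (sum f A) i"
  by (induction A rule: infinite_finite_induct) (auto intro: homogeneous_add)

lemma homogeneous_const [simp]: "homogeneous (Poly_Mapping.single 0 c) 0"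
  by (auto simp: homogeneous_def Poly_Mapping.in_keys_iff lookup_single when_def)

lemma homogeneous_1 [simp]: "homogeneous 1 0"
  by (simp add: homogeneous_def)

lemma homogeneous_prod:
  assumes "finite A" "\<And>a. a \<in> A \<Longrightarrow> homogeneous (f a) 1"
  shows "homogeneous (prod f A) (int (card A))"
  using assms
proof (induction A rule: finite_induct)
  case (insert x F)
  then show ?case using homogeneous_mult[of "f x" 1 "prod f F" "int (card F)"] by simp
qed auto

lemma homogeneous_lookup_0: "homogeneous x i \<Longrightarrow> i \<noteq> 0 \<Longrightarrow> Poly_Mapping.lookup x 0 = 0"
  by (metis homogeneous_def Poly_Mapping.in_keys_iff monom_degree_0 of_nat_0)

lemma homogeneous_0_eq_const:
  assumes "homogeneous x 0" shows "x = Poly_Mapping.single 0 (Poly_Mapping.lookup x 0)"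
proof (rule poly_mapping_eqI)
  fix m show "Poly_Mapping.lookup x m = Poly_Mapping.lookup (Poly_Mapping.single 0 (Poly_Mapping.lookup x 0)) m"
    using assms by (cases "m = 0") (auto simp: lookup_single homogeneous_def Poly_Mapping.in_keys_iff monom_degree_eq_0_iff when_def)
qed

definition hcomp :: "int \<Rightarrow> 'k::field mpol \<Rightarrow> 'k mpol" where
  "hcomp j p = (\<Sum>m\<in>{m\<in>Poly_Mapping.keys p. int (monom_degree m) = j}. Poly_Mapping.single m (Poly_Mapping.lookup p m))"

lemma lookup_hcomp:
  "Poly_Mapping.lookup (hcomp j p) m = (if int (monom_degree m) = j then Poly_Mapping.lookup p m else 0)"
proof -
  have "Poly_Mapping.lookup (hcomp j p) m =
    (\<Sum>n\<in>{m\<in>Poly_Mapping.keys p. int (monom_degree m) = j}. if m = n then Poly_Mapping.lookup p n else 0)"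
    unfolding hcomp_def lookup_sum by (rule sum.cong) (auto simp: lookup_single when_def)
  also have "\<dots> = (if int (monom_degree m) = j then Poly_Mapping.lookup p m else 0)"
    by (subst sum.delta') (auto simp: Poly_Mapping.in_keys_iff)
  finally show ?thesis .
qed

lemma hcomp_add: "hcomp j (x + y) = hcomp j x + hcomp j y"
  by (rule poly_mapping_eqI) (simp add: lookup_hcomp lookup_add)

lemma hcomp_0 [simp]: "hcomp j 0 = 0"
  by (rule poly_mapping_eqI) (simp add: lookup_hcomp)

lemma hcomp_sum: "hcomp j (sum f A) = (\<Sum>a\<in>A. hcomp j (f a))"
  by (induction A rule: infinite_finite_induct) (auto simp: hcomp_add)

lemma keys_hcomp: "Poly_Mapping.keys (hcomp j p) = {m\<in>Poly_Mapping.keys p. int (monom_degree m) = j}"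
  by (auto simp: Poly_Mapping.in_keys_iff lookup_hcomp split: if_splits)

lemma homogeneous_hcomp [simp]: "homogeneous (hcomp j x) j"
  by (simp add: homogeneous_def keys_hcomp)

lemma hcomp_PR [intro]: "x \<in> PR d \<Longrightarrow> hcomp j x \<in> PR d"
  by (simp add: PR_iff keys_hcomp)

lemma hcomp_homogeneous: "homogeneous x j \<Longrightarrow> hcomp j x = x"
  by (rule poly_mapping_eqI) (auto simp: lookup_hcomp homogeneous_def Poly_Mapping.in_keys_iff)

text \<open>Multiplication by a homogeneous element shifts components. This makes it possible to replace any
  solution of a system of linear equations with homogeneous coefficients by a homogeneous one.\<close>

lemma hcomp_mult:
  assumes "homogeneous a t" shows "hcomp j (a * u) = a * hcomp (j - t) u"
proof -
  define r where "r = u - hcomp (j - t) u"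
  have "hcomp j (a * r) = 0"
  proof (rule poly_mapping_eqI, simp add: lookup_hcomp, rule impI, rule ccontr)
    fix m assume m: "int (monom_degree m) = j" "Poly_Mapping.lookup (a * r) m \<noteq> 0"
    then have "m \<in> Poly_Mapping.keys (a * r)" by (simp add: Poly_Mapping.in_keys_iff)
    then obtain x y where xy: "x \<in> Poly_Mapping.keys a" "y \<in> Poly_Mapping.keys r" "m = x + y"
      using keys_mult[of a r] by blast
    then have "int (monom_degree y) = j - t"
      using m(1) assms by (auto simp: homogeneous_def monom_degree_add)
    then show False using xy(2) by (simp add: Poly_Mapping.in_keys_iff r_def lookup_minus lookup_hcomp)
  qed
  moreover have "a * u = a * hcomp (j - t) u + a * r" by (simp add: r_def algebra_simps)
  moreover have "hcomp j (a * hcomp (j - t) u) = a * hcomp (j - t) u"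
    using homogeneous_mult[OF assms homogeneous_hcomp[of "j - t" u]] by (simp add: hcomp_homogeneous)
  ultimately show ?thesis by (simp add: hcomp_add)
qed

section \<open>Matrices over the polynomial ring\<close>

text \<open>Vectors of length \<open>r\<close> are functions of which only the values below \<open>r\<close> matter; nothing is required of
  the other values. This is more convenient for block constructions than extensional functions.\<close>

definition pvec :: "nat \<Rightarrow> nat \<Rightarrow> (nat \<Rightarrow> 'k::field mpol) \<Rightarrow> bool" where
  "pvec d r u \<longleftrightarrow> (\<forall>l<r. u l \<in> PR d)"

definition mat_vec :: "nat \<Rightarrow> (nat \<Rightarrow> nat \<Rightarrow> 'a::comm_ring_1) \<Rightarrow> (nat \<Rightarrow> 'a) \<Rightarrow> nat \<Rightarrow> 'a" where
  "mat_vec r A u k = (\<Sum>l<r. A k l * u l)"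

lemma mat_vec_cong: "(\<And>l. l < r \<Longrightarrow> u l = v l) \<Longrightarrow> mat_vec r A u k = mat_vec r A v k"
  by (simp add: mat_vec_def)

lemma mat_vec_mv: "mat_vec r A (mat_vec t B u) k = mat_vec t (\<lambda>k l. \<Sum>i<r. A k i * B i l) u k"
  unfolding mat_vec_def sum_distrib_left sum_distrib_right
  by (subst sum.swap) (simp add: mult.assoc)

lemma mat_vec_diff: "mat_vec r A (\<lambda>l. u l - v l) k = mat_vec r A u k - mat_vec r A v k"
  by (simp add: mat_vec_def algebra_simps sum_subtractf)

lemma mat_vec_diff': "mat_vec r A (\<lambda>l. u l - v l) = (\<lambda>k. mat_vec r A u k - mat_vec r A v k)"
  by (rule ext) (rule mat_vec_diff)

lemma mat_vec_add: "mat_vec r A (\<lambda>l. u l + v l) k = mat_vec r A u k + mat_vec r A v k"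
  by (simp add: mat_vec_def algebra_simps sum.distrib)

lemma mat_vec_uminus: "mat_vec r A (\<lambda>l. - u l) k = - mat_vec r A u k"
  by (simp add: mat_vec_def sum_negf)

lemma mat_vec_0 [simp]: "mat_vec r A (\<lambda>l. 0) k = 0"
  by (simp add: mat_vec_def)

abbreviation unit_vec :: "nat \<Rightarrow> nat \<Rightarrow> 'a::comm_ring_1" where
  "unit_vec l \<equiv> (\<lambda>j. if j = l then 1 else 0)"

lemma mat_vec_unit: "l < r \<Longrightarrow> mat_vec r A (unit_vec l) k = A k l"
  by (simp add: mat_vec_def if_distrib[of "\<lambda>x. _ * x"] cong: if_cong)

lemma pvec_unit [simp]: "pvec d r (unit_vec l)"
  by (simp add: pvec_def)

lemma PR_mat_vec:
  assumes "\<And>l. l < r \<Longrightarrow> A k l \<in> PR d" "pvec d r u" shows "mat_vec r A u k \<in> PR d"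
  unfolding mat_vec_def using assms by (intro PR_sum PR_mult) (auto simp: pvec_def)

lemma homogeneous_negative: "homogeneous x j \<Longrightarrow> j < 0 \<Longrightarrow> x = 0"
  by (rule poly_mapping_eqI) (force simp: homogeneous_def Poly_Mapping.in_keys_iff)

lemma lookup_mult_0:
  fixes x y :: "'k::field mpol"
  assumes "Poly_Mapping.lookup x 0 = 0" shows "Poly_Mapping.lookup (x * y) 0 = 0"
proof (rule ccontr)
  assume "Poly_Mapping.lookup (x * y) 0 \<noteq> 0"
  then have "0 \<in> Poly_Mapping.keys (x * y)" by (simp add: Poly_Mapping.in_keys_iff)
  then obtain a b where ab: "a \<in> Poly_Mapping.keys x" "(0::nat \<Rightarrow>\<^sub>0 nat) = a + b"
    using keys_mult[of x y] by blast
  then have "monom_degree a + monom_degree b = 0"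
    by (metis monom_degree_add monom_degree_0)
  then have "a = 0" by (simp add: monom_degree_eq_0_iff)
  with ab assms show False by (simp add: Poly_Mapping.in_keys_iff)
qed

section \<open>Graded resolutions\<close>

text \<open>The augmentation is treated as one more matrix: the free module of index \<open>0\<close> is the ring itself,
  so \<open>\<rho> 0 = 1\<close>, the module of index \<open>p + 1\<close> has rank \<open>\<rho> (p + 1)\<close> and generators in degrees \<open>s (p + 1) l\<close>,
  and \<open>A p\<close> maps the module of index \<open>p + 1\<close> to that of index \<open>p\<close>. All steps of a resolution then have the
  same shape. The last clause says both that the composite of two consecutive maps vanishes and that the
  kernel is not larger than the image.\<close>

definition graded_res ::
  "nat \<Rightarrow> 'k::field mpol set \<Rightarrow> (nat \<Rightarrow> nat) \<Rightarrow> (nat \<Rightarrow> nat \<Rightarrow> nat \<Rightarrow> 'k mpol) \<Rightarrow> (nat \<Rightarrow> nat \<Rightarrow> int) \<Rightarrow> bool" where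
  "graded_res d J \<rho> A s \<longleftrightarrow>
     \<rho> 0 = 1 \<and> s 0 0 = 0 \<and>
     (\<forall>p. \<forall>k<\<rho> p. \<forall>l<\<rho> (Suc p). A p k l \<in> PR d \<and> homogeneous (A p k l) (s (Suc p) l - s p k)) \<and>
     (\<forall>x. x \<in> J \<longleftrightarrow> (\<exists>u. pvec d (\<rho> 1) u \<and> x = mat_vec (\<rho> 1) (A 0) u 0)) \<and>
     (\<forall>p u. pvec d (\<rho> (Suc p)) u \<longrightarrow>
        ((\<forall>k<\<rho> p. mat_vec (\<rho> (Suc p)) (A p) u k = 0) \<longleftrightarrow>
         (\<exists>w. pvec d (\<rho> (Suc (Suc p))) w \<and>
            (\<forall>k<\<rho> (Suc p). u k = mat_vec (\<rho> (Suc (Suc p))) (A (Suc p)) w k))))"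

lemma
  assumes "graded_res d J \<rho> A s"
  shows graded_res_base: "\<rho> 0 = Suc 0" "s 0 0 = 0"
    and graded_res_entry: "\<And>p k l. k < \<rho> p \<Longrightarrow> l < \<rho> (Suc p) \<Longrightarrow>
        A p k l \<in> PR d \<and> homogeneous (A p k l) (s (Suc p) l - s p k)"
    and graded_res_image: "\<And>x. x \<in> J \<longleftrightarrow> (\<exists>u. pvec d (\<rho> 1) u \<and> x = mat_vec (\<rho> 1) (A 0) u 0)"
    and graded_res_exact: "\<And>p u. pvec d (\<rho> (Suc p)) u \<Longrightarrow>
        (\<forall>k<\<rho> p. mat_vec (\<rho> (Suc p)) (A p) u k = 0) \<longleftrightarrow>
        (\<exists>w. pvec d (\<rho> (Suc (Suc p))) w \<and> (\<forall>k<\<rho> (Suc p). u k = mat_vec (\<rho> (Suc (Suc p))) (A (Suc p)) w k))"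
  using assms unfolding graded_res_def by - (elim conjE; simp; fail)+

definition min_res :: "(nat \<Rightarrow> nat) \<Rightarrow> (nat \<Rightarrow> nat \<Rightarrow> nat \<Rightarrow> 'k::field mpol) \<Rightarrow> bool" where
  "min_res \<rho> A \<longleftrightarrow> (\<forall>p. \<forall>k<\<rho> (Suc p). \<forall>l<\<rho> (Suc (Suc p)). Poly_Mapping.lookup (A (Suc p) k l) 0 = 0)"

text \<open>All generators of the module of index \<open>p + 1\<close> have degree \<open>q + p\<close>. Hence \<open>A 0\<close> has entries of
  degree \<open>q\<close> and all other matrices have entries of degree \<open>1\<close>.\<close>

definition lin_res :: "nat \<Rightarrow> int \<Rightarrow> 'k::field mpol set \<Rightarrow> (nat \<Rightarrow> nat) \<Rightarrow> (nat \<Rightarrow> nat \<Rightarrow> nat \<Rightarrow> 'k mpol) \<Rightarrow> bool" where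
  "lin_res d q J \<rho> A \<longleftrightarrow> graded_res d J \<rho> A (\<lambda>p k. if p = 0 then 0 else q + int p - 1)"

lemma lin_res_min: "lin_res d q J \<rho> A \<Longrightarrow> min_res \<rho> A"
  unfolding lin_res_def min_res_def graded_res_def
  by (auto intro!: homogeneous_lookup_0[where i = 1]) 
     (smt (verit, best) nat.distinct(1) of_nat_Suc)

lemma min_res_kernel:
  assumes "graded_res d J \<rho> A s" "min_res \<rho> A"
    and "pvec d (\<rho> (Suc p)) u" "\<And>k. k < \<rho> p \<Longrightarrow> mat_vec (\<rho> (Suc p)) (A p) u k = 0" "l < \<rho> (Suc p)"
  shows "Poly_Mapping.lookup (u l) 0 = 0"
proof -
  obtain w where "pvec d (\<rho> (Suc (Suc p))) w"
    and w: "\<forall>k<\<rho> (Suc p). u k = mat_vec (\<rho> (Suc (Suc p))) (A (Suc p)) w k"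
    using assms(1,3,4) unfolding graded_res_def by metis
  have "Poly_Mapping.lookup (A (Suc p) l j * w j) 0 = 0" if "j < \<rho> (Suc (Suc p))" for j
    using assms(2,5) that by (intro lookup_mult_0) (auto simp: min_res_def)
  then show ?thesis using w assms(5) by (simp add: mat_vec_def lookup_sum)
qed

section \<open>Uniqueness of the shifts\<close>

text \<open>One step in the comparison of two resolutions. Given a scalar matrix \<open>M\<close> that maps the image of \<open>A\<close> onto
  that of \<open>B\<close> and is injective, columns can be lifted in both directions, to a matrix \<open>W\<close> with \<open>M A = B W\<close> and a
  matrix \<open>Z\<close> with \<open>B = M A Z\<close>. The columns of \<open>Z W - 1\<close> lie in the kernel of \<open>A\<close>, so by minimality the entries
  of \<open>Z W - 1\<close> have no constant term. Since the entries of \<open>Z\<close> and \<open>W\<close> in position \<open>l\<close> have opposite degrees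
  \<open>t' - s l\<close> and \<open>s l - t'\<close>, a shift \<open>s l\<close> different from \<open>t'\<close> would make the \<open>l\<close>-th diagonal entry of
  \<open>Z W\<close> zero. So all shifts are \<open>t'\<close>, the matrices \<open>Z\<close> and \<open>W\<close> are scalar and inverse to each other, and
  \<open>W\<close> maps the kernel of \<open>A\<close> onto that of \<open>B\<close>, which is what the next step needs.\<close>

lemma scalar_matrix_lift:
  fixes A B M :: "nat \<Rightarrow> nat \<Rightarrow> 'k::field mpol"
  assumes A: "\<And>k l. k < a \<Longrightarrow> l < a' \<Longrightarrow> A k l \<in> PR d \<and> homogeneous (A k l) (s l - t)"
    and B: "\<And>k l. k < b \<Longrightarrow> l < b' \<Longrightarrow> B k l \<in> PR d \<and> homogeneous (B k l) (t' - t)"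
    and M: "\<And>k l. k < b \<Longrightarrow> l < a \<Longrightarrow> M k l \<in> PR d \<and> homogeneous (M k l) 0"
    and M_inj: "\<And>u l. pvec d a u \<Longrightarrow> (\<And>k. k < b \<Longrightarrow> mat_vec a M u k = 0) \<Longrightarrow> l < a \<Longrightarrow> u l = 0"
    and M_im1: "\<And>u. pvec d a' u \<Longrightarrow> \<exists>w. pvec d b' w \<and> (\<forall>k<b. mat_vec a M (mat_vec a' A u) k = mat_vec b' B w k)"
    and M_im2: "\<And>w. pvec d b' w \<Longrightarrow> \<exists>u. pvec d a' u \<and> (\<forall>k<b. mat_vec a M (mat_vec a' A u) k = mat_vec b' B w k)"
    and kerA: "\<And>u l. pvec d a' u \<Longrightarrow> (\<And>k. k < a \<Longrightarrow> mat_vec a' A u k = 0) \<Longrightarrow> l < a' \<Longrightarrow> Poly_Mapping.lookup (u l) 0 = 0"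
    and kerB: "\<And>u l. pvec d b' u \<Longrightarrow> (\<And>k. k < b \<Longrightarrow> mat_vec b' B u k = 0) \<Longrightarrow> l < b' \<Longrightarrow> Poly_Mapping.lookup (u l) 0 = 0"
  obtains W where "\<And>l. l < a' \<Longrightarrow> s l = t'"
    and "\<And>k l. k < b' \<Longrightarrow> l < a' \<Longrightarrow> W k l \<in> PR d \<and> homogeneous (W k l) 0"
    and "\<And>u l. pvec d a' u \<Longrightarrow> (\<And>k. k < b' \<Longrightarrow> mat_vec a' W u k = 0) \<Longrightarrow> l < a' \<Longrightarrow> u l = 0"
    and "\<And>u k. pvec d a' u \<Longrightarrow> (\<And>k. k < a \<Longrightarrow> mat_vec a' A u k = 0) \<Longrightarrow> k < b \<Longrightarrow> mat_vec b' B (mat_vec a' W u) k = 0"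
    and "\<And>w. pvec d b' w \<Longrightarrow> (\<And>k. k < b \<Longrightarrow> mat_vec b' B w k = 0) \<Longrightarrow>
           \<exists>u. pvec d a' u \<and> (\<forall>k<a. mat_vec a' A u k = 0) \<and> (\<forall>k<b'. mat_vec a' W u k = w k)"
proof -
  have "\<exists>w. \<forall>l<a'. pvec d b' (w l) \<and> (\<forall>k<b. mat_vec a M (mat_vec a' A (unit_vec l)) k = mat_vec b' B (w l) k)"
    using M_im1[OF pvec_unit] by metis
  then obtain w where w: "\<And>l. l < a' \<Longrightarrow> pvec d b' (w l)"
    and w_eq: "\<And>l k. l < a' \<Longrightarrow> k < b \<Longrightarrow> mat_vec a M (mat_vec a' A (unit_vec l)) k = mat_vec b' B (w l) k"
    by blast
  have "\<exists>z. \<forall>l<b'. pvec d a' (z l) \<and> (\<forall>k<b. mat_vec a M (mat_vec a' A (z l)) k = mat_vec b' B (unit_vec l) k)"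
    using M_im2[OF pvec_unit] by metis
  then obtain z where z: "\<And>l. l < b' \<Longrightarrow> pvec d a' (z l)"
    and z_eq: "\<And>l k. l < b' \<Longrightarrow> k < b \<Longrightarrow> mat_vec a M (mat_vec a' A (z l)) k = mat_vec b' B (unit_vec l) k"
    by blast
  define W where "W j l = hcomp (s l - t') (w l j)" for j l
  define Z where "Z j l = hcomp (t' - s j) (z l j)" for j l
  have W: "W j l \<in> PR d" "homogeneous (W j l) (s l - t')" if "j < b'" "l < a'" for j l
    using w that by (auto simp: W_def pvec_def)
  have Z: "Z j l \<in> PR d" "homogeneous (Z j l) (t' - s j)" if "j < a'" "l < b'" for j l
    using z that by (auto simp: Z_def pvec_def)
  have MA: "mat_vec a M (\<lambda>i. A i l) k = mat_vec b' B (\<lambda>j. W j l) k" if "k < b" "l < a'" for k l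
  proof -
    have "mat_vec a M (\<lambda>i. A i l) k = mat_vec b' B (w l) k"
    proof -
      have "mat_vec a' A (unit_vec l) = (\<lambda>i. A i l)" using that by (intro ext mat_vec_unit)
      then show ?thesis using w_eq[OF that(2,1)] by simp
    qed
    moreover have "homogeneous (mat_vec a M (\<lambda>i. A i l) k) (s l - t)"
      unfolding mat_vec_def using homogeneous_mult[of "M k _" 0] M A that by (intro homogeneous_sum) fastforce
    ultimately have "mat_vec a M (\<lambda>i. A i l) k = hcomp (s l - t) (mat_vec b' B (w l) k)"
      by (metis hcomp_homogeneous)
    also have "\<dots> = mat_vec b' B (\<lambda>j. W j l) k"
      unfolding mat_vec_def hcomp_sum using that B
      by (intro sum.cong refl) (simp add: hcomp_mult[of _ "t' - t"] W_def)
    finally show ?thesis .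
  qed
  have BZ: "B k l = mat_vec a M (mat_vec a' A (\<lambda>j. Z j l)) k" if "k < b" "l < b'" for k l
  proof -
    have "B k l = hcomp (t' - t) (mat_vec a M (mat_vec a' A (z l)) k)"
      using z_eq[OF that(2,1)] that B[OF that] by (simp add: mat_vec_unit hcomp_homogeneous)
    also have "\<dots> = mat_vec a M (mat_vec a' A (\<lambda>j. Z j l)) k"
      unfolding mat_vec_def hcomp_sum
    proof (intro sum.cong refl)
      fix i assume i: "i \<in> {..<a}"
      have "hcomp (t' - t) (M k i * (\<Sum>j<a'. A i j * z l j)) = M k i * (\<Sum>j<a'. hcomp (t' - t) (A i j * z l j))"
        using M[OF that(1), of i] i by (simp add: hcomp_mult[of _ 0] hcomp_sum)
      also have "(\<Sum>j<a'. hcomp (t' - t) (A i j * z l j)) = (\<Sum>j<a'. A i j * Z j l)"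
        by (intro sum.cong refl, subst hcomp_mult[where t = "s _ - t"]) (use A[of i] i in \<open>auto simp: Z_def\<close>)
      finally show "hcomp (t' - t) (M k i * (\<Sum>j<a'. A i j * z l j)) = M k i * (\<Sum>j<a'. A i j * Z j l)" .
    qed
    finally show ?thesis .
  qed
  have MA_u: "mat_vec a M (mat_vec a' A u) k = mat_vec b' B (mat_vec a' W u) k" if "k < b" for u k
    unfolding mat_vec_mv using MA[OF that] by (auto simp: mat_vec_def intro!: sum.cong)
  have MAZ_u: "mat_vec a M (mat_vec a' A (mat_vec b' Z u)) k = mat_vec b' B u k" if "k < b" for u k
    unfolding mat_vec_mv using BZ[OF that] unfolding mat_vec_mv by (auto simp: mat_vec_def intro!: sum.cong)
  have pA: "pvec d a (mat_vec a' A u)" if "pvec d a' u" for u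
    using that A by (auto simp: pvec_def[of d a] intro!: PR_mat_vec)
  have pW: "pvec d b' (mat_vec a' W u)" if "pvec d a' u" for u
    using that W by (auto simp: pvec_def[of d b'] intro!: PR_mat_vec)
  have pZ: "pvec d a' (mat_vec b' Z u)" if "pvec d b' u" for u
    using that Z by (auto simp: pvec_def[of d a'] intro!: PR_mat_vec)
  have A_inj: "mat_vec a' A u k = 0" if "pvec d a' u" "\<And>k. k < b \<Longrightarrow> mat_vec b' B (mat_vec a' W u) k = 0" "k < a" for u k
    by (rule M_inj[OF pA[OF that(1)] _ that(3)]) (use that MA_u in simp)
  have dA: "mat_vec b' Z (\<lambda>k. W k l) j - unit_vec l j \<in> PR d" if "l < a'" "j < a'" for l j
    using that W Z by (intro PR_diff PR_mat_vec) (auto simp: pvec_def)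
  have ZW_ker: "Poly_Mapping.lookup (mat_vec b' Z (\<lambda>k. W k l) j - unit_vec l j) 0 = 0" if "l < a'" "j < a'" for l j
  proof (rule kerA[of "\<lambda>j. mat_vec b' Z (\<lambda>k. W k l) j - unit_vec l j"])
    show p: "pvec d a' (\<lambda>j. mat_vec b' Z (\<lambda>k. W k l) j - unit_vec l j)"
      using dA that by (simp add: pvec_def)
    fix k assume k: "k < a"
    show "mat_vec a' A (\<lambda>j. mat_vec b' Z (\<lambda>k. W k l) j - unit_vec l j) k = 0"
    proof (rule M_inj[OF pA[OF p] _ k])
      fix k assume k: "k < b"
      have "mat_vec a M (mat_vec a' A (\<lambda>j. mat_vec b' Z (\<lambda>k. W k l) j - unit_vec l j)) k =
          mat_vec a M (\<lambda>i. mat_vec a' A (mat_vec b' Z (\<lambda>k. W k l)) i - mat_vec a' A (unit_vec l) i) k"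
        by (simp only: mat_vec_diff')
      also have "\<dots> = mat_vec a M (mat_vec a' A (mat_vec b' Z (\<lambda>k. W k l))) k - mat_vec a M (\<lambda>i. A i l) k"
        using that by (simp add: mat_vec_diff mat_vec_unit)
      also have "\<dots> = 0" using MAZ_u[OF k] MA[OF k that(1)] by simp
      finally show "mat_vec a M (mat_vec a' A (\<lambda>j. mat_vec b' Z (\<lambda>k. W k l) j - unit_vec l j)) k = 0" .
    qed
  qed (use that in auto)
  \<comment> \<open>A homogeneous polynomial of negative degree vanishes, and one of the two degrees is negative.\<close>
  have st: "s l = t'" if l: "l < a'" for l
  proof (rule ccontr)
    assume "s l \<noteq> t'"
    then have "Z l k * W k l = 0" if "k < b'" for k
      using Z(2)[OF l that] W(2)[OF that l] homogeneous_negative[of "Z l k" "t' - s l"]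
        homogeneous_negative[of "W k l" "s l - t'"] by (cases "s l < t'") auto
    then have "mat_vec b' Z (\<lambda>k. W k l) l = 0" unfolding mat_vec_def by (intro sum.neutral) auto
    then show False using ZW_ker[OF l l] by (simp add: lookup_minus)
  qed
  have W0: "homogeneous (W j l) 0" if "j < b'" "l < a'" for j l
    using W(2)[OF that] st[OF that(2)] by simp
  have Z0: "homogeneous (Z j l) 0" if "j < a'" "l < b'" for j l
    using Z(2)[OF that] st[OF that(1)] by simp
  have const0: "x = 0" if "homogeneous x 0" "Poly_Mapping.lookup x 0 = 0" for x :: "'k mpol"
    using homogeneous_0_eq_const[OF that(1)] that(2) by simp
  have ZW: "mat_vec b' Z (\<lambda>k. W k l) j = unit_vec l j" if "l < a'" "j < a'" for l j
  proof -
    have "homogeneous (Z j k * W k l) 0" if "k < b'" for k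
      using homogeneous_mult[OF Z0 W0, of j k k l] that \<open>l < a'\<close> \<open>j < a'\<close> by simp
    then have "homogeneous (mat_vec b' Z (\<lambda>k. W k l) j - unit_vec l j) 0"
      unfolding mat_vec_def by (intro homogeneous_diff homogeneous_sum) auto
    from const0[OF this ZW_ker[OF that]] show ?thesis by simp
  qed
  have WZ: "mat_vec a' W (\<lambda>k. Z k l) j = unit_vec l j" if "l < b'" "j < b'" for l j
  proof -
    have "homogeneous (W j k * Z k l) 0" if "k < a'" for k
      using homogeneous_mult[OF W0 Z0, of j k k l] that \<open>l < b'\<close> \<open>j < b'\<close> by simp
    then have h: "homogeneous (mat_vec a' W (\<lambda>k. Z k l) j - unit_vec l j) 0"
      unfolding mat_vec_def by (intro homogeneous_diff homogeneous_sum) auto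
    have "Poly_Mapping.lookup (mat_vec a' W (\<lambda>k. Z k l) j - unit_vec l j) 0 = 0"
    proof (rule kerB[of "\<lambda>j. mat_vec a' W (\<lambda>k. Z k l) j - unit_vec l j"])
      show "pvec d b' (\<lambda>j. mat_vec a' W (\<lambda>k. Z k l) j - unit_vec l j)"
        using that W Z by (auto simp: pvec_def intro!: PR_diff PR_mat_vec)
      fix k assume k: "k < b"
      show "mat_vec b' B (\<lambda>j. mat_vec a' W (\<lambda>k. Z k l) j - unit_vec l j) k = 0"
        using MA_u[OF k, of "\<lambda>k. Z k l"] BZ[OF k that(1)] that by (simp add: mat_vec_diff mat_vec_unit)
    qed (use that in auto)
    from const0[OF h this] show ?thesis by simp
  qed
  have ZW_u: "mat_vec b' Z (mat_vec a' W u) j = u j" if "j < a'" for u j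
  proof -
    have "mat_vec b' Z (mat_vec a' W u) j = (\<Sum>l<a'. unit_vec l j * u l)"
      unfolding mat_vec_mv using ZW[OF _ that] by (auto simp: mat_vec_def intro!: sum.cong)
    also have "\<dots> = u j" using that by (simp add: if_distrib[of "\<lambda>x. x * _"] cong: if_cong)
    finally show ?thesis .
  qed
  have WZ_u: "mat_vec a' W (mat_vec b' Z u) j = u j" if "j < b'" for u j
  proof -
    have "mat_vec a' W (mat_vec b' Z u) j = (\<Sum>l<b'. unit_vec l j * u l)"
      unfolding mat_vec_mv using WZ[OF _ that] by (auto simp: mat_vec_def intro!: sum.cong)
    also have "\<dots> = u j" using that by (simp add: if_distrib[of "\<lambda>x. x * _"] cong: if_cong)
    finally show ?thesis .
  qed
  show thesis
  proof (rule that[of W])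
    show "s l = t'" if "l < a'" for l by (rule st[OF that])
    show "W k l \<in> PR d \<and> homogeneous (W k l) 0" if "k < b'" "l < a'" for k l
      using W W0 that by blast
    show "u l = 0" if "pvec d a' u" "\<And>k. k < b' \<Longrightarrow> mat_vec a' W u k = 0" "l < a'" for u l
    proof -
      have "u l = mat_vec b' Z (mat_vec a' W u) l" using ZW_u that by simp
      also have "\<dots> = mat_vec b' Z (\<lambda>_. 0) l" by (rule mat_vec_cong) (use that in auto)
      finally show ?thesis by simp
    qed
    show "mat_vec b' B (mat_vec a' W u) k = 0" if "pvec d a' u" "\<And>k. k < a \<Longrightarrow> mat_vec a' A u k = 0" "k < b" for u k
    proof -
      have "mat_vec b' B (mat_vec a' W u) k = mat_vec a M (\<lambda>_. 0) k"
        unfolding MA_u[OF that(3), symmetric] by (rule mat_vec_cong) (use that in auto)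
      then show ?thesis by simp
    qed
    show "\<exists>u. pvec d a' u \<and> (\<forall>k<a. mat_vec a' A u k = 0) \<and> (\<forall>k<b'. mat_vec a' W u k = w k)"
      if "pvec d b' w" "\<And>k. k < b \<Longrightarrow> mat_vec b' B w k = 0" for w
    proof (intro exI[of _ "mat_vec b' Z w"] conjI allI impI)
      show p: "pvec d a' (mat_vec b' Z w)" by (rule pZ[OF that(1)])
      show "mat_vec a' W (mat_vec b' Z w) k = w k" if "k < b'" for k by (rule WZ_u[OF that])
      show "mat_vec a' A (mat_vec b' Z w) k = 0" if "k < a" for k
        by (rule M_inj[OF pA[OF p] _ that]) (use MAZ_u \<open>\<And>k. k < b \<Longrightarrow> mat_vec b' B w k = 0\<close> in simp)
    qed
  qed
qed

text \<open>The two resolutions are compared step by step, starting from the identity of the ring; \<open>\<Phi> p M\<close>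
  collects what the lifting step needs to know about the scalar matrix \<open>M\<close> between the modules of
  index \<open>p\<close>.\<close>

lemma min_res_shifts:
  fixes A B :: "nat \<Rightarrow> nat \<Rightarrow> nat \<Rightarrow> 'k::field mpol"
  assumes A: "graded_res d J \<rho> A s" "min_res \<rho> A" and B: "lin_res d q J \<sigma> B"
    and "l < \<rho> (Suc p)"
  shows "s (Suc p) l = q + int p"
proof -
  define t where "t = (\<lambda>p. if p = 0 then 0 else q + int p - 1)"
  define \<Phi> where "\<Phi> p M \<longleftrightarrow> (\<forall>l<\<rho> p. s p l = t p)
     \<and> (\<forall>k<\<sigma> p. \<forall>l<\<rho> p. M k l \<in> PR d \<and> homogeneous (M k l) 0)
     \<and> (\<forall>u. pvec d (\<rho> p) u \<longrightarrow> (\<forall>k<\<sigma> p. mat_vec (\<rho> p) M u k = 0) \<longrightarrow> (\<forall>l<\<rho> p. u l = 0))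
     \<and> (\<forall>u. pvec d (\<rho> (Suc p)) u \<longrightarrow> (\<exists>w. pvec d (\<sigma> (Suc p)) w \<and> (\<forall>k<\<sigma> p. mat_vec (\<rho> p) M (mat_vec (\<rho> (Suc p)) (A p) u) k = mat_vec (\<sigma> (Suc p)) (B p) w k)))
     \<and> (\<forall>w. pvec d (\<sigma> (Suc p)) w \<longrightarrow> (\<exists>u. pvec d (\<rho> (Suc p)) u \<and> (\<forall>k<\<sigma> p. mat_vec (\<rho> p) M (mat_vec (\<rho> (Suc p)) (A p) u) k = mat_vec (\<sigma> (Suc p)) (B p) w k)))"
    for p and M :: "nat \<Rightarrow> nat \<Rightarrow> 'k mpol"
  have B': "graded_res d J \<sigma> B (\<lambda>p _. t p)" using B by (simp add: lin_res_def t_def)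
  note Ah = graded_res_entry[OF A(1)] and eA = graded_res_exact[OF A(1)] and JA = graded_res_image[OF A(1)]
  note Bh = graded_res_entry[OF B'] and eB = graded_res_exact[OF B'] and JB = graded_res_image[OF B']
  note base = graded_res_base[OF A(1)] graded_res_base[OF B']
  have kA: "\<And>p u l. pvec d (\<rho> (Suc p)) u \<Longrightarrow> (\<And>k. k < \<rho> p \<Longrightarrow> mat_vec (\<rho> (Suc p)) (A p) u k = 0) \<Longrightarrow> l < \<rho> (Suc p) \<Longrightarrow> Poly_Mapping.lookup (u l) 0 = 0"
    by (rule min_res_kernel[OF A])
  have kB: "\<And>p u l. pvec d (\<sigma> (Suc p)) u \<Longrightarrow> (\<And>k. k < \<sigma> p \<Longrightarrow> mat_vec (\<sigma> (Suc p)) (B p) u k = 0) \<Longrightarrow> l < \<sigma> (Suc p) \<Longrightarrow> Poly_Mapping.lookup (u l) 0 = 0"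
    by (rule min_res_kernel[OF B' lin_res_min[OF B]])
  have "\<exists>M. \<Phi> p M" for p
  proof (induction p)
    case 0
    have 1: "mat_vec (Suc 0) (\<lambda>_ _. 1) u k = u 0" for u :: "nat \<Rightarrow> 'k mpol" and k
      by (simp add: mat_vec_def)
    have "\<Phi> 0 (\<lambda>_ _. 1)"
      unfolding \<Phi>_def using JA[symmetric] JB[symmetric] by (simp add: base t_def 1) metis
    then show ?case by (rule exI[of "\<Phi> 0"])
  next
    case (Suc p)
    then obtain M where M: "\<Phi> p M" ..
    note M_parts = M[unfolded \<Phi>_def, THEN conjunct1] M[unfolded \<Phi>_def, THEN conjunct2, THEN conjunct1]
      M[unfolded \<Phi>_def, THEN conjunct2, THEN conjunct2, THEN conjunct1]
      M[unfolded \<Phi>_def, THEN conjunct2, THEN conjunct2, THEN conjunct2, THEN conjunct1]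
      M[unfolded \<Phi>_def, THEN conjunct2, THEN conjunct2, THEN conjunct2, THEN conjunct2]
    have "\<exists>W. \<Phi> (Suc p) W"
    proof (rule scalar_matrix_lift[where A = "A p" and B = "B p" and M = M and a = "\<rho> p" and a' = "\<rho> (Suc p)"
          and b = "\<sigma> p" and b' = "\<sigma> (Suc p)" and t = "t p" and t' = "t (Suc p)" and s = "s (Suc p)" and d = d])
      show "A p k l \<in> PR d \<and> homogeneous (A p k l) (s (Suc p) l - t p)" if "k < \<rho> p" "l < \<rho> (Suc p)" for k l
        using Ah[OF that] M_parts(1) that by simp
      fix W assume W: "\<And>l. l < \<rho> (Suc p) \<Longrightarrow> s (Suc p) l = t (Suc p)"
        "\<And>k l. k < \<sigma> (Suc p) \<Longrightarrow> l < \<rho> (Suc p) \<Longrightarrow> W k l \<in> PR d \<and> homogeneous (W k l) 0"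
        "\<And>u l. pvec d (\<rho> (Suc p)) u \<Longrightarrow> (\<And>k. k < \<sigma> (Suc p) \<Longrightarrow> mat_vec (\<rho> (Suc p)) W u k = 0) \<Longrightarrow> l < \<rho> (Suc p) \<Longrightarrow> u l = 0"
        and W1: "\<And>u k. pvec d (\<rho> (Suc p)) u \<Longrightarrow> (\<And>k. k < \<rho> p \<Longrightarrow> mat_vec (\<rho> (Suc p)) (A p) u k = 0) \<Longrightarrow> k < \<sigma> p \<Longrightarrow> mat_vec (\<sigma> (Suc p)) (B p) (mat_vec (\<rho> (Suc p)) W u) k = 0"
        and W2: "\<And>w. pvec d (\<sigma> (Suc p)) w \<Longrightarrow> (\<And>k. k < \<sigma> p \<Longrightarrow> mat_vec (\<sigma> (Suc p)) (B p) w k = 0) \<Longrightarrow>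
           \<exists>u. pvec d (\<rho> (Suc p)) u \<and> (\<forall>k<\<rho> p. mat_vec (\<rho> (Suc p)) (A p) u k = 0) \<and> (\<forall>k<\<sigma> (Suc p). mat_vec (\<rho> (Suc p)) W u k = w k)"
      have pA: "pvec d (\<rho> (Suc p)) (mat_vec (\<rho> (Suc (Suc p))) (A (Suc p)) u)" if "pvec d (\<rho> (Suc (Suc p))) u" for u
        using that Ah by (auto simp: pvec_def[of d "\<rho> (Suc p)"] intro!: PR_mat_vec)
      have pB: "pvec d (\<sigma> (Suc p)) (mat_vec (\<sigma> (Suc (Suc p))) (B (Suc p)) u)" if "pvec d (\<sigma> (Suc (Suc p))) u" for u
        using that Bh by (auto simp: pvec_def[of d "\<sigma> (Suc p)"] intro!: PR_mat_vec)
      have pW: "pvec d (\<sigma> (Suc p)) (mat_vec (\<rho> (Suc p)) W u)" if "pvec d (\<rho> (Suc p)) u" for u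
        using that W(2) by (auto simp: pvec_def[of d "\<sigma> (Suc p)"] intro!: PR_mat_vec)
      have im1: "\<exists>w. pvec d (\<sigma> (Suc (Suc p))) w \<and> (\<forall>k<\<sigma> (Suc p). mat_vec (\<rho> (Suc p)) W (mat_vec (\<rho> (Suc (Suc p))) (A (Suc p)) u) k = mat_vec (\<sigma> (Suc (Suc p))) (B (Suc p)) w k)"
        if "pvec d (\<rho> (Suc (Suc p))) u" for u
        using eA[OF pA[OF that]] eB[OF pW[OF pA[OF that]]] W1[OF pA[OF that]] that by blast
      have im2: "\<exists>u. pvec d (\<rho> (Suc (Suc p))) u \<and> (\<forall>k<\<sigma> (Suc p). mat_vec (\<rho> (Suc p)) W (mat_vec (\<rho> (Suc (Suc p))) (A (Suc p)) u) k = mat_vec (\<sigma> (Suc (Suc p))) (B (Suc p)) w k)"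
        if "pvec d (\<sigma> (Suc (Suc p))) w" for w
      proof -
        note Bw = pB[OF that]
        have "\<forall>k<\<sigma> p. mat_vec (\<sigma> (Suc p)) (B p) (mat_vec (\<sigma> (Suc (Suc p))) (B (Suc p)) w) k = 0"
          using eB[OF pB[OF that]] that by blast
        then obtain v where v: "pvec d (\<rho> (Suc p)) v" "\<forall>k<\<rho> p. mat_vec (\<rho> (Suc p)) (A p) v k = 0"
          "\<forall>k<\<sigma> (Suc p). mat_vec (\<rho> (Suc p)) W v k = mat_vec (\<sigma> (Suc (Suc p))) (B (Suc p)) w k"
          using W2[OF Bw] by blast
        obtain u where u: "pvec d (\<rho> (Suc (Suc p))) u" "\<forall>k<\<rho> (Suc p). v k = mat_vec (\<rho> (Suc (Suc p))) (A (Suc p)) u k"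
          using eA[OF v(1)] v(2) by blast
        have "mat_vec (\<rho> (Suc p)) W (mat_vec (\<rho> (Suc (Suc p))) (A (Suc p)) u) k = mat_vec (\<rho> (Suc p)) W v k" for k
          by (rule mat_vec_cong) (use u in auto)
        then show ?thesis using u(1) v(3) by auto
      qed
      have "\<Phi> (Suc p) W"
        unfolding \<Phi>_def using W im1 im2 by (intro conjI allI impI) simp_all
      then show ?thesis by (rule exI[of "\<Phi> (Suc p)"])
    next
      show "B p k l \<in> PR d \<and> homogeneous (B p k l) (t (Suc p) - t p)" if "k < \<sigma> p" "l < \<sigma> (Suc p)" for k l
        using Bh[OF that] .
      show "M k l \<in> PR d \<and> homogeneous (M k l) 0" if "k < \<sigma> p" "l < \<rho> p" for k l
        using M_parts(2) that by simp
      show "u l = 0" if "pvec d (\<rho> p) u" "\<And>k. k < \<sigma> p \<Longrightarrow> mat_vec (\<rho> p) M u k = 0" "l < \<rho> p" for u l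
        using M_parts(3) that by simp
      show "\<exists>w. pvec d (\<sigma> (Suc p)) w \<and> (\<forall>k<\<sigma> p. mat_vec (\<rho> p) M (mat_vec (\<rho> (Suc p)) (A p) u) k = mat_vec (\<sigma> (Suc p)) (B p) w k)"
        if "pvec d (\<rho> (Suc p)) u" for u
        using M_parts(4) that by simp
      show "\<exists>u. pvec d (\<rho> (Suc p)) u \<and> (\<forall>k<\<sigma> p. mat_vec (\<rho> p) M (mat_vec (\<rho> (Suc p)) (A p) u) k = mat_vec (\<sigma> (Suc p)) (B p) w k)"
        if "pvec d (\<sigma> (Suc p)) w" for w
        using M_parts(5) that by simp
      show "Poly_Mapping.lookup (u l) 0 = 0" if "pvec d (\<rho> (Suc p)) u" "\<And>k. k < \<rho> p \<Longrightarrow> mat_vec (\<rho> (Suc p)) (A p) u k = 0" "l < \<rho> (Suc p)" for u l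
        by (rule kA[OF that])
      show "Poly_Mapping.lookup (u l) 0 = 0" if "pvec d (\<sigma> (Suc p)) u" "\<And>k. k < \<sigma> p \<Longrightarrow> mat_vec (\<sigma> (Suc p)) (B p) u k = 0" "l < \<sigma> (Suc p)" for u l
        by (rule kB[OF that])
    qed
    then show ?case .
  qed
  then obtain M where "\<Phi> (Suc p) M" by blast
  then have "\<forall>l<\<rho> (Suc p). s (Suc p) l = t (Suc p)" unfolding \<Phi>_def by (elim conjE)
  then show ?thesis using assms(4) by (simp add: t_def)
qed


lemma lin_res_imp_min_resolution:
  assumes "lin_res d q J \<rho> A"
  shows "\<exists>F. minimal_graded_free_resolution d J F"
proof -
  define t where "t = (\<lambda>p. if p = 0 then 0 else q + int p - 1)"
  have r: "graded_res d J \<rho> A (\<lambda>p _. t p)" using assms by (simp add: lin_res_def t_def)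
  note e = graded_res_entry[OF r] and ex = graded_res_exact[OF r] and im = graded_res_image[OF r]
    and base = graded_res_base[OF r]
  define F where "F = \<lparr>rk = (\<lambda>p. \<rho> (Suc p)), shift = (\<lambda>p _. t (Suc p)), aug = A 0 0, dif = (\<lambda>p. A (Suc p))\<rparr>"
  have pv: "pvec d r u" if "u \<in> free_mod d r" for r and u :: "nat \<Rightarrow> 'a mpol"
    using that by (auto simp: free_mod_def pvec_def)
  have fm: "restrict u {..<r} \<in> free_mod d r" if "pvec d r u" for r and u :: "nat \<Rightarrow> 'a mpol"
    using that by (auto simp: free_mod_def pvec_def)
  have aug: "aug_map F u = mat_vec (\<rho> (Suc 0)) (A 0) u 0" for u
    by (simp add: aug_map_def F_def mat_vec_def)
  have dif: "dif_map F p u = restrict (mat_vec (\<rho> (Suc (Suc p))) (A (Suc p)) u) {..<\<rho> (Suc p)}" for p u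
    by (simp add: dif_map_def F_def mat_vec_def restrict_def fun_eq_iff)
  have image_J: "aug_map F ` free_mod d (rk F 0) = J"
  proof (intro equalityI subsetI)
    fix x assume "x \<in> aug_map F ` free_mod d (rk F 0)"
    then obtain u where "u \<in> free_mod d (\<rho> 1)" "x = mat_vec (\<rho> 1) (A 0) u 0" by (auto simp: F_def aug[unfolded F_def])
    then show "x \<in> J" using im pv by blast
  next
    fix x assume "x \<in> J"
    then obtain u where u: "pvec d (\<rho> 1) u" "x = mat_vec (\<rho> 1) (A 0) u 0" using im by blast
    then have "x = aug_map F (restrict u {..<\<rho> (Suc 0)})"
      unfolding aug by (auto intro!: mat_vec_cong)
    then show "x \<in> aug_map F ` free_mod d (rk F 0)"
      using fm[OF u(1)] by (auto simp: F_def)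
  qed
  have image_dif: "dif_map F p ` free_mod d (\<rho> (Suc (Suc p))) =
      {u \<in> free_mod d (\<rho> (Suc p)). \<forall>k<\<rho> p. mat_vec (\<rho> (Suc p)) (A p) u k = 0}" (is "?L = ?R") for p
  proof (intro equalityI subsetI)
    fix u assume "u \<in> ?L"
    then obtain w where w: "w \<in> free_mod d (\<rho> (Suc (Suc p)))" "u = dif_map F p w" by blast
    have "pvec d (\<rho> (Suc p)) u"
      using e[of _ "Suc p"] pv[OF w(1)] by (auto simp: w(2) dif pvec_def[of d "\<rho> (Suc p)"] intro!: PR_mat_vec)
    moreover have "\<exists>w. pvec d (\<rho> (Suc (Suc p))) w \<and> (\<forall>k<\<rho> (Suc p). u k = mat_vec (\<rho> (Suc (Suc p))) (A (Suc p)) w k)"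
      using pv[OF w(1)] by (intro exI[of _ w]) (simp add: w(2) dif)
    moreover have "u \<in> extensional {..<\<rho> (Suc p)}" by (simp add: w(2) dif)
    ultimately show "u \<in> ?R" using ex[of p u] by (auto simp: free_mod_def pvec_def PiE_def)
  next
    fix u assume "u \<in> ?R"
    then have u: "u \<in> free_mod d (\<rho> (Suc p))" "\<forall>k<\<rho> p. mat_vec (\<rho> (Suc p)) (A p) u k = 0" by auto
    obtain w where w: "pvec d (\<rho> (Suc (Suc p))) w" "\<forall>k<\<rho> (Suc p). u k = mat_vec (\<rho> (Suc (Suc p))) (A (Suc p)) w k"
      using ex[OF pv[OF u(1)]] u(2) by blast
    have "u = dif_map F p (restrict w {..<\<rho> (Suc (Suc p))})"
    proof
      fix k
      show "u k = dif_map F p (restrict w {..<\<rho> (Suc (Suc p))}) k"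
      proof (cases "k < \<rho> (Suc p)")
        case True
        then have "u k = mat_vec (\<rho> (Suc (Suc p))) (A (Suc p)) w k" using w(2) by blast
        also have "\<dots> = mat_vec (\<rho> (Suc (Suc p))) (A (Suc p)) (restrict w {..<\<rho> (Suc (Suc p))}) k"
          by (rule mat_vec_cong) simp
        finally show ?thesis using True by (simp add: dif)
      qed (use u(1) in \<open>auto simp: dif free_mod_def PiE_def extensional_def\<close>)
    qed
    then show "u \<in> ?L" using fm[OF w(1)] by blast
  qed
  have "graded_free_resolution d J F"
    unfolding graded_free_resolution_def
  proof (intro conjI)
    show "\<forall>l<rk F 0. aug F l \<in> PR d \<and> homogeneous (aug F l) (shift F 0 l)"
      using e[of 0 0] by (simp add: F_def base t_def)
    show "\<forall>p. \<forall>k<rk F p. \<forall>l<rk F (Suc p). dif F p k l \<in> PR d \<and> homogeneous (dif F p k l) (shift F (Suc p) l - shift F p k)"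
      using e by (simp add: F_def)
    show "dif_map F 0 ` free_mod d (rk F 1) = {u \<in> free_mod d (rk F 0). aug_map F u = 0}"
      using image_dif[of 0] by (simp add: F_def base aug[unfolded F_def])
    show "\<forall>p. dif_map F (Suc p) ` free_mod d (rk F (Suc (Suc p))) =
        {u \<in> free_mod d (rk F (Suc p)). \<forall>k<rk F p. dif_map F p u k = 0}"
    proof
      fix p
      show "dif_map F (Suc p) ` free_mod d (rk F (Suc (Suc p))) =
        {u \<in> free_mod d (rk F (Suc p)). \<forall>k<rk F p. dif_map F p u k = 0}"
        unfolding dif[of p] using image_dif[of "Suc p"] by (simp add: F_def)
    qed
  qed (rule image_J)
  then have "minimal_graded_free_resolution d J F"
    using lin_res_min[OF assms] by (simp add: minimal_graded_free_resolution_def F_def min_res_def)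
  then show ?thesis ..
qed

lemma min_resolution_imp_graded_res:
  assumes "minimal_graded_free_resolution d J F"
  defines "\<rho> \<equiv> case_nat 1 (rk F)" and "A \<equiv> case_nat (\<lambda>_. aug F) (dif F)"
    and "s \<equiv> case_nat (\<lambda>_. 0) (shift F)"
  shows "graded_res d J \<rho> A s" "min_res \<rho> A"
proof -
  have F: "graded_free_resolution d J F"
    and Fm: "\<forall>p. \<forall>k<rk F p. \<forall>l<rk F (Suc p). Poly_Mapping.lookup (dif F p k l) 0 = 0"
    using assms(1) by (auto simp: minimal_graded_free_resolution_def)
  have aug: "\<forall>l<rk F 0. aug F l \<in> PR d \<and> homogeneous (aug F l) (shift F 0 l)"
    and dif: "\<forall>p. \<forall>k<rk F p. \<forall>l<rk F (Suc p). dif F p k l \<in> PR d \<and>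
        homogeneous (dif F p k l) (shift F (Suc p) l - shift F p k)"
    and im: "aug_map F ` free_mod d (rk F 0) = J"
    and ex0: "dif_map F 0 ` free_mod d (rk F 1) = {u \<in> free_mod d (rk F 0). aug_map F u = 0}"
    and exS: "\<forall>p. dif_map F (Suc p) ` free_mod d (rk F (Suc (Suc p))) =
        {u \<in> free_mod d (rk F (Suc p)). \<forall>k<rk F p. dif_map F p u k = 0}"
    using F[unfolded graded_free_resolution_def] by - (elim conjE, assumption)+
  have \<rho>S: "\<rho> (Suc p) = rk F p" and AS: "A (Suc p) = dif F p" and sS: "s (Suc p) = shift F p" for p
    by (simp_all add: \<rho>_def A_def s_def)
  have \<rho>0: "\<rho> 0 = 1" and A0: "A 0 0 = aug F" and s0: "s 0 k = 0" for k
    by (simp_all add: \<rho>_def A_def s_def)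
  have pv: "pvec d r u" if "u \<in> free_mod d r" for r and u :: "nat \<Rightarrow> 'a mpol"
    using that by (auto simp: free_mod_def pvec_def)
  have fm: "restrict u {..<r} \<in> free_mod d r" if "pvec d r u" for r and u :: "nat \<Rightarrow> 'a mpol"
    using that by (auto simp: free_mod_def pvec_def)
  have aug_mat_vec: "aug_map F u = mat_vec (\<rho> (Suc 0)) (A 0) u 0" for u
    by (simp add: aug_map_def A0 \<rho>S mat_vec_def)
  have dif_mat_vec: "dif_map F p u = restrict (mat_vec (\<rho> (Suc (Suc p))) (A (Suc p)) u) {..<\<rho> (Suc p)}" for p u
    by (simp add: dif_map_def AS \<rho>S mat_vec_def restrict_def fun_eq_iff)
  have image_dif: "dif_map F p ` free_mod d (\<rho> (Suc (Suc p))) =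
      {u \<in> free_mod d (\<rho> (Suc p)). \<forall>k<\<rho> p. mat_vec (\<rho> (Suc p)) (A p) u k = 0}" for p
  proof (cases p)
    case 0
    then show ?thesis using ex0 by (simp add: \<rho>S aug_mat_vec) (simp add: \<rho>S \<rho>0)
  next
    case (Suc q)
    have "dif_map F (Suc q) ` free_mod d (rk F (Suc (Suc q))) =
        {u \<in> free_mod d (rk F (Suc q)). \<forall>k<rk F q. dif_map F q u k = 0}" using exS by blast
    then show ?thesis unfolding dif_mat_vec[of q] by (simp add: Suc \<rho>S)
  qed
  show "min_res \<rho> A" using Fm by (simp add: min_res_def \<rho>S AS)
  show "graded_res d J \<rho> A s"
    unfolding graded_res_def
  proof (intro conjI allI impI)
    show "A p k l \<in> PR d" "homogeneous (A p k l) (s (Suc p) l - s p k)" if "k < \<rho> p" "l < \<rho> (Suc p)" for p k l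
      using that aug dif by (cases p; simp add: \<rho>S AS A0 \<rho>0 s0 sS)+
    fix x show "x \<in> J \<longleftrightarrow> (\<exists>u. pvec d (\<rho> 1) u \<and> x = mat_vec (\<rho> 1) (A 0) u 0)"
    proof
      assume "x \<in> J"
      then show "\<exists>u. pvec d (\<rho> 1) u \<and> x = mat_vec (\<rho> 1) (A 0) u 0"
        using im pv by (auto simp: aug_mat_vec \<rho>S)
    next
      assume "\<exists>u. pvec d (\<rho> 1) u \<and> x = mat_vec (\<rho> 1) (A 0) u 0"
      then obtain u where u: "pvec d (\<rho> 1) u" "x = mat_vec (\<rho> 1) (A 0) u 0" by blast
      then have "x = aug_map F (restrict u {..<\<rho> (Suc 0)})"
        unfolding aug_mat_vec by (auto intro!: mat_vec_cong)
      then show "x \<in> J" using fm[OF u(1)] im by (auto simp: \<rho>S)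
    qed
  next
    fix p and u :: "nat \<Rightarrow> 'a mpol" assume u: "pvec d (\<rho> (Suc p)) u"
    let ?u = "restrict u {..<\<rho> (Suc p)}"
    have mat_vec_u: "mat_vec (\<rho> (Suc p)) (A p) ?u k = mat_vec (\<rho> (Suc p)) (A p) u k" for k
      by (rule mat_vec_cong) simp
    show "(\<forall>k<\<rho> p. mat_vec (\<rho> (Suc p)) (A p) u k = 0) \<longleftrightarrow>
      (\<exists>w. pvec d (\<rho> (Suc (Suc p))) w \<and> (\<forall>k<\<rho> (Suc p). u k = mat_vec (\<rho> (Suc (Suc p))) (A (Suc p)) w k))"
    proof
      assume "\<forall>k<\<rho> p. mat_vec (\<rho> (Suc p)) (A p) u k = 0"
      then have "?u \<in> dif_map F p ` free_mod d (\<rho> (Suc (Suc p)))"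
        unfolding image_dif using fm[OF u] by (simp add: mat_vec_u)
      then obtain w where w: "w \<in> free_mod d (\<rho> (Suc (Suc p)))" "?u = dif_map F p w" by blast
      have "\<forall>k<\<rho> (Suc p). u k = mat_vec (\<rho> (Suc (Suc p))) (A (Suc p)) w k"
        using w(2) unfolding dif_mat_vec by (metis lessThan_iff restrict_apply')
      then show "\<exists>w. pvec d (\<rho> (Suc (Suc p))) w \<and> (\<forall>k<\<rho> (Suc p). u k = mat_vec (\<rho> (Suc (Suc p))) (A (Suc p)) w k)"
        using pv[OF w(1)] by blast
    next
      assume "\<exists>w. pvec d (\<rho> (Suc (Suc p))) w \<and> (\<forall>k<\<rho> (Suc p). u k = mat_vec (\<rho> (Suc (Suc p))) (A (Suc p)) w k)"
      then obtain w where w: "pvec d (\<rho> (Suc (Suc p))) w" "\<forall>k<\<rho> (Suc p). u k = mat_vec (\<rho> (Suc (Suc p))) (A (Suc p)) w k" by blast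
      have "mat_vec (\<rho> (Suc (Suc p))) (A (Suc p)) (restrict w {..<\<rho> (Suc (Suc p))}) k = mat_vec (\<rho> (Suc (Suc p))) (A (Suc p)) w k" for k
        by (rule mat_vec_cong) simp
      then have "?u = dif_map F p (restrict w {..<\<rho> (Suc (Suc p))})"
        using w(2) by (auto simp: dif_mat_vec restrict_def fun_eq_iff)
      then have "?u \<in> dif_map F p ` free_mod d (\<rho> (Suc (Suc p)))" using fm[OF w(1)] by blast
      then show "\<forall>k<\<rho> p. mat_vec (\<rho> (Suc p)) (A p) u k = 0"
        unfolding image_dif by (simp add: mat_vec_u)
    qed
  qed (simp_all add: \<rho>0 s0)
qed

text \<open>Betti numbers are defined through a chosen minimal resolution, of which only minimality is known. A linear
  resolution shows that there is something to choose from and determines the shifts of the choice.\<close>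

lemma lin_res_imp_linear_resolution:
  assumes "lin_res d (int n) J \<sigma> B" shows "linear_resolution d J n"
proof -
  define F where "F = (SOME F. minimal_graded_free_resolution d J F)"
  have F: "minimal_graded_free_resolution d J F"
    unfolding F_def by (rule someI_ex) (rule lin_res_imp_min_resolution[OF assms])
  have "shift F i k = int i + int n" if "k < rk F i" for i k
    using min_res_shifts[OF min_resolution_imp_graded_res[OF F] assms, of k i] that by simp
  then have "{k. k < rk F i \<and> shift F i k = j} = {}" if "j \<noteq> int i + int n" for i j
    using that by auto
  then show ?thesis
    by (simp add: linear_resolution_def graded_betti_def F_def[symmetric])
qed

section \<open>Ideals of the polynomial ring\<close>

lemma poly_ring_ops:
  "\<zero>\<^bsub>poly_ring d\<^esub> = 0" "x \<oplus>\<^bsub>poly_ring d\<^esub> y = x + y" "x \<otimes>\<^bsub>poly_ring d\<^esub> y = x * y"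
  by (simp_all add: poly_ring_def)

lemma ideal_PR_iff:
  "ideal I (poly_ring d) \<longleftrightarrow> I \<subseteq> PR d \<and> 0 \<in> I \<and> (\<forall>x\<in>I. \<forall>y\<in>I. x + y \<in> I) \<and> (\<forall>x\<in>I. \<forall>s\<in>PR d. s * x \<in> I)"
proof
  assume "ideal I (poly_ring d)"
  then interpret ideal I "poly_ring d" .
  show "I \<subseteq> PR d \<and> 0 \<in> I \<and> (\<forall>x\<in>I. \<forall>y\<in>I. x + y \<in> I) \<and> (\<forall>x\<in>I. \<forall>s\<in>PR d. s * x \<in> I)"
    using a_subset additive_subgroup.zero_closed[OF is_additive_subgroup]
      additive_subgroup.a_closed[OF is_additive_subgroup] I_l_closed
    by (auto simp: poly_ring_ops)
next
  assume I: "I \<subseteq> PR d \<and> 0 \<in> I \<and> (\<forall>x\<in>I. \<forall>y\<in>I. x + y \<in> I) \<and> (\<forall>x\<in>I. \<forall>s\<in>PR d. s * x \<in> I)"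
  interpret cring "poly_ring d" by (rule cring_poly_ring)
  have neg: "\<ominus>\<^bsub>poly_ring d\<^esub> x \<in> I" if "x \<in> I" for x
  proof -
    have "x \<in> PR d" using I that by blast
    then have "\<ominus>\<^bsub>poly_ring d\<^esub> x = - x"
      by (intro minus_equality) (auto simp: poly_ring_def)
    moreover have "- 1 * x \<in> I" using I that PR_uminus[OF PR_1] by blast
    ultimately show ?thesis by simp
  qed
  show "ideal I (poly_ring d)"
  proof (rule idealI)
    show "ring (poly_ring d)" by (rule ring_axioms)
    show "subgroup I (add_monoid (poly_ring d))"
      using I neg by (intro add.subgroupI) (auto simp: poly_ring_def a_inv_def)
    show "x \<otimes>\<^bsub>poly_ring d\<^esub> a \<in> I" "a \<otimes>\<^bsub>poly_ring d\<^esub> x \<in> I" if "a \<in> I" "x \<in> PR d" for a x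
      using I that by (auto simp: poly_ring_def mult.commute)
  qed
qed

lemma
  assumes "ideal I (poly_ring d)"
  shows ideal_PR_sub: "x \<in> I \<Longrightarrow> x \<in> PR d" and ideal_PR_0: "0 \<in> I"
    and ideal_PR_add: "x \<in> I \<Longrightarrow> y \<in> I \<Longrightarrow> x + y \<in> I"
    and ideal_PR_mult: "x \<in> I \<Longrightarrow> s \<in> PR d \<Longrightarrow> s * x \<in> I"
  using assms by (auto simp: ideal_PR_iff)

lemma ideal_PR_uminus: "ideal I (poly_ring d) \<Longrightarrow> x \<in> I \<Longrightarrow> - x \<in> I"
  using ideal_PR_mult[OF _ _ PR_uminus[OF PR_1]] by fastforce

lemma ideal_PR_diff: "ideal I (poly_ring d) \<Longrightarrow> x \<in> I \<Longrightarrow> y \<in> I \<Longrightarrow> x - y \<in> I"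
  using ideal_PR_add[of I d x "-y"] ideal_PR_uminus[of I d y] by simp

abbreviation ideal_gen :: "nat \<Rightarrow> 'k::field mpol set \<Rightarrow> 'k mpol set" where
  "ideal_gen d X \<equiv> genideal (poly_ring d) X"

lemma ideal_ideal_gen: "X \<subseteq> PR d \<Longrightarrow> ideal (ideal_gen d X) (poly_ring d)"
  using cring_poly_ring cring.axioms(1) ring.genideal_ideal by blast

lemma ideal_gen_base: "X \<subseteq> PR d \<Longrightarrow> x \<in> X \<Longrightarrow> x \<in> ideal_gen d X"
  using cring_poly_ring cring.axioms(1) ring.genideal_self by blast

lemma ideal_gen_minimal: "ideal I (poly_ring d) \<Longrightarrow> X \<subseteq> I \<Longrightarrow> ideal_gen d X \<subseteq> I"
  using cring_poly_ring cring.axioms(1) ring.genideal_minimal by blast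

lemma ideal_PR_zero: "ideal {0} (poly_ring d)"
  by (auto simp: ideal_PR_iff)

lemma ideal_gen_empty: "ideal_gen d {} = {0}"
proof
  show "ideal_gen d {} \<subseteq> {0}" by (rule ideal_gen_minimal[OF ideal_PR_zero]) simp
  show "{0} \<subseteq> ideal_gen d {}" using ideal_PR_0[OF ideal_ideal_gen[of "{}" d]] by simp
qed

lemma ideal_gen_insert:
  fixes X :: "'k::field mpol set"
  assumes "X \<subseteq> PR d" "g \<in> PR d"
  shows "ideal_gen d (insert g X) = {j + v * g |j v. j \<in> ideal_gen d X \<and> v \<in> PR d}" (is "_ = ?R")
proof
  note J = ideal_ideal_gen[OF assms(1)]
  have "ideal ?R (poly_ring d)"
    unfolding ideal_PR_iff
  proof (intro conjI ballI)
    show "?R \<subseteq> PR d" using ideal_PR_sub[OF J] assms(2) by auto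
    show "0 \<in> ?R" using ideal_PR_0[OF J] by (intro CollectI exI[of _ 0]) auto
    fix x assume "x \<in> ?R"
    then obtain j v where x: "x = j + v * g" "j \<in> ideal_gen d X" "v \<in> PR d" by blast
    {
      fix y assume "y \<in> ?R"
      then obtain i w where y: "y = i + w * g" "i \<in> ideal_gen d X" "w \<in> PR d" by blast
      have "x + y = (j + i) + (v + w) * g" by (simp add: x y algebra_simps)
      then show "x + y \<in> ?R" using x y ideal_PR_add[OF J] by blast
    }
    fix s :: "'k mpol" assume s: "s \<in> PR d"
    have "s * x = s * j + (s * v) * g" by (simp add: x algebra_simps)
    then show "s * x \<in> ?R" using x s ideal_PR_mult[OF J] by blast
  qed
  moreover have "insert g X \<subseteq> ?R"
  proof
    fix x assume "x \<in> insert g X"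
    then consider "x = 0 + 1 * g" | "x = x + 0 * g" "x \<in> ideal_gen d X"
      using ideal_gen_base[OF assms(1)] by fastforce
    then show "x \<in> ?R" using ideal_PR_0[OF J] PR_0 PR_1 by cases blast+
  qed
  ultimately show "ideal_gen d (insert g X) \<subseteq> ?R" by (rule ideal_gen_minimal)
  have ins: "insert g X \<subseteq> PR d" using assms by blast
  note J' = ideal_ideal_gen[OF ins]
  have "ideal_gen d X \<subseteq> ideal_gen d (insert g X)"
    using ideal_gen_base[OF ins] by (intro ideal_gen_minimal[OF J']) blast
  then show "?R \<subseteq> ideal_gen d (insert g X)"
    using ideal_PR_add[OF J'] ideal_PR_mult[OF J'] ideal_gen_base[OF ins, of g] by blast
qed

lemma ideal_gen_insert_redundant:
  assumes "X \<subseteq> PR d" "g \<in> ideal_gen d X" shows "ideal_gen d (insert g X) = ideal_gen d X"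
proof
  note J = ideal_ideal_gen[OF assms(1)]
  show "ideal_gen d (insert g X) \<subseteq> ideal_gen d X"
    using assms ideal_gen_base[OF assms(1)] by (intro ideal_gen_minimal[OF J]) auto
  have ins: "insert g X \<subseteq> PR d" using assms ideal_PR_sub[OF J] by blast
  show "ideal_gen d X \<subseteq> ideal_gen d (insert g X)"
    using ideal_gen_base[OF ins] by (intro ideal_gen_minimal[OF ideal_ideal_gen[OF ins]]) blast
qed

section \<open>Extending a linear resolution by one generator\<close>

text \<open>The zero ideal is generated by the empty family, and the matrices have no columns.\<close>

lemma lin_res_zero: "lin_res d q {0} (\<lambda>p. if p = 0 then 1 else 0) A"
  unfolding lin_res_def graded_res_def by (auto simp: mat_vec_def pvec_def)

lemma sum_lessThan_add: "(\<Sum>i<m + n. f i) = (\<Sum>i<m. f i) + (\<Sum>i<n. f (m + i))"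
  for f :: "nat \<Rightarrow> 'a::comm_monoid_add"
  by (induction n) (auto simp: add.assoc)

lemma all_less_add: "(\<forall>k<m + n. P k) \<longleftrightarrow> (\<forall>k<m. P k) \<and> (\<forall>k<n. P (m + k))" for m n :: nat
proof (intro iffI allI impI)
  fix k assume P: "(\<forall>k<m. P k) \<and> (\<forall>k<n. P (m + k))" and k: "k < m + n"
  show "P k"
  proof (cases "k < m")
    case False
    then have "P (m + (k - m))" using P k by (intro P[THEN conjunct2, rule_format]) linarith
    then show ?thesis using False by simp
  qed (use P in simp)
qed auto

text \<open>The exact sequence \<open>0 \<rightarrow> J \<rightarrow> J + (g) \<rightarrow> (S/I)(-q) \<rightarrow> 0\<close> suggests the sum of the resolution of \<open>J\<close> and the
  shifted resolution of \<open>S/I\<close> as a resolution of \<open>J + (g)\<close>, with the block matrices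
  \<open>C p = (A p, h p; 0, B (p - 1))\<close>. The correction terms \<open>h p\<close> have to satisfy
  \<open>A p \<cdot> h (p + 1) + h p \<cdot> B p = 0\<close>. They start with \<open>h 0 = g\<close>, and \<open>h (p + 1)\<close> exists because \<open>h p \<cdot> B p\<close> maps into
  the image of \<open>A p\<close>: for \<open>p = 0\<close> because \<open>I g \<subseteq> J\<close>, and later by exactness. The entries of \<open>h (p + 1)\<close> have degree
  \<open>1\<close>, so the sum is linear.\<close>

lemma lin_res_cone:
  fixes A B :: "nat \<Rightarrow> nat \<Rightarrow> nat \<Rightarrow> 'k::field mpol"
  assumes J: "lin_res d q J \<rho> A" and I: "lin_res d 1 I \<sigma> B"
    and g: "g \<in> PR d" "homogeneous g q" and colon: "colon d J g = I"
  shows "\<exists>\<tau> C. lin_res d q {j + v * g |j v. j \<in> J \<and> v \<in> PR d} \<tau> C"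
proof -
  define t where "t = (\<lambda>p. if p = 0 then 0 else q + int p - 1)"
  have rA: "graded_res d J \<rho> A (\<lambda>p _. t p)" using J by (simp add: lin_res_def t_def)
  have rB: "graded_res d I \<sigma> B (\<lambda>p _. int p)"
  proof -
    have "(\<lambda>p (k::nat). if p = 0 then 0 else 1 + int p - 1) = (\<lambda>p _. int p)" by auto
    then show ?thesis using I by (simp add: lin_res_def)
  qed
  note eA = graded_res_entry[OF rA] and xA = graded_res_exact[OF rA] and imA = graded_res_image[OF rA]
  note eB = graded_res_entry[OF rB] and xB = graded_res_exact[OF rB] and imB = graded_res_image[OF rB]
  have \<rho>0: "\<rho> 0 = 1" and \<sigma>0: "\<sigma> 0 = 1" and t0: "t 0 = 0"
    using graded_res_base[OF rA] graded_res_base[OF rB] by (auto simp: t_def)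
  have BB: "mat_vec (\<sigma> (Suc p)) (B p) (mat_vec (\<sigma> (Suc (Suc p))) (B (Suc p)) w) k = 0"
    if "pvec d (\<sigma> (Suc (Suc p))) w" "k < \<sigma> p" for p w k
  proof -
    have "pvec d (\<sigma> (Suc p)) (mat_vec (\<sigma> (Suc (Suc p))) (B (Suc p)) w)"
      using that eB by (auto simp: pvec_def[of d "\<sigma> (Suc p)"] intro!: PR_mat_vec)
    then show ?thesis using xB[of p "mat_vec (\<sigma> (Suc (Suc p))) (B (Suc p)) w"] that by blast
  qed
  have AA: "mat_vec (\<rho> (Suc p)) (A p) (mat_vec (\<rho> (Suc (Suc p))) (A (Suc p)) w) k = 0"
    if "pvec d (\<rho> (Suc (Suc p))) w" "k < \<rho> p" for p w k
  proof -
    have "pvec d (\<rho> (Suc p)) (mat_vec (\<rho> (Suc (Suc p))) (A (Suc p)) w)"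
      using that eA by (auto simp: pvec_def[of d "\<rho> (Suc p)"] intro!: PR_mat_vec)
    then show ?thesis using xA[of p "mat_vec (\<rho> (Suc (Suc p))) (A (Suc p)) w"] that by blast
  qed
  \<comment> \<open>\<open>q + int p - t p\<close> is \<open>q\<close> for \<open>p = 0\<close> and \<open>1\<close> otherwise. The second part of \<open>H\<close> is the condition
    for the existence of the next correction term.\<close>
  define H where "H p h \<longleftrightarrow> (\<forall>k<\<rho> p. \<forall>l<\<sigma> p. h k l \<in> PR d \<and> homogeneous (h k l) (q + int p - t p)) \<and>
      (\<forall>l<\<sigma> (Suc p). \<exists>w. pvec d (\<rho> (Suc p)) w \<and> (\<forall>k<\<rho> p. mat_vec (\<sigma> p) h (\<lambda>i. B p i l) k = mat_vec (\<rho> (Suc p)) (A p) w k))"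
    for p and h :: "nat \<Rightarrow> nat \<Rightarrow> 'k mpol"
  define R where "R p h h' \<longleftrightarrow> (\<forall>k<\<rho> p. \<forall>l<\<sigma> (Suc p).
      mat_vec (\<rho> (Suc p)) (A p) (\<lambda>i. h' i l) k = - mat_vec (\<sigma> p) h (\<lambda>i. B p i l) k)"
    for p and h h' :: "nat \<Rightarrow> nat \<Rightarrow> 'k mpol"
  have step: "\<exists>h'. H (Suc p) h' \<and> R p h h'" if H: "H p h" for p h
  proof -
    have hH: "h k l \<in> PR d \<and> homogeneous (h k l) (q + int p - t p)" if "k < \<rho> p" "l < \<sigma> p" for k l
      using H that unfolding H_def by simp
    obtain w where w: "\<And>l. l < \<sigma> (Suc p) \<Longrightarrow> pvec d (\<rho> (Suc p)) (w l)"
      and w_eq: "\<And>l k. l < \<sigma> (Suc p) \<Longrightarrow> k < \<rho> p \<Longrightarrow> mat_vec (\<sigma> p) h (\<lambda>i. B p i l) k = mat_vec (\<rho> (Suc p)) (A p) (w l) k"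
      using H unfolding H_def by metis
    define h' where "h' k l = - hcomp (q + int (Suc p) - t (Suc p)) (w l k)" for k l
    have h': "h' k l \<in> PR d \<and> homogeneous (h' k l) (q + int (Suc p) - t (Suc p))" if "k < \<rho> (Suc p)" "l < \<sigma> (Suc p)" for k l
      using w that by (auto simp: h'_def pvec_def intro!: homogeneous_uminus)
    have R: "mat_vec (\<rho> (Suc p)) (A p) (\<lambda>i. h' i l) k = - mat_vec (\<sigma> p) h (\<lambda>i. B p i l) k" if "k < \<rho> p" "l < \<sigma> (Suc p)" for k l
    proof -
      have "homogeneous (h k i * B p i l) (q + int (Suc p) - t p)" if "i < \<sigma> p" for i
        using homogeneous_mult[of "h k i" "q + int p - t p" "B p i l" 1] hH[of k i] eB[of i p l] that \<open>k < \<rho> p\<close> \<open>l < \<sigma> (Suc p)\<close>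
        by (simp add: algebra_simps)
      then have "homogeneous (mat_vec (\<sigma> p) h (\<lambda>i. B p i l) k) (q + int (Suc p) - t p)"
        unfolding mat_vec_def by (intro homogeneous_sum) simp
      then have "mat_vec (\<sigma> p) h (\<lambda>i. B p i l) k = hcomp (q + int (Suc p) - t p) (mat_vec (\<rho> (Suc p)) (A p) (w l) k)"
        using w_eq[OF that(2,1)] by (metis hcomp_homogeneous)
      also have "\<dots> = (\<Sum>i<\<rho> (Suc p). A p k i * hcomp (q + int (Suc p) - t (Suc p)) (w l i))"
        unfolding mat_vec_def hcomp_sum
      proof (intro sum.cong refl)
        fix i assume "i \<in> {..<\<rho> (Suc p)}"
        then have "homogeneous (A p k i) (t (Suc p) - t p)" using eA[of k p i] that by simp
        moreover have "q + int (Suc p) - t p - (t (Suc p) - t p) = q + int (Suc p) - t (Suc p)" by simp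
        ultimately show "hcomp (q + int (Suc p) - t p) (A p k i * w l i) = A p k i * hcomp (q + int (Suc p) - t (Suc p)) (w l i)"
          by (metis hcomp_mult)
      qed
      finally show ?thesis by (simp add: mat_vec_def h'_def sum_negf)
    qed
    have "\<exists>w. pvec d (\<rho> (Suc (Suc p))) w \<and> (\<forall>k<\<rho> (Suc p). mat_vec (\<sigma> (Suc p)) h' (\<lambda>i. B (Suc p) i l) k = mat_vec (\<rho> (Suc (Suc p))) (A (Suc p)) w k)"
      if l: "l < \<sigma> (Suc (Suc p))" for l
    proof -
      let ?y = "mat_vec (\<sigma> (Suc p)) h' (\<lambda>i. B (Suc p) i l)"
      have "pvec d (\<rho> (Suc p)) ?y"
        using h' eB[of _ "Suc p" l] l by (auto simp: pvec_def intro!: PR_mat_vec)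
      moreover have "mat_vec (\<rho> (Suc p)) (A p) ?y k = 0" if k: "k < \<rho> p" for k
      proof -
        have "mat_vec (\<rho> (Suc p)) (A p) ?y k = mat_vec (\<sigma> (Suc p)) (\<lambda>k j. - mat_vec (\<sigma> p) h (\<lambda>i. B p i j) k) (\<lambda>i. B (Suc p) i l) k"
          unfolding mat_vec_mv using R[OF k] by (auto simp: mat_vec_def intro!: sum.cong)
        also have "\<dots> = - mat_vec (\<sigma> p) h (mat_vec (\<sigma> (Suc p)) (B p) (\<lambda>i. B (Suc p) i l)) k"
          unfolding mat_vec_mv by (simp add: mat_vec_def sum_negf)
        also have "mat_vec (\<sigma> p) h (mat_vec (\<sigma> (Suc p)) (B p) (\<lambda>i. B (Suc p) i l)) k = mat_vec (\<sigma> p) h (\<lambda>_. 0) k"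
        proof (rule mat_vec_cong)
          fix j assume "j < \<sigma> p"
          moreover have "mat_vec (\<sigma> (Suc (Suc p))) (B (Suc p)) (unit_vec l) = (\<lambda>i. B (Suc p) i l)"
            using l by (intro ext mat_vec_unit)
          ultimately show "mat_vec (\<sigma> (Suc p)) (B p) (\<lambda>i. B (Suc p) i l) j = 0"
            using BB[of p "unit_vec l" j] by simp
        qed
        finally show ?thesis by simp
      qed
      ultimately show ?thesis using xA[of p ?y] by blast
    qed
    then have "H (Suc p) h'" using h' unfolding H_def by blast
    moreover have "R p h h'" using R unfolding R_def by blast
    ultimately show ?thesis by blast
  qed
  have base: "H 0 (\<lambda>_ _. g)"
    unfolding H_def
  proof (intro conjI allI impI)
    show "g \<in> PR d" "homogeneous g (q + int 0 - t 0)" using g by (auto simp: t0)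
    fix l assume l: "l < \<sigma> (Suc 0)"
    have "B 0 0 l \<in> I" using imB l by (auto simp: mat_vec_unit intro!: exI[of _ "unit_vec l"])
    then have "B 0 0 l * g \<in> J" using colon by (auto simp: colon_def)
    then obtain w where "pvec d (\<rho> 1) w" "B 0 0 l * g = mat_vec (\<rho> 1) (A 0) w 0" using imA by blast
    then show "\<exists>w. pvec d (\<rho> (Suc 0)) w \<and> (\<forall>k<\<rho> 0. mat_vec (\<sigma> 0) (\<lambda>_ _. g) (\<lambda>i. B 0 i l) k = mat_vec (\<rho> (Suc 0)) (A 0) w k)"
      by (intro exI[of _ w]) (auto simp: \<rho>0 \<sigma>0 mat_vec_def mult.commute)
  qed
  define h where "h = rec_nat (\<lambda>_ _. g) (\<lambda>p h. SOME h'. H (Suc p) h' \<and> R p h h')"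
  have h0: "h 0 = (\<lambda>_ _. g)" and hS: "h (Suc p) = (SOME h'. H (Suc p) h' \<and> R p (h p) h')" for p
    by (simp_all add: h_def)
  have H: "H p (h p)" for p
  proof (induction p)
    case (Suc p)
    show ?case using someI_ex[OF step[OF Suc]] unfolding hS by blast
  qed (simp add: h0 base)
  have R: "R p (h p) (h (Suc p))" for p
    using someI_ex[OF step[OF H[of p]]] unfolding hS by blast
  have hE: "h p k l \<in> PR d \<and> homogeneous (h p k l) (q + int p - t p)" if "k < \<rho> p" "l < \<sigma> p" for p k l
    using H[of p] that unfolding H_def by blast
  have hR: "mat_vec (\<rho> (Suc p)) (A p) (mat_vec (\<sigma> (Suc p)) (h (Suc p)) w) k = - mat_vec (\<sigma> p) (h p) (mat_vec (\<sigma> (Suc p)) (B p) w) k"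
    if "k < \<rho> p" for p w k
  proof -
    have "mat_vec (\<rho> (Suc p)) (A p) (mat_vec (\<sigma> (Suc p)) (h (Suc p)) w) k =
        mat_vec (\<sigma> (Suc p)) (\<lambda>k l. - mat_vec (\<sigma> p) (h p) (\<lambda>i. B p i l) k) w k"
      unfolding mat_vec_mv using R[of p] that unfolding R_def by (auto simp: mat_vec_def intro!: sum.cong)
    also have "\<dots> = - mat_vec (\<sigma> p) (h p) (mat_vec (\<sigma> (Suc p)) (B p) w) k"
      unfolding mat_vec_mv by (simp add: mat_vec_def sum_negf)
    finally show ?thesis .
  qed
  \<comment> \<open>The index of the resolution of \<open>S/I\<close> lags by one: \<open>J + (g)\<close> receives \<open>g\<close> as a generator from \<open>\<sigma> 0 = 1\<close>.\<close>
  define \<tau> where "\<tau> p = \<rho> p + (case p of 0 \<Rightarrow> 0 | Suc p' \<Rightarrow> \<sigma> p')" for p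
  define C where "C p k l = (if k < \<rho> p then (if l < \<rho> (Suc p) then A p k l else h p k (l - \<rho> (Suc p)))
      else (if l < \<rho> (Suc p) then 0 else B (p - 1) (k - \<rho> p) (l - \<rho> (Suc p))))" for p k l
  have \<tau>S: "\<tau> (Suc p) = \<rho> (Suc p) + \<sigma> p" and \<tau>0: "\<tau> 0 = 1" for p by (simp_all add: \<tau>_def \<rho>0)
  have C1: "mat_vec (\<tau> (Suc p)) (C p) u k = mat_vec (\<rho> (Suc p)) (A p) u k + mat_vec (\<sigma> p) (h p) (\<lambda>l. u (\<rho> (Suc p) + l)) k"
    if "k < \<rho> p" for p u k
    using that by (simp add: mat_vec_def \<tau>S sum_lessThan_add C_def)
  have C2: "mat_vec (\<tau> (Suc (Suc p))) (C (Suc p)) u (\<rho> (Suc p) + k) = mat_vec (\<sigma> (Suc p)) (B p) (\<lambda>l. u (\<rho> (Suc (Suc p)) + l)) k" for p u k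
    by (simp add: mat_vec_def \<tau>S sum_lessThan_add C_def)
  have split: "(\<forall>k<\<tau> (Suc p). P k) \<longleftrightarrow> (\<forall>k<\<rho> (Suc p). P k) \<and> (\<forall>k<\<sigma> p. P (\<rho> (Suc p) + k))" for P p
    unfolding \<tau>S by (rule all_less_add)
  have pv_split: "pvec d (\<tau> (Suc p)) u \<longleftrightarrow> pvec d (\<rho> (Suc p)) u \<and> pvec d (\<sigma> p) (\<lambda>l. u (\<rho> (Suc p) + l))" for p u
    unfolding pvec_def split ..
  define join where "join p z w = (\<lambda>l. if l < \<rho> (Suc p) then z l else w (l - \<rho> (Suc p)))"
    for p and z w :: "nat \<Rightarrow> 'k mpol"
  have join2: "(\<lambda>l. join p z w (\<rho> (Suc p) + l)) = w" for p z w by (simp add: join_def)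
  have join1: "mat_vec (\<rho> (Suc p)) X (join p z w) k = mat_vec (\<rho> (Suc p)) X z k" for X p z w k
    by (rule mat_vec_cong) (simp add: join_def)
  have pv_join: "pvec d (\<tau> (Suc p)) (join p z w)" if "pvec d (\<rho> (Suc p)) z" "pvec d (\<sigma> p) w" for p z w
    unfolding pv_split join2 using that by (simp add: pvec_def join_def)
  have entries: "C p k l \<in> PR d \<and> homogeneous (C p k l) (t (Suc p) - t p)" if "k < \<tau> p" "l < \<tau> (Suc p)" for p k l
  proof -
    note kl = that
    have t1: "q + int p - t p = t (Suc p) - t p" by (simp add: t_def)
    show ?thesis
    proof (cases "k < \<rho> p")
      case True
      show ?thesis
      proof (cases "l < \<rho> (Suc p)")
        case True
        then show ?thesis using eA[of k p l] \<open>k < \<rho> p\<close> by (simp add: C_def)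
      next
        case False
        then show ?thesis using hE[of k p "l - \<rho> (Suc p)"] that \<open>k < \<rho> p\<close> t1 by (simp add: C_def \<tau>S)
      qed
    next
      case False
      then obtain p' where p': "p = Suc p'" using kl False \<tau>0 \<rho>0 by (cases p) auto
      show ?thesis
        using eB[of "k - \<rho> p" p' "l - \<rho> (Suc p)"] that False by (auto simp: C_def \<tau>S p' t_def)
    qed
  qed
  have "graded_res d {j + v * g |j v. j \<in> J \<and> v \<in> PR d} \<tau> C (\<lambda>p _. t p)"
    unfolding graded_res_def
  proof (intro conjI allI impI)
    show "C p k l \<in> PR d" "homogeneous (C p k l) (t (Suc p) - t p)" if "k < \<tau> p" "l < \<tau> (Suc p)" for p k l
      using entries[OF that] by auto
    have C0: "mat_vec (\<tau> 1) (C 0) u 0 = mat_vec (\<rho> 1) (A 0) u 0 + u (\<rho> 1) * g" for u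
      using C1[of 0 0 u] by (simp add: \<rho>0 \<sigma>0 h0 mat_vec_def mult.commute)
    fix x
    show "x \<in> {j + v * g |j v. j \<in> J \<and> v \<in> PR d} \<longleftrightarrow> (\<exists>u. pvec d (\<tau> 1) u \<and> x = mat_vec (\<tau> 1) (C 0) u 0)"
    proof
      assume "x \<in> {j + v * g |j v. j \<in> J \<and> v \<in> PR d}"
      then obtain j v where x: "x = j + v * g" "j \<in> J" "v \<in> PR d" by blast
      then obtain u where u: "pvec d (\<rho> 1) u" "j = mat_vec (\<rho> 1) (A 0) u 0" using imA by blast
      have "pvec d (\<tau> 1) (join 0 u (\<lambda>_. v))" using pv_join[of 0 u] u x by (simp add: pvec_def)
      moreover have "x = mat_vec (\<tau> 1) (C 0) (join 0 u (\<lambda>_. v)) 0"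
        unfolding One_nat_def C0[unfolded One_nat_def] join1[of 0] using u x by (simp add: join_def)
      ultimately show "\<exists>u. pvec d (\<tau> 1) u \<and> x = mat_vec (\<tau> 1) (C 0) u 0" by blast
    next
      assume "\<exists>u. pvec d (\<tau> 1) u \<and> x = mat_vec (\<tau> 1) (C 0) u 0"
      then obtain u where u: "pvec d (\<tau> 1) u" "x = mat_vec (\<tau> 1) (C 0) u 0" by blast
      have "pvec d (\<rho> 1) u" "u (\<rho> 1) \<in> PR d"
        using u(1) pv_split[of 0 u] by (auto simp: \<sigma>0 pvec_def)
      then show "x \<in> {j + v * g |j v. j \<in> J \<and> v \<in> PR d}"
        unfolding u(2) C0 using imA by blast
    qed
  next
    fix p and u :: "nat \<Rightarrow> 'k mpol" assume u: "pvec d (\<tau> (Suc p)) u"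
    define v where "v = (\<lambda>l. u (\<rho> (Suc p) + l))"
    have pu: "pvec d (\<rho> (Suc p)) u" and pv: "pvec d (\<sigma> p) v" using u by (simp_all add: pv_split v_def)
    show "(\<forall>k<\<tau> p. mat_vec (\<tau> (Suc p)) (C p) u k = 0) \<longleftrightarrow>
      (\<exists>w. pvec d (\<tau> (Suc (Suc p))) w \<and> (\<forall>k<\<tau> (Suc p). u k = mat_vec (\<tau> (Suc (Suc p))) (C (Suc p)) w k))"
    proof
      assume ker: "\<forall>k<\<tau> p. mat_vec (\<tau> (Suc p)) (C p) u k = 0"
      have k1: "mat_vec (\<rho> (Suc p)) (A p) u k + mat_vec (\<sigma> p) (h p) v k = 0" if "k < \<rho> p" for k
      proof -
        have "k < \<tau> p" using that by (simp add: \<tau>_def)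
        then show ?thesis using ker C1[OF that, of u] unfolding v_def by metis
      qed
      \<comment> \<open>Exactness for \<open>S/I\<close>; in the lowest degree this is the hypothesis \<open>J : g = I\<close>.\<close>
      have "\<exists>w. pvec d (\<sigma> (Suc p)) w \<and> (\<forall>k<\<sigma> p. v k = mat_vec (\<sigma> (Suc p)) (B p) w k)"
      proof (cases p)
        case 0
        have "v 0 * g = - mat_vec (\<rho> 1) (A 0) u 0"
          using k1[of 0] by (simp add: 0 \<rho>0 \<sigma>0 h0 mat_vec_def mult.commute eq_neg_iff_add_eq_0 add.commute)
        also have "\<dots> = mat_vec (\<rho> 1) (A 0) (\<lambda>l. - u l) 0" by (simp add: mat_vec_uminus)
        also have "\<dots> \<in> J"
          unfolding imA using pu by (intro exI[of _ "\<lambda>l. - u l"]) (auto simp: 0 pvec_def)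
        finally have "v 0 \<in> I" using colon pv by (auto simp: colon_def pvec_def 0 \<sigma>0)
        then show ?thesis using imB by (simp add: 0 \<sigma>0)
      next
        case (Suc p')
        have "mat_vec (\<sigma> p) (B p') v k = 0" if "k < \<sigma> p'" for k
        proof -
          have "\<rho> p + k < \<tau> p" using that by (simp add: \<tau>_def Suc)
          then show ?thesis using ker C2[of p' u k] unfolding v_def Suc by metis
        qed
        then show ?thesis using xB[of p' v] pv unfolding Suc by blast
      qed
      then obtain w where w: "pvec d (\<sigma> (Suc p)) w" "\<And>k. k < \<sigma> p \<Longrightarrow> v k = mat_vec (\<sigma> (Suc p)) (B p) w k" by blast
      let ?x = "\<lambda>k. u k - mat_vec (\<sigma> (Suc p)) (h (Suc p)) w k"
      have "pvec d (\<rho> (Suc p)) ?x"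
        using pu w(1) hE by (auto simp: pvec_def[of d "\<rho> (Suc p)"] intro!: PR_diff PR_mat_vec)
      moreover have "mat_vec (\<rho> (Suc p)) (A p) ?x k = 0" if "k < \<rho> p" for k
      proof -
        have "mat_vec (\<sigma> p) (h p) v k = mat_vec (\<sigma> p) (h p) (mat_vec (\<sigma> (Suc p)) (B p) w) k"
          by (rule mat_vec_cong) (rule w(2))
        then show ?thesis using k1[OF that] hR[OF that, of w] by (simp add: mat_vec_diff)
      qed
      ultimately obtain z where z: "pvec d (\<rho> (Suc (Suc p))) z"
        "\<And>k. k < \<rho> (Suc p) \<Longrightarrow> ?x k = mat_vec (\<rho> (Suc (Suc p))) (A (Suc p)) z k"
        using xA[of p ?x] by blast
      have "u k = mat_vec (\<tau> (Suc (Suc p))) (C (Suc p)) (join (Suc p) z w) k" if "k < \<rho> (Suc p)" for k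
        using z(2)[OF that] by (simp add: C1[OF that] join1 join2 diff_eq_eq)
      moreover have "u (\<rho> (Suc p) + k) = mat_vec (\<tau> (Suc (Suc p))) (C (Suc p)) (join (Suc p) z w) (\<rho> (Suc p) + k)" if "k < \<sigma> p" for k
        using w(2)[OF that] by (simp add: C2 join2) (simp add: v_def)
      ultimately show "\<exists>w. pvec d (\<tau> (Suc (Suc p))) w \<and> (\<forall>k<\<tau> (Suc p). u k = mat_vec (\<tau> (Suc (Suc p))) (C (Suc p)) w k)"
        using pv_join[OF z(1) w(1)] split by (intro exI[of _ "join (Suc p) z w"]) simp
    next
      assume "\<exists>w. pvec d (\<tau> (Suc (Suc p))) w \<and> (\<forall>k<\<tau> (Suc p). u k = mat_vec (\<tau> (Suc (Suc p))) (C (Suc p)) w k)"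
      then obtain y where y: "pvec d (\<tau> (Suc (Suc p))) y"
        "\<forall>k<\<tau> (Suc p). u k = mat_vec (\<tau> (Suc (Suc p))) (C (Suc p)) y k" by blast
      define w where "w = (\<lambda>l. y (\<rho> (Suc (Suc p)) + l))"
      have py: "pvec d (\<rho> (Suc (Suc p))) y" and pw: "pvec d (\<sigma> (Suc p)) w" using y(1) by (simp_all add: pv_split w_def)
      have u_eq: "u k = mat_vec (\<rho> (Suc (Suc p))) (A (Suc p)) y k + mat_vec (\<sigma> (Suc p)) (h (Suc p)) w k" if "k < \<rho> (Suc p)" for k
        using y(2) that C1[OF that, of y] unfolding split w_def by simp
      have v_eq: "v k = mat_vec (\<sigma> (Suc p)) (B p) w k" if "k < \<sigma> p" for k
        using y(2) that C2[of p y k] unfolding split w_def v_def by simp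
      have ker1: "mat_vec (\<tau> (Suc p)) (C p) u k = 0" if "k < \<rho> p" for k
      proof -
        have "mat_vec (\<tau> (Suc p)) (C p) u k = mat_vec (\<rho> (Suc p)) (A p) u k + mat_vec (\<sigma> p) (h p) v k"
          by (simp add: C1[OF that] v_def)
        also have "mat_vec (\<rho> (Suc p)) (A p) u k = mat_vec (\<rho> (Suc p)) (A p) (\<lambda>k. mat_vec (\<rho> (Suc (Suc p))) (A (Suc p)) y k + mat_vec (\<sigma> (Suc p)) (h (Suc p)) w k) k"
          by (rule mat_vec_cong) (rule u_eq)
        also have "mat_vec (\<sigma> p) (h p) v k = mat_vec (\<sigma> p) (h p) (mat_vec (\<sigma> (Suc p)) (B p) w) k"
          by (rule mat_vec_cong) (rule v_eq)
        finally show ?thesis using AA[OF py that] hR[OF that, of w] by (simp add: mat_vec_add)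
      qed
      show "\<forall>k<\<tau> p. mat_vec (\<tau> (Suc p)) (C p) u k = 0"
      proof (cases p)
        case 0
        then show ?thesis using ker1 by (simp add: \<tau>0 \<rho>0)
      next
        case (Suc p')
        have "mat_vec (\<tau> (Suc p)) (C p) u (\<rho> p + k) = 0" if "k < \<sigma> p'" for k
        proof -
          have "mat_vec (\<tau> (Suc p)) (C p) u (\<rho> p + k) = mat_vec (\<sigma> p) (B p') v k"
            unfolding Suc C2 v_def ..
          also have "\<dots> = mat_vec (\<sigma> p) (B p') (mat_vec (\<sigma> (Suc p)) (B p) w) k"
            by (rule mat_vec_cong) (rule v_eq)
          also have "\<dots> = 0" using BB[of p' w k] pw that by (simp add: Suc)
          finally show ?thesis .
        qed
        then show ?thesis using ker1 split[of p' "\<lambda>k. mat_vec (\<tau> (Suc p)) (C p) u k = 0"] by (simp add: Suc)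
      qed
    qed
  qed (simp_all add: \<tau>0 t0)
  then show ?thesis unfolding lin_res_def t_def by blast
qed

section \<open>Substitution homomorphisms\<close>

text \<open>Facts about the basis \<open>e ` {1..d}\<close> are stated with the lower bound \<open>1\<close>. Rewriting it to \<open>Suc 0\<close> would keep
  them from being applied.\<close>

declare One_nat_def [simp del]

definition monom_subst :: "(nat \<Rightarrow> 'k::field mpol) \<Rightarrow> (nat \<Rightarrow>\<^sub>0 nat) \<Rightarrow> 'k mpol" where
  "monom_subst \<theta> m = (\<Prod>k\<in>Poly_Mapping.keys m. \<theta> k ^ Poly_Mapping.lookup m k)"

definition poly_subst :: "(nat \<Rightarrow> 'k::field mpol) \<Rightarrow> 'k mpol \<Rightarrow> 'k mpol" where
  "poly_subst \<theta> p = (\<Sum>m\<in>Poly_Mapping.keys p. Poly_Mapping.single 0 (Poly_Mapping.lookup p m) * monom_subst \<theta> m)"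

lemma monom_subst_superset:
  assumes "finite A" "Poly_Mapping.keys m \<subseteq> A"
  shows "monom_subst \<theta> m = (\<Prod>k\<in>A. \<theta> k ^ Poly_Mapping.lookup m k)"
  unfolding monom_subst_def
  by (rule prod.mono_neutral_left) (use assms in \<open>auto simp: Poly_Mapping.in_keys_iff\<close>)

lemma monom_subst_add: "monom_subst \<theta> (m + n) = monom_subst \<theta> m * monom_subst \<theta> n"
proof -
  let ?A = "Poly_Mapping.keys m \<union> Poly_Mapping.keys n"
  have "Poly_Mapping.keys (m + n) \<subseteq> ?A" by (rule keys_add)
  then show ?thesis
    by (subst (1 2 3) monom_subst_superset[of ?A]) (auto simp: lookup_add power_add prod.distrib)
qed

lemma poly_subst_superset:
  assumes "finite A" "Poly_Mapping.keys p \<subseteq> A"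
  shows "poly_subst \<theta> p = (\<Sum>m\<in>A. Poly_Mapping.single 0 (Poly_Mapping.lookup p m) * monom_subst \<theta> m)"
  unfolding poly_subst_def
  by (rule sum.mono_neutral_left) (use assms in \<open>auto simp: Poly_Mapping.in_keys_iff\<close>)

lemma poly_subst_add: "poly_subst \<theta> (p + q) = poly_subst \<theta> p + poly_subst \<theta> q"
proof -
  let ?A = "Poly_Mapping.keys p \<union> Poly_Mapping.keys q"
  have "Poly_Mapping.keys (p + q) \<subseteq> ?A" by (rule keys_add)
  then show ?thesis
    by (subst (1 2 3) poly_subst_superset[of ?A])
       (auto simp: lookup_add single_add distrib_right sum.distrib)
qed

lemma poly_subst_0 [simp]: "poly_subst \<theta> 0 = 0"
  by (simp add: poly_subst_def)

lemma poly_subst_sum: "poly_subst \<theta> (sum f A) = (\<Sum>a\<in>A. poly_subst \<theta> (f a))"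
  by (induction A rule: infinite_finite_induct) (auto simp: poly_subst_add)

lemma poly_subst_single: "poly_subst \<theta> (Poly_Mapping.single m c) = Poly_Mapping.single 0 c * monom_subst \<theta> m"
  by (cases "c = 0") (simp_all add: poly_subst_def)

lemma poly_subst_const: "poly_subst \<theta> (Poly_Mapping.single 0 c) = Poly_Mapping.single 0 c"
  by (simp add: poly_subst_single monom_subst_def)

lemma sum_single_keys: "(\<Sum>m\<in>Poly_Mapping.keys p. Poly_Mapping.single m (Poly_Mapping.lookup p m)) = p"
  for p :: "'a \<Rightarrow>\<^sub>0 'b::comm_monoid_add"
proof (rule poly_mapping_eqI)
  fix k
  have "Poly_Mapping.lookup (\<Sum>m\<in>Poly_Mapping.keys p. Poly_Mapping.single m (Poly_Mapping.lookup p m)) k =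
      (\<Sum>m\<in>Poly_Mapping.keys p. if k = m then Poly_Mapping.lookup p m else 0)"
    unfolding lookup_sum by (rule sum.cong) (auto simp: lookup_single when_def)
  also have "\<dots> = Poly_Mapping.lookup p k"
    by (subst sum.delta') (auto simp: Poly_Mapping.in_keys_iff)
  finally show "Poly_Mapping.lookup (\<Sum>m\<in>Poly_Mapping.keys p. Poly_Mapping.single m (Poly_Mapping.lookup p m)) k = Poly_Mapping.lookup p k" .
qed

lemma poly_subst_mult: "poly_subst \<theta> (p * q) = poly_subst \<theta> p * poly_subst \<theta> q"
proof -
  have "p * q = (\<Sum>m\<in>Poly_Mapping.keys p. Poly_Mapping.single m (Poly_Mapping.lookup p m)) *
      (\<Sum>n\<in>Poly_Mapping.keys q. Poly_Mapping.single n (Poly_Mapping.lookup q n))"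
    by (simp only: sum_single_keys)
  also have "\<dots> = (\<Sum>m\<in>Poly_Mapping.keys p. \<Sum>n\<in>Poly_Mapping.keys q.
      Poly_Mapping.single (m + n) (Poly_Mapping.lookup p m * Poly_Mapping.lookup q n))"
    by (simp add: sum_product mult_single)
  also have "poly_subst \<theta> \<dots> = (\<Sum>m\<in>Poly_Mapping.keys p. \<Sum>n\<in>Poly_Mapping.keys q.
      (Poly_Mapping.single 0 (Poly_Mapping.lookup p m) * monom_subst \<theta> m) *
      (Poly_Mapping.single 0 (Poly_Mapping.lookup q n) * monom_subst \<theta> n))"
    unfolding poly_subst_sum poly_subst_single monom_subst_add
  proof (intro sum.cong refl)
    fix m n
    have "Poly_Mapping.single (0::nat \<Rightarrow>\<^sub>0 nat) (Poly_Mapping.lookup p m * Poly_Mapping.lookup q n) =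
        Poly_Mapping.single 0 (Poly_Mapping.lookup p m) * Poly_Mapping.single 0 (Poly_Mapping.lookup q n)"
      by (simp add: mult_single)
    then show "Poly_Mapping.single 0 (Poly_Mapping.lookup p m * Poly_Mapping.lookup q n) * (monom_subst \<theta> m * monom_subst \<theta> n) =
      (Poly_Mapping.single 0 (Poly_Mapping.lookup p m) * monom_subst \<theta> m) *
      (Poly_Mapping.single 0 (Poly_Mapping.lookup q n) * monom_subst \<theta> n)"
      by (simp only: mult_ac)
  qed
  also have "\<dots> = poly_subst \<theta> p * poly_subst \<theta> q"
    unfolding poly_subst_def sum_product ..
  finally show ?thesis .
qed

abbreviation pvar :: "nat \<Rightarrow> 'k::field mpol" where
  "pvar k \<equiv> Poly_Mapping.single (Poly_Mapping.single k 1) 1"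

lemma poly_subst_pvar: "poly_subst \<theta> (pvar k) = \<theta> k"
  by (simp add: poly_subst_single monom_subst_def)

lemma pvar_power: "(pvar k :: 'k::field mpol) ^ j = Poly_Mapping.single (Poly_Mapping.single k j) 1"
  by (induction j) (simp_all add: mult_single single_add[symmetric] One_nat_def)

lemma monom_subst_pvar: "monom_subst pvar m = (Poly_Mapping.single m 1 :: 'k::field mpol)"
proof -
  have "(\<Prod>k\<in>A. Poly_Mapping.single (g k) 1) = (Poly_Mapping.single (\<Sum>k\<in>A. g k) 1 :: 'k mpol)"
    if "finite A" for A :: "nat set" and g :: "nat \<Rightarrow> nat \<Rightarrow>\<^sub>0 nat"
    using that by induction (auto simp: mult_single)
  from this[of "Poly_Mapping.keys m" "\<lambda>k. Poly_Mapping.single k (Poly_Mapping.lookup m k)"] show ?thesis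
    by (simp add: monom_subst_def pvar_power sum_single_keys)
qed

lemma poly_subst_id: "poly_subst pvar p = p"
  unfolding poly_subst_def monom_subst_pvar
  by (simp add: mult_single sum_single_keys)

lemma PR_pvar: "k \<in> {1..d} \<Longrightarrow> pvar k \<in> PR d"
  by (simp add: PR_iff)

text \<open>The ring is generated by constants and variables, because every polynomial is its own image under the
  substitution of the variables by themselves.\<close>

lemma PR_induct [consumes 1, case_names const pvar add mult]:
  assumes "p \<in> PR d" and const: "\<And>c. P (Poly_Mapping.single 0 c)"
    and pvar: "\<And>k. k \<in> {1..d} \<Longrightarrow> P (pvar k)"
    and add: "\<And>x y. x \<in> PR d \<Longrightarrow> y \<in> PR d \<Longrightarrow> P x \<Longrightarrow> P y \<Longrightarrow> P (x + y)"
    and mult: "\<And>x y. x \<in> PR d \<Longrightarrow> y \<in> PR d \<Longrightarrow> P x \<Longrightarrow> P y \<Longrightarrow> P (x * y)"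
  shows "P p"
proof -
  define Q where "Q x \<longleftrightarrow> x \<in> PR d \<and> P x" for x
  have Q_const: "Q (Poly_Mapping.single 0 c)" for c using const by (simp add: Q_def)
  have Q_add: "Q (x + y)" if "Q x" "Q y" for x y using that add by (auto simp: Q_def)
  have Q_mult: "Q (x * y)" if "Q x" "Q y" for x y using that mult by (auto simp: Q_def)
  have Q_pvar: "Q (pvar k)" if "k \<in> {1..d}" for k using pvar[OF that] that by (auto simp: Q_def PR_iff)
  have Q0: "Q 0" and Q1: "Q 1" using Q_const[of 0] Q_const[of 1] by simp_all
  have Q_power: "Q (x ^ j)" if "Q x" for x and j :: nat using that Q1 Q_mult by (induction j) auto
  have Q_monom: "Q (monom_subst pvar m)" if "m \<in> Poly_Mapping.keys p" for m
  proof -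
    have "Poly_Mapping.keys m \<subseteq> {1..d}" using that assms(1) by (auto simp: PR_iff)
    moreover have "Q (\<Prod>k\<in>A. pvar k ^ Poly_Mapping.lookup m k)" if "finite A" "A \<subseteq> {1..d}" for A
      using that by induction (auto intro!: Q1 Q_mult Q_power Q_pvar)
    ultimately show ?thesis by (simp add: monom_subst_def)
  qed
  have "Q (\<Sum>m\<in>A. Poly_Mapping.single 0 (Poly_Mapping.lookup p m) * monom_subst pvar m)"
    if "finite A" "A \<subseteq> Poly_Mapping.keys p" for A
    using that by induction (auto intro!: Q0 Q_add Q_mult Q_const Q_monom)
  from this[of "Poly_Mapping.keys p"] have "Q (poly_subst pvar p)" by (simp add: poly_subst_def)
  then show ?thesis by (simp add: poly_subst_id Q_def)
qed

lemma poly_subst_PR: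
  assumes "p \<in> PR d" "\<And>k. k \<in> {1..d} \<Longrightarrow> \<theta> k \<in> PR d'" shows "poly_subst \<theta> p \<in> PR d'"
  using assms(1)
  by (induction rule: PR_induct) (auto simp: poly_subst_const poly_subst_pvar poly_subst_add poly_subst_mult assms(2))

section \<open>Linear forms and the ideals that they generate\<close>

lemma single_inj: "Poly_Mapping.single j (1::nat) = Poly_Mapping.single k 1 \<longleftrightarrow> j = k"
  by (metis keys_single singleton_inject one_neq_zero)

locale sym_space = vector_space scale
  for scale :: "'k::field \<Rightarrow> 'v::ab_group_add \<Rightarrow> 'v" +
  fixes d :: nat and e :: "nat \<Rightarrow> 'v"
  assumes basis: "ordered_basis scale d e UNIV"
begin

lemma inj_e: "inj_on e {1..d}" and indep_e: "independent (e ` {1..d})" and span_e: "span (e ` {1..d}) = UNIV"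
  using basis unfolding ordered_basis_def by blast+

sublocale finite_dimensional_vector_space scale "e ` {1..d}"
  by unfold_locales (auto simp: indep_e span_e)

abbreviation lform :: "'v \<Rightarrow> 'k mpol" where "lform \<equiv> sym_incl scale d e"

abbreviation coord :: "'v \<Rightarrow> nat \<Rightarrow> 'k" where "coord v k \<equiv> representation (e ` {1..d}) v (e k)"

abbreviation const :: "'k \<Rightarrow> 'k mpol" where "const c \<equiv> Poly_Mapping.single 0 c"

lemma lform_eq: "lform v = (\<Sum>k\<in>{1..d}. const (coord v k) * pvar k)"
  by (simp add: sym_incl_def mult_single)

lemma lform_add: "lform (v + w) = lform v + lform w"
  unfolding lform_eq representation_add[OF indep_e, unfolded span_e, OF UNIV_I UNIV_I]
  by (simp add: single_add distrib_right sum.distrib)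

lemma lform_scale: "lform (scale c v) = const c * lform v"
proof -
  have "const (c * coord v k) = const c * const (coord v k)" for k by (simp add: mult_single)
  then show ?thesis
    unfolding lform_eq representation_scale[OF indep_e, unfolded span_e, OF UNIV_I]
    by (simp only: sum_distrib_left mult.assoc)
qed

lemma lform_0 [simp]: "lform 0 = 0"
  using lform_scale[of 0 0] by simp

lemma lform_diff: "lform (v - w) = lform v - lform w"
  using lform_add[of "v - w" w] by (simp add: eq_diff_eq)

lemma lform_sum: "lform (sum f A) = (\<Sum>a\<in>A. lform (f a))"
  by (induction A rule: infinite_finite_induct) (auto simp: lform_add)

lemma lform_PR [simp, intro]: "lform v \<in> PR d"
  unfolding lform_eq by (intro PR_sum PR_mult PR_single_0 PR_pvar)

lemma homogeneous_lform [simp]: "homogeneous (lform v) 1"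
proof -
  have "homogeneous (const c * pvar k) 1" for c k
    using homogeneous_mult[of "const c" 0 "pvar k" 1] by (simp add: homogeneous_def)
  then show ?thesis unfolding lform_eq by (intro homogeneous_sum)
qed

lemma lookup_lform:
  assumes "k \<in> {1..d}" shows "Poly_Mapping.lookup (lform v) (Poly_Mapping.single k 1) = coord v k"
proof -
  have "Poly_Mapping.lookup (lform v) (Poly_Mapping.single k 1) = (\<Sum>j\<in>{1..d}. if j = k then coord v j else 0)"
    unfolding sym_incl_def lookup_sum
    by (rule sum.cong) (auto simp: lookup_single when_def simp: single_inj)
  then show ?thesis using assms by simp
qed

lemma sum_coord: "(\<Sum>k\<in>{1..d}. scale (coord v k) (e k)) = v"
  using sum_representation_eq[OF indep_e, of v "e ` {1..d}"] by (simp add: span_e sum.reindex[OF inj_e])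

lemma lform_eq_0_iff: "lform v = 0 \<longleftrightarrow> v = 0"
proof
  assume "lform v = 0"
  then have "coord v k = 0" if "k \<in> {1..d}" for k
    using lookup_lform[OF that, of v] by simp
  then have "(\<Sum>k\<in>{1..d}. scale (coord v k) (e k)) = 0" by (intro sum.neutral) simp
  then show "v = 0" by (simp only: sum_coord)
qed simp

lemma lform_e: "k \<in> {1..d} \<Longrightarrow> lform (e k) = pvar k"
proof -
  assume k: "k \<in> {1..d}"
  have "lform (e k) = (\<Sum>j\<in>{1..d}. if j = k then pvar k else 0)"
    unfolding lform_eq using k
    by (intro sum.cong) (auto simp: representation_basis[OF indep_e] inj_on_eq_iff[OF inj_e])
  then show ?thesis using k by simp
qed

lemma linear_form_lform:
  assumes p: "p \<in> PR d" "homogeneous p 1" obtains v where "p = lform v"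
proof
  define v where "v = (\<Sum>k\<in>{1..d}. scale (Poly_Mapping.lookup p (Poly_Mapping.single k 1)) (e k))"
  have lv: "lform v = (\<Sum>k\<in>{1..d}. Poly_Mapping.single (Poly_Mapping.single k 1) (Poly_Mapping.lookup p (Poly_Mapping.single k 1)))"
    unfolding v_def lform_sum lform_scale by (intro sum.cong refl) (simp add: lform_e mult_single)
  have keys: "Poly_Mapping.keys p \<subseteq> (\<lambda>k. Poly_Mapping.single k 1) ` {1..d}"
  proof
    fix m assume m: "m \<in> Poly_Mapping.keys p"
    then have "monom_degree m = 1" using p(2) by (auto simp: homogeneous_def)
    then obtain k where k: "k \<in> Poly_Mapping.keys m" "Poly_Mapping.lookup m k = 1"
      "\<forall>j\<in>Poly_Mapping.keys m. k \<noteq> j \<longrightarrow> Poly_Mapping.lookup m j = 0"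
      unfolding monom_degree_def by (auto simp: sum_eq_1_iff)
    have "m = Poly_Mapping.single k 1"
      using k by (intro poly_mapping_eqI) (auto simp: lookup_single when_def Poly_Mapping.in_keys_iff)
    moreover have "k \<in> {1..d}" using k(1) m p(1) unfolding PR_iff by blast
    ultimately show "m \<in> (\<lambda>k. Poly_Mapping.single k 1) ` {1..d}" by blast
  qed
  have "p = (\<Sum>m\<in>(\<lambda>k. Poly_Mapping.single k 1) ` {1..d}. Poly_Mapping.single m (Poly_Mapping.lookup p m))"
    by (subst sum_single_keys[of p, symmetric], rule sum.mono_neutral_left)
       (use keys in \<open>auto simp: Poly_Mapping.in_keys_iff\<close>)
  also have "\<dots> = lform v"
    unfolding lv by (subst sum.reindex) (auto simp: inj_on_def simp: single_inj)
  finally show "p = lform v" .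
qed

text \<open>Functoriality of the symmetric algebra.\<close>

lemma linear_induced_hom:
  assumes "Vector_Spaces.linear scale scale \<pi>"
  obtains \<phi> where "\<And>x y. \<phi> (x + y) = \<phi> x + \<phi> y" "\<And>x y. \<phi> (x * y) = \<phi> x * \<phi> y"
    "\<And>c. \<phi> (const c) = const c" "\<And>x. x \<in> PR d \<Longrightarrow> \<phi> x \<in> PR d" "\<And>v. \<phi> (lform v) = lform (\<pi> v)"
proof -
  interpret \<pi>: Vector_Spaces.linear scale scale \<pi> by fact
  define \<phi> where "\<phi> = poly_subst (\<lambda>k. lform (\<pi> (e k)))"
  have "\<phi> (lform v) = lform (\<pi> v)" for v
  proof -
    have "\<phi> (lform v) = (\<Sum>k\<in>{1..d}. const (coord v k) * lform (\<pi> (e k)))"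
      unfolding \<phi>_def lform_eq[of v] poly_subst_sum poly_subst_mult poly_subst_const poly_subst_pvar ..
    also have "\<dots> = lform (\<pi> (\<Sum>k\<in>{1..d}. scale (coord v k) (e k)))"
      by (simp add: \<pi>.sum \<pi>.scale lform_sum lform_scale)
    finally show ?thesis by (simp only: sum_coord)
  qed
  then show ?thesis
    by (intro that[of \<phi>]) (auto simp: \<phi>_def poly_subst_add poly_subst_mult poly_subst_const intro!: poly_subst_PR)
qed

lemma projection_exists:
  assumes "subspace U"
  obtains \<pi> where "Vector_Spaces.linear scale scale \<pi>" "\<And>v. \<pi> v \<in> U" "\<And>v. v \<in> U \<Longrightarrow> \<pi> v = v"
proof -
  interpret vector_space_pair scale scale by unfold_locales
  have "\<exists>g. g ` UNIV \<subseteq> U \<and> Vector_Spaces.linear scale scale g \<and> (\<forall>v\<in>U. g (id v) = v)"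
    by (rule linear_exists_left_inverse_on[OF linear_id[unfolded id_def, folded id_def] assms]) simp
  then show ?thesis using that by (metis UNIV_I id_apply image_subset_iff)
qed

definition lin_ideal :: "'v set \<Rightarrow> 'k mpol set" where
  "lin_ideal X = ideal_gen d (lform ` X)"

lemma lform_image_PR: "lform ` X \<subseteq> PR d" by auto

lemma ideal_lin_ideal: "ideal (lin_ideal X) (poly_ring d)"
  unfolding lin_ideal_def by (rule ideal_ideal_gen[OF lform_image_PR])

lemma lin_ideal_base: "v \<in> X \<Longrightarrow> lform v \<in> lin_ideal X"
  unfolding lin_ideal_def by (rule ideal_gen_base[OF lform_image_PR]) simp

lemma lin_ideal_minimal: "ideal I (poly_ring d) \<Longrightarrow> (\<And>v. v \<in> X \<Longrightarrow> lform v \<in> I) \<Longrightarrow> lin_ideal X \<subseteq> I"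
  unfolding lin_ideal_def by (rule ideal_gen_minimal) auto

lemma subspace_lform_vimage:
  assumes "ideal I (poly_ring d)" shows "subspace {v. lform v \<in> I}"
  unfolding subspace_def
  using ideal_PR_0[OF assms] ideal_PR_add[OF assms] ideal_PR_mult[OF assms]
  by (auto simp: lform_add lform_scale)

lemma lin_ideal_span: "lin_ideal (span X) = lin_ideal X"
proof
  have "span X \<subseteq> {v. lform v \<in> lin_ideal X}"
    by (rule span_minimal[OF _ subspace_lform_vimage[OF ideal_lin_ideal]]) (auto intro: lin_ideal_base)
  then show "lin_ideal (span X) \<subseteq> lin_ideal X"
    by (intro lin_ideal_minimal[OF ideal_lin_ideal]) auto
  show "lin_ideal X \<subseteq> lin_ideal (span X)"
    by (intro lin_ideal_minimal[OF ideal_lin_ideal] lin_ideal_base span_base)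
qed

text \<open>With \<open>\<rho>\<close> a projection of the space onto \<open>U\<close>, the homomorphism \<open>\<phi>\<close> induced by \<open>v \<mapsto> v - \<rho> v\<close> kills \<open>U\<close>, and
  \<open>\<phi> s - s\<close> lies in the ideal of \<open>U\<close> for all \<open>s\<close> because it does so for the variables. So the ideal is the
  kernel of a homomorphism into a domain, which makes it prime and shows which linear forms it contains.\<close>

lemma lin_ideal_kernel:
  assumes U: "subspace U"
  obtains \<phi> where "\<And>x y. \<phi> (x * y) = \<phi> x * \<phi> y" "\<phi> 1 = 1" "\<And>s. s \<in> PR d \<Longrightarrow> s \<in> lin_ideal U \<longleftrightarrow> \<phi> s = (0::'k mpol)"
    "\<And>v. \<phi> (lform v) = 0 \<longleftrightarrow> v \<in> U"
proof -
  obtain \<rho> where \<rho>: "Vector_Spaces.linear scale scale \<rho>" "\<And>v. \<rho> v \<in> U" "\<And>v. v \<in> U \<Longrightarrow> \<rho> v = v"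
    using projection_exists[OF U] by blast
  interpret \<rho>: Vector_Spaces.linear scale scale \<rho> by fact
  have "Vector_Spaces.linear scale scale (\<lambda>v. v - \<rho> v)"
    by unfold_locales (auto simp: \<rho>.add \<rho>.scale scale_right_diff_distrib)
  then obtain \<phi> where \<phi>: "\<And>x y. \<phi> (x + y) = \<phi> x + \<phi> y" "\<And>x y. \<phi> (x * y) = \<phi> x * \<phi> y"
    "\<And>c. \<phi> (const c) = const c" "\<And>x. x \<in> PR d \<Longrightarrow> \<phi> x \<in> PR d" "\<And>v. \<phi> (lform v) = lform (v - \<rho> v)"
    using linear_induced_hom by blast
  note I = ideal_lin_ideal[of U]
  have \<phi>0: "\<phi> 0 = 0" and \<phi>1: "\<phi> 1 = 1" using \<phi>(3)[of 0] \<phi>(3)[of 1] by simp_all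
  have lf: "\<phi> (lform v) = 0 \<longleftrightarrow> v \<in> U" for v
    unfolding \<phi>(5) lform_eq_0_iff using \<rho>(2)[of v] \<rho>(3)[of v] by auto
  have diff: "\<phi> s - s \<in> lin_ideal U" if "s \<in> PR d" for s
    using that
  proof (induction rule: PR_induct)
    case (const c)
    then show ?case using ideal_PR_0[OF I] by (simp add: \<phi>)
  next
    case (pvar k)
    have "\<phi> (pvar k) - pvar k = lform (- \<rho> (e k))"
      using pvar \<phi>(5)[of "e k"] by (simp add: lform_e[symmetric] lform_diff[symmetric])
    then show ?case using \<rho>(2) U by (auto intro: lin_ideal_base simp: subspace_neg)
  next
    case (add x y)
    have "\<phi> (x + y) - (x + y) = (\<phi> x - x) + (\<phi> y - y)" by (simp add: \<phi>)
    then show ?case using ideal_PR_add[OF I] add by metis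
  next
    case (mult x y)
    have "\<phi> (x * y) - x * y = \<phi> y * (\<phi> x - x) + x * (\<phi> y - y)" by (simp add: \<phi> algebra_simps)
    then show ?case using ideal_PR_add[OF I] ideal_PR_mult[OF I] mult \<phi>(4) by metis
  qed
  have "s \<in> lin_ideal U \<longleftrightarrow> \<phi> s = 0" if "s \<in> PR d" for s
  proof
    assume "\<phi> s = 0"
    then show "s \<in> lin_ideal U" using ideal_PR_uminus[OF I diff[OF that]] by simp
  next
    have "ideal {s \<in> PR d. \<phi> s = 0} (poly_ring d)"
      unfolding ideal_PR_iff using \<phi>0 by (auto simp: \<phi>)
    then have "lin_ideal U \<subseteq> {s \<in> PR d. \<phi> s = 0}"
      by (rule lin_ideal_minimal) (use lf in auto)
    then show "s \<in> lin_ideal U \<Longrightarrow> \<phi> s = 0" by blast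
  qed
  then show ?thesis using \<phi>(2) \<phi>1 lf by (intro that[of \<phi>]) blast+
qed

lemma lin_ideal_prime:
  assumes "s \<in> PR d" "t \<in> PR d" "s * t \<in> lin_ideal (span X)"
  shows "s \<in> lin_ideal (span X) \<or> t \<in> lin_ideal (span X)"
proof -
  obtain \<phi> where "\<And>x y. \<phi> (x * y) = \<phi> x * \<phi> y" "\<And>s. s \<in> PR d \<Longrightarrow> s \<in> lin_ideal (span X) \<longleftrightarrow> \<phi> s = (0::'k mpol)"
    using lin_ideal_kernel[OF subspace_span[of X]] by metis
  then show ?thesis using assms PR_mult by (metis mult_eq_0_iff)
qed

lemma one_notin_lin_ideal: "1 \<notin> lin_ideal (span X)"
  using lin_ideal_kernel[OF subspace_span[of X]] PR_1 by (metis zero_neq_one)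

lemma lform_in_lin_ideal_iff: "lform v \<in> lin_ideal (span X) \<longleftrightarrow> v \<in> span X"
  using lin_ideal_kernel[OF subspace_span[of X]] lform_PR by metis

lemma prod_in_lin_ideal:
  assumes "finite A" "\<And>i. i \<in> A \<Longrightarrow> g i \<in> PR d" "prod g A \<in> lin_ideal (span X)"
  shows "\<exists>i\<in>A. g i \<in> lin_ideal (span X)"
  using assms
proof (induction A rule: finite_induct)
  case empty
  then show ?case using one_notin_lin_ideal by simp
next
  case (insert x F)
  have "g x \<in> PR d" "prod g F \<in> PR d" using insert.prems(1) by auto
  then show ?case using lin_ideal_prime[of "g x" "prod g F" X] insert by auto
qed

text \<open>Modulo the prime ideal of \<open>span X\<close>, the relation \<open>x \<gamma>\<^sub>y = y \<gamma>\<^sub>x\<close> makes the quotient \<open>\<gamma>\<^sub>y / y\<close> independent of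
  \<open>y\<close>. It is a scalar: if \<open>x \<in> W\<close> is not in \<open>span X\<close>, then \<open>x\<close> is prime modulo \<open>span X\<close>, and it divides \<open>y \<gamma>\<^sub>x\<close> for
  all \<open>y\<close>. So \<open>x\<close> divides \<open>\<gamma>\<^sub>x\<close>, unless it divides every \<open>y \<in> W\<close>; but then it divides \<open>\<gamma>\<^sub>x \<in> W\<close> as well.\<close>

lemma lform_division:
  assumes W: "subspace W" "\<And>y. y \<in> W \<Longrightarrow> \<gamma> y \<in> W"
    and sym: "\<And>x y. x \<in> W \<Longrightarrow> y \<in> W \<Longrightarrow> lform x * lform (\<gamma> y) - lform y * lform (\<gamma> x) \<in> lin_ideal (span X)"
  shows "\<exists>c. \<forall>y\<in>W. \<gamma> y - scale c y \<in> span X"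
proof (cases "W \<subseteq> span X")
  case True
  then show ?thesis using W(2) by (intro exI[of _ 0]) auto
next
  case False
  then obtain x where x: "x \<in> W" "x \<notin> span X" by blast
  let ?X = "insert x X"
  note I' = ideal_lin_ideal[of "span ?X"] and I = ideal_lin_ideal[of "span X"]
  have sub: "lin_ideal (span X) \<subseteq> lin_ideal (span ?X)"
    by (intro lin_ideal_minimal[OF I'] lin_ideal_base) (meson span_mono subset_insertI subsetD)
  have "\<gamma> x \<in> span ?X"
  proof (cases "W \<subseteq> span ?X")
    case False
    then obtain y where y: "y \<in> W" "y \<notin> span ?X" by blast
    have "lform (\<gamma> y) * lform x \<in> lin_ideal (span ?X)"
      by (intro ideal_PR_mult[OF I'] lin_ideal_base span_base) auto
    then have "lform y * lform (\<gamma> x) \<in> lin_ideal (span ?X)"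
      using ideal_PR_diff[OF I' _ subsetD[OF sub sym[OF x(1) y(1)]], of "lform x * lform (\<gamma> y)"]
      by (simp add: mult.commute)
    then show ?thesis using lin_ideal_prime[of "lform y" "lform (\<gamma> x)" ?X] y
      by (auto simp: lform_in_lin_ideal_iff)
  qed (use W x in auto)
  then obtain c where c: "\<gamma> x - scale c x \<in> span X" by (auto simp: span_breakdown_eq)
  have "\<gamma> y - scale c y \<in> span X" if y: "y \<in> W" for y
  proof -
    have "lform x * lform (\<gamma> y - scale c y) =
        (lform x * lform (\<gamma> y) - lform y * lform (\<gamma> x)) + lform y * lform (\<gamma> x - scale c x)"
      by (simp add: lform_diff lform_scale algebra_simps)
    also have "\<dots> \<in> lin_ideal (span X)"
      using sym[OF x(1) y] c by (intro ideal_PR_add[OF I] ideal_PR_mult[OF I] lin_ideal_base) auto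
    finally show ?thesis
      using lin_ideal_prime[of "lform x" "lform (\<gamma> y - scale c y)" X] x by (auto simp: lform_in_lin_ideal_iff)
  qed
  then show ?thesis by blast
qed

text \<open>A linear form outside the prime ideal \<open>I\<close> of linear forms satisfies \<open>I : x = I\<close>, so the generators
  can be added one at a time. Up to isomorphism, this builds the Koszul complex.\<close>

lemma lin_ideal_lin_res:
  assumes "finite X" shows "\<exists>\<rho> A. lin_res d 1 (lin_ideal (span X)) \<rho> A"
  using assms
proof induction
  case empty
  have "lin_ideal (span {}) = {0}"
    unfolding lin_ideal_span by (simp add: lin_ideal_def ideal_gen_empty)
  then show ?case using lin_res_zero by metis
next
  case (insert x X)
  then obtain \<rho> A where A: "lin_res d 1 (lin_ideal (span X)) \<rho> A" by blast
  have ins: "lin_ideal (span (insert x X)) = ideal_gen d (insert (lform x) (lform ` X))"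
    unfolding lin_ideal_span by (simp add: lin_ideal_def)
  show ?case
  proof (cases "x \<in> span X")
    case True
    then have "span (insert x X) = span X" by (rule span_redundant)
    then show ?thesis using A by metis
  next
    case False
    have "colon d (lin_ideal (span X)) (lform x) = lin_ideal (span X)"
    proof (intro equalityI subsetI)
      fix s assume "s \<in> colon d (lin_ideal (span X)) (lform x)"
      then show "s \<in> lin_ideal (span X)"
        using lin_ideal_prime[of s "lform x" X] False by (auto simp: colon_def lform_in_lin_ideal_iff)
    next
      fix s assume "s \<in> lin_ideal (span X)"
      then show "s \<in> colon d (lin_ideal (span X)) (lform x)"
        using ideal_PR_mult[OF ideal_lin_ideal, of s "span X" "lform x"] ideal_PR_sub[OF ideal_lin_ideal]
        by (auto simp: colon_def mult.commute)
    qed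
    from lin_res_cone[OF A A lform_PR homogeneous_lform this]
    show ?thesis
      unfolding ins ideal_gen_insert[OF lform_image_PR lform_PR] lin_ideal_def[symmetric]
      by (simp only: lin_ideal_span)
  qed
qed

end

section \<open>Generic bases\<close>

text \<open>Generators of \<open>W\<^sub>b\<close> for \<open>b = a - (1,\<dots>,1)\<close>, restricted to the indices in \<open>N\<close>.\<close>

definition below :: "(nat \<Rightarrow> nat \<Rightarrow> 'v) \<Rightarrow> nat set \<Rightarrow> (nat \<Rightarrow> nat) \<Rightarrow> 'v set" where
  "below f N a = {f i j |i j. i \<in> N \<and> 1 \<le> j \<and> j < a i}"

lemma below_cong: "(\<And>i. i \<in> N \<Longrightarrow> a i = b i) \<Longrightarrow> below f N a = below f N b"
  unfolding below_def by metis

context sym_space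
begin

lemma ordered_basis_if_spanning:
  assumes "span (g ` {1..dim U}) = U" shows "ordered_basis scale (dim U) g U"
proof -
  have le: "dim U \<le> card (g ` {1..dim U})"
    by (rule dim_le_card) (use assms in auto)
  moreover have "card (g ` {1..dim U}) \<le> dim U" using card_image_le[of "{1..dim U}" g] by simp
  ultimately have card: "card (g ` {1..dim U}) = dim U" by simp
  then have "inj_on g {1..dim U}" by (intro eq_card_imp_inj_on) auto
  moreover have "independent (g ` {1..dim U})"
    using span_superset[of "g ` {1..dim U}"] unfolding assms
    by (intro card_le_dim_spanning[of _ U]) (simp_all add: assms card)
  ultimately show ?thesis using assms by (simp add: ordered_basis_def)
qed

lemma separating_functional:
  assumes U: "v \<notin> span U" and w: "w \<notin> span (insert v U)"
  obtains \<xi> :: "'v \<Rightarrow> 'k" where "Vector_Spaces.linear scale (*) \<xi>" "\<And>u. u \<in> span U \<Longrightarrow> \<xi> u = 0" "\<xi> v = 1" "\<xi> w = 1"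
proof -
  interpret vp: vector_space_pair scale "(*) :: 'k \<Rightarrow> 'k \<Rightarrow> 'k"
    by unfold_locales (auto simp: algebra_simps)
  obtain B where B: "B \<subseteq> U" "independent B" "U \<subseteq> span B" using maximal_independent_subset by blast
  have sB: "span B = span U" using B span_mono[of B U] span_minimal[of U "span B"] by auto
  have "span (insert v B) \<subseteq> span (insert v U)" using B by (intro span_mono) auto
  then have "independent (insert w (insert v B))"
    using U w B sB by (intro independent_insertI) auto
  then obtain \<xi> where \<xi>: "Vector_Spaces.linear scale (*) \<xi>"
    "\<forall>x\<in>insert w (insert v B). \<xi> x = (if x = v \<or> x = w then 1 else (0::'k))"
    using vp.linear_independent_extend[of _ "\<lambda>x. if x = v \<or> x = w then 1 else 0"] by blast
  have vw: "v \<notin> B" "w \<notin> B" using U w B(1) span_superset by blast+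
  have "\<xi> u = 0" if "u \<in> span U" for u
  proof (rule vp.linear_eq_0_on_span[OF \<xi>(1), of B u])
    show "\<xi> x = 0" if "x \<in> B" for x using \<xi>(2) vw that by auto
  qed (use that sB in simp)
  then show ?thesis using that \<xi> by simp
qed

text \<open>The set \<open>T\<close> is a minimal one for which some \<open>v = f i (a i)\<close> with \<open>i \<in> T\<close> lies in the span \<open>W\<close> of \<open>below f T a\<close>. If
  \<open>w = f j (a j)\<close> were outside \<open>W\<close> for some \<open>j \<in> T\<close>, then, as \<open>v\<close> is not in the span \<open>U\<close> of \<open>below f (T - {j}) a\<close> by
  minimality, there is a functional \<open>\<xi>\<close> that vanishes on \<open>U\<close> and is \<open>1\<close> on \<open>v\<close> and \<open>w\<close>. Subtracting multiples of \<open>w\<close>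
  moves the vectors \<open>f j k\<close>, \<open>k < a j\<close>, into the kernel of \<open>\<xi>\<close> and leaves a basis of \<open>V j\<close>. The new span has at least
  the dimension of \<open>W\<close>, since the two agree after \<open>w\<close> is added and \<open>w\<close> is in neither. It does not contain \<open>v\<close>
  any more, so adding \<open>v\<close> increases the dimension, in contrast to \<open>W\<close>. This contradicts genericity.\<close>

lemma generic_tight:
  assumes gen: "generic_bases scale n V f" and N: "N \<subseteq> {1..n}"
    and a: "\<And>i. i \<in> N \<Longrightarrow> a i \<in> {1..dim (V i)}"
    and i: "i \<in> N" "f i (a i) \<in> span (below f N a)"
  shows "\<exists>T\<subseteq>N. T \<noteq> {} \<and> (\<forall>j\<in>T. f j (a j) \<in> span (below f T a))"
proof -
  define S where "S T \<longleftrightarrow> T \<subseteq> N \<and> (\<exists>i\<in>T. f i (a i) \<in> span (below f T a))" for T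
  have "S N" using i by (auto simp: S_def)
  then obtain T where T: "S T" and min: "\<And>T'. S T' \<Longrightarrow> card T \<le> card T'"
    using ex_has_least_nat[of S N card] by blast
  have "finite T" using T N by (auto simp: S_def intro: finite_subset)
  obtain i where i: "i \<in> T" "f i (a i) \<in> span (below f T a)" using T by (auto simp: S_def)
  have "f j (a j) \<in> span (below f T a)" if j: "j \<in> T" for j
  proof (rule ccontr)
    define v where "v = f i (a i)"
    define w where "w = f j (a j)"
    define U where "U = below f (T - {j}) a"
    assume "f j (a j) \<notin> span (below f T a)"
    then have w: "w \<notin> span (below f T a)" by (simp add: w_def)
    have ij: "i \<noteq> j" using i w by (auto simp: w_def)
    have "\<not> S (T - {j})" using min[of "T - {j}"] card_Diff1_less[OF \<open>finite T\<close> j] by auto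
    then have v: "v \<notin> span U" using i ij T by (auto simp: S_def U_def v_def)
    have "insert v U \<subseteq> span (below f T a)"
      using i span_superset[of "below f T a"] by (auto simp: U_def v_def below_def)
    then have "span (insert v U) \<subseteq> span (below f T a)" by (rule span_minimal) simp
    then have wU: "w \<notin> span (insert v U)" using w by blast
    obtain \<xi> where \<xi>: "Vector_Spaces.linear scale (*) \<xi>" "\<And>u. u \<in> span U \<Longrightarrow> \<xi> u = 0" "\<xi> v = 1" "\<xi> w = 1"
      using separating_functional[OF v wU] by blast
    interpret \<xi>: Vector_Spaces.linear scale "(*)" \<xi> by (rule \<xi>(1))
    define g where "g l k = (if l = j \<and> k < a j then f j k - scale (\<xi> (f j k)) w else f l k)" for l k
    have jN: "j \<in> {1..n}" and aj: "1 \<le> a j" "a j \<le> dim (V j)" using T j N a by (auto simp: S_def)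
    have fb: "ordered_basis scale (dim (V l)) (f l) (V l)" if "l \<in> {1..n}" for l
      using gen that by (simp add: generic_bases_def collection_of_bases_def)
    have gl: "g l = f l" if "l \<noteq> j" for l using that by (simp add: g_def fun_eq_iff)
    have gw: "g j (a j) = w" by (simp add: g_def w_def)
    have Vj: "subspace (V j)" and spV: "span (f j ` {1..dim (V j)}) = V j"
      using fb[OF jN] subspace_span by (metis ordered_basis_def)+
    have fV: "f j k \<in> V j" if "k \<in> {1..dim (V j)}" for k
      using that spV span_superset by blast
    have "span (g j ` {1..dim (V j)}) = V j"
    proof
      have wV: "w \<in> V j" using fV[of "a j"] aj by (simp add: w_def)
      show "span (g j ` {1..dim (V j)}) \<subseteq> V j"
        using fV wV Vj by (intro span_minimal) (auto simp: g_def subspace_diff subspace_scale)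
      have wg: "w \<in> span (g j ` {1..dim (V j)})" using gw aj by (intro span_base) force
      have "f j k \<in> span (g j ` {1..dim (V j)})" if k: "k \<in> {1..dim (V j)}" for k
      proof -
        have "f j k = g j k + scale (if k < a j then \<xi> (f j k) else 0) w" by (simp add: g_def)
        moreover have "g j k \<in> span (g j ` {1..dim (V j)})" using k by (intro span_base) auto
        ultimately show ?thesis using wg by (metis span_add span_scale)
      qed
      then have "span (f j ` {1..dim (V j)}) \<subseteq> span (g j ` {1..dim (V j)})"
        by (intro span_minimal) auto
      then show "V j \<subseteq> span (g j ` {1..dim (V j)})" by (simp only: spV)
    qed
    then have "ordered_basis scale (dim (V j)) (g j) (V j)" by (rule ordered_basis_if_spanning)
    then have cb: "collection_of_bases scale n V g"
      unfolding collection_of_bases_def using fb gl by metis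
    \<comment> \<open>The multi-index for which \<open>W\<close> is spanned by \<open>below f T a\<close> and \<open>v\<close>.\<close>
    define c where "c l = (if l \<in> T then if l = i then a l else a l - 1 else 0)" for l
    have "\<forall>l\<in>{1..n}. c l \<le> dim (V l)"
      using T a by (auto simp: c_def S_def) (meson atLeastAtMost_iff diff_le_self le_trans subsetD)+
    then have "dim (W_span scale n g c) \<le> dim (W_span scale n f c)"
      using gen cb by (simp add: generic_bases_def)
    moreover have W: "W_span scale n h c = span (insert (h i (a i)) (below h T a))" for h
    proof -
      have "{h i j |i j. i \<in> {1..n} \<and> j \<in> {1..c i}} = insert (h i (a i)) (below h T a)"
      proof (intro equalityI subsetI)
        fix x assume "x \<in> {h i j |i j. i \<in> {1..n} \<and> j \<in> {1..c i}}"
        then obtain l k where lk: "x = h l k" "l \<in> {1..n}" "1 \<le> k" "k \<le> c l" by auto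
        then have l: "l \<in> T" by (auto simp: c_def split: if_splits)
        show "x \<in> insert (h i (a i)) (below h T a)"
        proof (cases "k < a l")
          case True
          then show ?thesis using lk l unfolding below_def by blast
        next
          case False
          then have "l = i \<and> k = a i" using lk l by (auto simp: c_def split: if_splits)
          then show ?thesis using lk by simp
        qed
      next
        fix x assume "x \<in> insert (h i (a i)) (below h T a)"
        then obtain l k where "x = h l k" "l \<in> T" "1 \<le> k" "k \<le> c l"
        proof (elim insertE)
          assume "x = h i (a i)"
          moreover have "1 \<le> a i" using a[of i] i T by (auto simp: S_def)
          ultimately show thesis using that[of i "a i"] i by (simp add: c_def)
        next
          assume "x \<in> below h T a"
          then obtain l k where "x = h l k" "l \<in> T" "1 \<le> k" "k < a l" unfolding below_def by blast
          moreover from this have "k \<le> c l" by (auto simp: c_def)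
          ultimately show thesis using that[of l k] by blast
        qed
        moreover have "T \<subseteq> {1..n}" using T N by (auto simp: S_def)
        ultimately show "x \<in> {h i j |i j. i \<in> {1..n} \<and> j \<in> {1..c i}}"
          by (intro CollectI exI[of _ l] exI[of _ k]) auto
      qed
      then show ?thesis by (simp add: W_span_def)
    qed
    have "dim (W_span scale n f c) = dim (below f T a)"
      unfolding W using i by (simp add: dim_insert)
    moreover have ker: "\<xi> u = 0" if "u \<in> span (below g T a)" for u
    proof -
      have "below g T a \<subseteq> {u. \<xi> u = 0}"
      proof
        fix x assume "x \<in> below g T a"
        then obtain l k where x: "x = g l k" "l \<in> T" "1 \<le> k" "k < a l" unfolding below_def by blast
        show "x \<in> {u. \<xi> u = 0}"
        proof (cases "l = j")
          case True
          then show ?thesis using x by (simp add: g_def \<xi>.diff \<xi>.scale \<xi>(4))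
        next
          case False
          then have "x \<in> U" using x gl[OF False] unfolding U_def below_def by auto
          then show ?thesis using \<xi>(2) span_base by simp
        qed
      qed
      moreover have "subspace {u. \<xi> u = 0}"
        unfolding subspace_def by (auto simp: \<xi>.add \<xi>.scale \<xi>.zero)
      ultimately show ?thesis using span_minimal that by blast
    qed
    have "dim (W_span scale n g c) = dim (below g T a) + 1"
      unfolding W gl[OF ij] v_def[symmetric] using ker[of v] \<xi>(3) by (auto simp: dim_insert)
    moreover have "dim (below f T a) \<le> dim (below g T a)"
    proof -
      have "below f T a \<subseteq> span (insert w (below g T a))"
      proof
        fix x assume "x \<in> below f T a"
        then obtain l k where x: "x = f l k" "l \<in> T" "1 \<le> k" "k < a l" unfolding below_def by blast
        have "g l k \<in> span (insert w (below g T a))"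
          using x by (intro span_base insertI2) (auto simp: below_def)
        moreover have "w \<in> span (insert w (below g T a))" by (rule span_base) simp
        moreover have "f l k = g l k + scale (if l = j then \<xi> (f j k) else 0) w"
          using x by (auto simp: g_def)
        ultimately show "x \<in> span (insert w (below g T a))" using x by (metis span_add span_scale)
      qed
      then have "insert w (below f T a) \<subseteq> span (insert w (below g T a))" by (simp add: span_base)
      then have "dim (insert w (below f T a)) \<le> dim (insert w (below g T a))" by (rule dim_mono)
      moreover have "w \<notin> span (below g T a)" using ker[of w] \<xi>(4) by auto
      ultimately show ?thesis using w by (simp add: dim_insert)
    qed
    ultimately show False by linarith
  qed
  then show ?thesis using T i by (intro exI[of _ T]) (auto simp: S_def)
qed

end

section \<open>Products of linear forms indexed by poset ideals\<close>

text \<open>What the algebra uses of a generic collection of bases. The index set \<open>{1..n}\<close> is replaced by an arbitrary finite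
  set \<open>M\<close>, and the notions below depend on an index set \<open>N\<close>, because the induction passes to subarrangements.\<close>

locale tight_arrangement = sym_space scale d e
  for scale :: "'k::field \<Rightarrow> 'v::ab_group_add \<Rightarrow> 'v" and d :: nat and e :: "nat \<Rightarrow> 'v" +
  fixes M :: "nat set" and m :: "nat \<Rightarrow> nat" and f :: "nat \<Rightarrow> nat \<Rightarrow> 'v"
  assumes finite_M: "finite M"
    and f_nonzero: "i \<in> M \<Longrightarrow> j \<in> {1..m i} \<Longrightarrow> f i j \<noteq> 0"
    and tight: "N \<subseteq> M \<Longrightarrow> (\<And>i. i \<in> N \<Longrightarrow> a i \<in> {1..m i}) \<Longrightarrow> i \<in> N \<Longrightarrow>
        f i (a i) \<in> span (below f N a) \<Longrightarrow>
        \<exists>T\<subseteq>N. T \<noteq> {} \<and> (\<forall>j\<in>T. f j (a j) \<in> span (below f T a))"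
begin

text \<open>The poset \<open>D\<close> of the subarrangement indexed by \<open>N\<close>.\<close>

definition box :: "nat set \<Rightarrow> (nat \<Rightarrow> nat) set" where
  "box N = (\<Pi>\<^sub>E i\<in>N. {1..m i})"

definition lower_set :: "nat set \<Rightarrow> (nat \<Rightarrow> nat) set \<Rightarrow> bool" where
  "lower_set N P \<longleftrightarrow> P \<subseteq> box N \<and> (\<forall>a\<in>box N. \<forall>b\<in>P. (\<forall>i\<in>N. a i \<le> b i) \<longrightarrow> a \<in> P)"

definition maximal_in :: "nat set \<Rightarrow> (nat \<Rightarrow> nat) set \<Rightarrow> (nat \<Rightarrow> nat) \<Rightarrow> bool" where
  "maximal_in N P a \<longleftrightarrow> a \<in> P \<and> (\<forall>c\<in>P. (\<forall>i\<in>N. a i \<le> c i) \<longrightarrow> c = a)"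

definition fprod :: "nat set \<Rightarrow> (nat \<Rightarrow> nat) \<Rightarrow> 'k mpol" where
  "fprod N a = (\<Prod>i\<in>N. lform (f i (a i)))"

definition J :: "nat set \<Rightarrow> (nat \<Rightarrow> nat) set \<Rightarrow> 'k mpol set" where
  "J N P = ideal_gen d (fprod N ` P)"

lemma fprod_PR [simp, intro]: "fprod N a \<in> PR d"
  unfolding fprod_def by (intro PR_prod) simp

lemma homogeneous_fprod: "finite N \<Longrightarrow> homogeneous (fprod N a) (int (card N))"
  unfolding fprod_def by (intro homogeneous_prod) auto

lemma fprod_image_PR: "fprod N ` P \<subseteq> PR d" by auto

lemma ideal_J: "ideal (J N P) (poly_ring d)"
  unfolding J_def by (rule ideal_ideal_gen[OF fprod_image_PR])

lemma J_base: "c \<in> P \<Longrightarrow> fprod N c \<in> J N P"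
  unfolding J_def by (rule ideal_gen_base[OF fprod_image_PR]) simp

lemma J_minimal: "ideal I (poly_ring d) \<Longrightarrow> (\<And>c. c \<in> P \<Longrightarrow> fprod N c \<in> I) \<Longrightarrow> J N P \<subseteq> I"
  unfolding J_def by (rule ideal_gen_minimal) auto

lemma J_remove:
  assumes "a \<in> P"
  shows "J N P = {j + v * fprod N a |j v. j \<in> J N (P - {a}) \<and> v \<in> PR d}"
proof -
  have "fprod N ` P = insert (fprod N a) (fprod N ` (P - {a}))" using assms by blast
  then show ?thesis
    unfolding J_def by (simp only: ideal_gen_insert[OF fprod_image_PR fprod_PR])
qed

lemma J_remove_redundant:
  assumes "a \<in> P" "fprod N a \<in> J N (P - {a})" shows "J N P = J N (P - {a})"
proof -
  have "fprod N ` P = insert (fprod N a) (fprod N ` (P - {a}))" using assms by blast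
  then show ?thesis
    using ideal_gen_insert_redundant[OF fprod_image_PR] assms(2) unfolding J_def by metis
qed

lemma ideal_colon: "ideal I (poly_ring d) \<Longrightarrow> ideal {s \<in> PR d. s * g \<in> I} (poly_ring d)"
  by (auto simp: ideal_PR_iff distrib_right mult.assoc)

lemma finite_box: "finite N \<Longrightarrow> finite (box N)"
  unfolding box_def by (intro finite_PiE) auto

lemma finite_lower_set: "finite N \<Longrightarrow> lower_set N P \<Longrightarrow> finite P"
  unfolding lower_set_def using finite_box finite_subset by blast

lemma maximal_in_exists:
  assumes "finite N" "lower_set N P" "P \<noteq> {}" shows "\<exists>a. maximal_in N P a"
proof -
  let ?s = "\<lambda>a. \<Sum>i\<in>N. a i"
  have fin: "finite P" using finite_lower_set assms by blast
  have "Max (?s ` P) \<in> ?s ` P" using fin assms(3) by (intro Max_in) auto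
  then obtain a where a: "a \<in> P" "Max (?s ` P) = ?s a" by auto
  have "c = a" if c: "c \<in> P" "\<forall>i\<in>N. a i \<le> c i" for c
  proof (rule ccontr)
    assume "c \<noteq> a"
    have ac: "a \<in> extensional N" "c \<in> extensional N"
      using a c assms(2) by (auto simp: lower_set_def box_def PiE_def)
    then obtain i where "i \<in> N" "c i \<noteq> a i" using \<open>c \<noteq> a\<close> by (metis extensionalityI)
    then have "a i < c i" using c(2) by (simp add: le_neq_implies_less)
    then have "?s a < ?s c" using c(2) assms(1) \<open>i \<in> N\<close> by (intro sum_strict_mono_ex1) auto
    moreover have "?s c \<le> ?s a" unfolding a(2)[symmetric] using fin c by (intro Max_ge) auto
    ultimately show False by simp
  qed
  then show ?thesis using a by (auto simp: maximal_in_def)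
qed

lemma lower_set_remove: "lower_set N P \<Longrightarrow> maximal_in N P a \<Longrightarrow> lower_set N (P - {a})"
  unfolding lower_set_def maximal_in_def by blast

text \<open>Replacing the factor \<open>f i (a i)\<close> by \<open>f i j\<close> with \<open>j < a i\<close> leads from \<open>a\<close> to a smaller element of \<open>P\<close>.\<close>

lemma below_mult_fprod:
  assumes N: "finite N" and P: "lower_set N P" and a: "a \<in> P" and v: "v \<in> span (below f N a)"
  shows "lform v * fprod N a \<in> J N (P - {a})"
proof -
  let ?I = "{s \<in> PR d. s * fprod N a \<in> J N (P - {a})}"
  have I: "ideal ?I (poly_ring d)" by (rule ideal_colon[OF ideal_J])
  have "below f N a \<subseteq> {v. lform v \<in> ?I}"
  proof
    fix x assume "x \<in> below f N a"
    then obtain i j where x: "x = f i j" "i \<in> N" "1 \<le> j" "j < a i" unfolding below_def by blast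
    have ab: "a \<in> box N" using P a by (auto simp: lower_set_def)
    have ext: "a(i := j) \<in> extensional N"
      using ab x(2) by (auto simp: box_def PiE_def extensional_def)
    have "a i \<le> m i" using ab x(2) by (auto simp: box_def PiE_def Pi_def)
    then have "a(i := j) \<in> box N"
      using ab x ext by (auto simp: box_def PiE_def Pi_def)
    moreover have "\<forall>k\<in>N. (a(i := j)) k \<le> a k" using x by auto
    ultimately have "a(i := j) \<in> P" using P a unfolding lower_set_def by blast
    moreover have "a(i := j) \<noteq> a" using x(4) by (metis fun_upd_same less_irrefl)
    ultimately have "fprod N (a(i := j)) \<in> J N (P - {a})" by (intro J_base) simp
    then have "lform (f i (a i)) * fprod N (a(i := j)) \<in> J N (P - {a})"
      by (intro ideal_PR_mult[OF ideal_J] lform_PR)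
    also have "lform (f i (a i)) * fprod N (a(i := j)) = lform (f i j) * fprod N a"
    proof -
      have "(\<Prod>k\<in>N - {i}. lform (f k ((a(i := j)) k))) = (\<Prod>k\<in>N - {i}. lform (f k (a k)))"
        by (intro prod.cong) auto
      then show ?thesis
        by (simp add: fprod_def prod.remove[OF N x(2)] mult.left_commute)
    qed
    finally show "x \<in> {v. lform v \<in> ?I}" using x by simp
  qed
  then have "span (below f N a) \<subseteq> {v. lform v \<in> ?I}"
    by (rule span_minimal[OF _ subspace_lform_vimage[OF I]])
  then show ?thesis using v by blast
qed

lemma lin_ideal_subset_colon:
  assumes "finite N" "lower_set N P" "a \<in> P"
  shows "lin_ideal (span (below f N a)) \<subseteq> colon d (J N (P - {a})) (fprod N a)"
  unfolding colon_def
  by (rule lin_ideal_minimal[OF ideal_colon[OF ideal_J]]) (simp add: below_mult_fprod[OF assms])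

text \<open>As \<open>a\<close> is maximal, every other element of \<open>P\<close> is smaller than \<open>a\<close> in some coordinate.\<close>

lemma J_subset_lin_ideal:
  assumes N: "finite N" and P: "lower_set N P" and a: "maximal_in N P a"
  shows "J N (P - {a}) \<subseteq> lin_ideal (span (below f N a))"
proof (rule J_minimal[OF ideal_lin_ideal])
  fix c assume c: "c \<in> P - {a}"
  then obtain i where i: "i \<in> N" "c i < a i" using a unfolding maximal_in_def by (metis Diff_iff not_le singletonI)
  have "1 \<le> c i" using c P i by (auto simp: lower_set_def box_def PiE_def Pi_def)
  then have "f i (c i) \<in> below f N a" using i by (auto simp: below_def)
  then have "lform (f i (c i)) \<in> lin_ideal (span (below f N a))" by (intro lin_ideal_base span_base)
  then have "(\<Prod>k\<in>N - {i}. lform (f k (c k))) * lform (f i (c i)) \<in> lin_ideal (span (below f N a))"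
    by (intro ideal_PR_mult[OF ideal_lin_ideal]) auto
  then show "fprod N c \<in> lin_ideal (span (below f N a))"
    by (simp add: fprod_def prod.remove[OF N i(1)] mult.commute)
qed

lemma colon_J:
  assumes "finite N" "lower_set N P" "maximal_in N P a" "fprod N a \<notin> lin_ideal (span (below f N a))"
  shows "colon d (J N (P - {a})) (fprod N a) = lin_ideal (span (below f N a))"
proof
  have "a \<in> P" using assms(3) by (simp add: maximal_in_def)
  then show "lin_ideal (span (below f N a)) \<subseteq> colon d (J N (P - {a})) (fprod N a)"
    by (rule lin_ideal_subset_colon[OF assms(1,2)])
  show "colon d (J N (P - {a})) (fprod N a) \<subseteq> lin_ideal (span (below f N a))"
  proof
    fix s assume "s \<in> colon d (J N (P - {a})) (fprod N a)"
    then have "s \<in> PR d" "s * fprod N a \<in> lin_ideal (span (below f N a))"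
      using J_subset_lin_ideal[OF assms(1-3)] by (auto simp: colon_def)
    then show "s \<in> lin_ideal (span (below f N a))" using lin_ideal_prime[of s "fprod N a"] assms(4) by auto
  qed
qed

text \<open>The part of the colon statement that depends on genericity. It has a name because the induction proves it
  for all smaller poset ideals of all subarrangements at once.\<close>

definition redundancy :: "nat set \<Rightarrow> (nat \<Rightarrow> nat) set \<Rightarrow> bool" where
  "redundancy N P \<longleftrightarrow> (\<forall>a. maximal_in N P a \<longrightarrow> fprod N a \<in> lin_ideal (span (below f N a)) \<longrightarrow>
     fprod N a \<in> J N (P - {a}))"

lemma mult_hom_prod:
  fixes \<psi> :: "'a::comm_monoid_mult \<Rightarrow> 'b::comm_monoid_mult"
  assumes "\<And>x y. \<psi> (x * y) = \<psi> x * \<psi> y" "\<psi> 1 = 1"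
  shows "\<psi> (prod g A) = (\<Prod>i\<in>A. \<psi> (g i))"
  by (induction A rule: infinite_finite_induct) (auto simp: assms)

lemma hcomp_mult_stable:
  assumes I: "ideal I (poly_ring d)" and s: "s \<in> PR d"
    and x: "\<And>j. hcomp j x \<in> I"
  shows "hcomp j (s * x) \<in> I"
  using s x
proof (induction arbitrary: x j rule: PR_induct)
  case (const c)
  then show ?case using ideal_PR_mult[OF I] by (simp add: hcomp_mult[of _ 0])
next
  case (pvar k)
  have "homogeneous (pvar k) 1" by (simp add: homogeneous_def)
  then have "hcomp j (pvar k * x) = pvar k * hcomp (j - 1) x" by (rule hcomp_mult)
  then show ?case using pvar by (auto intro!: ideal_PR_mult[OF I] PR_pvar)
next
  case (add s t)
  then show ?case using ideal_PR_add[OF I] by (simp add: distrib_right hcomp_add)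
next
  case (mult s t)
  then show ?case by (simp add: mult.assoc)
qed

lemma hcomp_J:
  assumes N: "finite N" and x: "x \<in> J N P" shows "hcomp j x \<in> J N P"
proof -
  let ?I = "{x \<in> PR d. \<forall>j. hcomp j x \<in> J N P}"
  have "ideal ?I (poly_ring d)"
    unfolding ideal_PR_iff
    using ideal_PR_0[OF ideal_J] ideal_PR_add[OF ideal_J] hcomp_mult_stable[OF ideal_J]
    by (auto simp: hcomp_add)
  moreover have "fprod N c \<in> ?I" if "c \<in> P" for c
  proof -
    have "hcomp j (fprod N c) = 1 * fprod N c \<or> hcomp j (fprod N c) = 0" for j
    proof (cases "j = int (card N)")
      case True
      then show ?thesis using homogeneous_fprod[OF N] by (simp add: hcomp_homogeneous)
    next
      case False
      then have "hcomp j (fprod N c) = 0"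
        using homogeneous_fprod[OF N, of c] by (intro poly_mapping_eqI) (auto simp: lookup_hcomp homogeneous_def Poly_Mapping.in_keys_iff)
      then show ?thesis ..
    qed
    then have "hcomp j (fprod N c) \<in> J N P" for j
      using J_base[OF that, of N] ideal_PR_0[OF ideal_J[of N P]] by (metis mult_1)
    then show ?thesis by simp
  qed
  ultimately have "J N P \<subseteq> ?I" by (rule J_minimal)
  then show ?thesis using x by blast
qed

text \<open>The local cohomology argument described at the beginning, in elementary terms. The homomorphism \<open>\<psi>\<close> is a
  retraction onto \<open>Sym W\<close>. It fixes all generators and is used to bring the coefficients
  \<open>\<gamma>\<close> into \<open>W\<close>, which \<open>lform_division\<close> needs when \<open>W\<close> is contained in the span of \<open>below f N a\<close> for the maximal element \<open>a\<close> that
  is removed. The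
  hypothesis on the degree of \<open>h\<close> makes the coefficients linear.\<close>

lemma annihilated_in_J:
  assumes N: "finite N" and W: "subspace W" "W \<noteq> {0}"
    and \<rho>: "\<And>v. \<rho> v \<in> W" "\<And>v. v \<in> W \<Longrightarrow> \<rho> v = v"
    and \<psi>: "\<And>x y. \<psi> (x + y) = \<psi> x + \<psi> y" "\<And>x y. \<psi> (x * y) = \<psi> x * \<psi> y"
    "\<And>c. \<psi> (const c) = const c" "\<And>x. x \<in> PR d \<Longrightarrow> \<psi> x \<in> PR d" "\<And>v. \<psi> (lform v) = lform (\<rho> v)"
    and P: "lower_set N P" "\<And>c i. c \<in> P \<Longrightarrow> i \<in> N \<Longrightarrow> f i (c i) \<in> W"
    and red: "\<And>P'. P' \<subseteq> P \<Longrightarrow> lower_set N P' \<Longrightarrow> redundancy N P'"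
    and h: "h \<in> PR d" "homogeneous h (int (card N))" "\<psi> h = h" "\<And>y. y \<in> W \<Longrightarrow> lform y * h \<in> J N P"
  shows "h \<in> J N P"
  using P red h
proof (induction "card P" arbitrary: P h rule: less_induct)
  case less
  have \<psi>1: "\<psi> 1 = 1" using \<psi>(3)[of 1] by simp
  have \<psi>_fprod: "\<psi> (fprod N c) = fprod N c" if "c \<in> P" for c
    using less.prems(2)[OF that] by (simp add: fprod_def mult_hom_prod[of \<psi>, OF \<psi>(2) \<psi>1] \<psi>(5) \<rho>(2))
  show ?case
  proof (cases "P = {}")
    case True
    then have J0: "J N P = {0}" by (simp add: J_def ideal_gen_empty)
    obtain y where "y \<in> W" "y \<noteq> 0" using W subspace_0 by blast
    then have "h = 0" using less.prems(7)[of y] J0 by (simp add: lform_eq_0_iff)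
    then show ?thesis using J0 by simp
  next
    case False
    obtain a where a: "maximal_in N P a" using maximal_in_exists[OF N less.prems(1) False] by blast
    then have aP: "a \<in> P" by (simp add: maximal_in_def)
    let ?Q = "P - {a}" and ?g = "fprod N a" and ?X = "below f N a"
    have Q: "lower_set N ?Q" by (rule lower_set_remove[OF less.prems(1) a])
    have card: "card ?Q < card P"
      using finite_lower_set[OF N less.prems(1)] aP by (intro psubset_card_mono) auto
    note IH = less.hyps[OF card Q]
    have red_Q: "redundancy N P'" if "P' \<subseteq> ?Q" "lower_set N P'" for P'
      using less.prems(3)[of P'] that by blast
    show ?thesis
    proof (cases "?g \<in> lin_ideal (span ?X)")
      case True
      then have "?g \<in> J N ?Q" using less.prems(3)[OF subset_refl less.prems(1)] a by (simp add: redundancy_def)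
      then have eq: "J N P = J N ?Q" using J_remove_redundant[OF aP] by blast
      show ?thesis
        unfolding eq by (rule IH) (use less.prems red_Q in \<open>auto simp: eq\<close>)
    next
      case False
      note colon = colon_J[OF N less.prems(1) a False]
      have "\<exists>\<gamma>\<in>W. lform y * h - lform \<gamma> * ?g \<in> J N ?Q" if y: "y \<in> W" for y
      proof -
        obtain j v where jv: "lform y * h = j + v * ?g" "j \<in> J N ?Q" "v \<in> PR d"
          using less.prems(7)[OF y] unfolding J_remove[OF aP] by blast
        let ?q = "int (card N)"
        obtain \<gamma> where \<gamma>: "hcomp 1 v = lform \<gamma>"
          using linear_form_lform[of "hcomp 1 v"] jv(3) by auto
        have "homogeneous (lform y * h) (1 + ?q)" by (rule homogeneous_mult[OF homogeneous_lform less.prems(5)])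
        then have "lform y * h = hcomp (1 + ?q) (j + ?g * v)"
          using jv(1) by (simp add: hcomp_homogeneous mult.commute)
        also have "\<dots> = hcomp (1 + ?q) j + lform \<gamma> * ?g"
          using hcomp_mult[OF homogeneous_fprod[OF N, of a], of "1 + ?q" v] \<gamma>
          by (simp add: hcomp_add mult.commute)
        finally have "\<psi> (lform y * h) = \<psi> (hcomp (1 + ?q) j) + \<psi> (lform \<gamma>) * \<psi> ?g" by (simp add: \<psi>(1,2))
        then have "lform y * h = \<psi> (hcomp (1 + ?q) j) + lform (\<rho> \<gamma>) * ?g"
          using less.prems(6) \<rho>(2)[OF y] \<psi>_fprod[OF aP] by (simp add: \<psi>(2,5))
        moreover have "\<psi> x \<in> J N ?Q" if "x \<in> J N ?Q" for x
        proof -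
          have "ideal {x \<in> PR d. \<psi> x \<in> J N ?Q} (poly_ring d)"
            unfolding ideal_PR_iff using ideal_PR_0[OF ideal_J] ideal_PR_add[OF ideal_J] ideal_PR_mult[OF ideal_J] \<psi> \<psi>(3)[of 0]
            by auto
          then have "J N ?Q \<subseteq> {x \<in> PR d. \<psi> x \<in> J N ?Q}"
            by (rule J_minimal) (use \<psi>_fprod J_base in auto)
          then show ?thesis using that by blast
        qed
        ultimately show ?thesis using hcomp_J[OF N jv(2)] \<rho>(1) by (intro bexI[of _ "\<rho> \<gamma>"]) auto
      qed
      then obtain \<gamma> where \<gamma>: "\<And>y. y \<in> W \<Longrightarrow> \<gamma> y \<in> W" "\<And>y. y \<in> W \<Longrightarrow> lform y * h - lform (\<gamma> y) * ?g \<in> J N ?Q"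
        by metis
      have "lform x * lform (\<gamma> y) - lform y * lform (\<gamma> x) \<in> lin_ideal (span ?X)" if "x \<in> W" "y \<in> W" for x y
      proof -
        have "(lform x * lform (\<gamma> y) - lform y * lform (\<gamma> x)) * ?g =
            lform y * (lform x * h - lform (\<gamma> x) * ?g) - lform x * (lform y * h - lform (\<gamma> y) * ?g)"
          by (simp add: algebra_simps)
        also have "\<dots> \<in> J N ?Q"
          by (rule ideal_PR_diff[OF ideal_J]; rule ideal_PR_mult[OF ideal_J]) (simp_all add: \<gamma>(2) that)
        finally show ?thesis unfolding colon[symmetric] colon_def by auto
      qed
      then obtain c where c: "\<And>y. y \<in> W \<Longrightarrow> \<gamma> y - scale c y \<in> span ?X"
        using lform_division[OF W(1), of \<gamma> ?X] \<gamma>(1) by blast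
      let ?h = "h - const c * ?g"
      have "?h \<in> J N ?Q"
      proof (rule IH)
        show "?h \<in> PR d" using less.prems(4) by auto
        show "homogeneous ?h (int (card N))"
          using homogeneous_mult[OF homogeneous_const homogeneous_fprod[OF N]] less.prems(5)
          by (intro homogeneous_diff) auto
        have "h = ?h + const c * ?g" by simp
        then have "\<psi> h = \<psi> ?h + const c * ?g" using \<psi>_fprod[OF aP] \<psi>(1,2,3) by metis
        then show "\<psi> ?h = ?h" using less.prems(6) by (simp add: eq_diff_eq)
        fix y assume y: "y \<in> W"
        have "lform y * ?h = (lform y * h - lform (\<gamma> y) * ?g) + lform (\<gamma> y - scale c y) * ?g"
          by (simp add: lform_diff lform_scale algebra_simps)
        also have "\<dots> \<in> J N ?Q"
          using \<gamma>(2)[OF y] below_mult_fprod[OF N less.prems(1) aP c[OF y]] by (rule ideal_PR_add[OF ideal_J])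
        finally show "lform y * ?h \<in> J N ?Q" .
      qed (use less.prems red_Q in auto)
      then have "?h + const c * ?g \<in> J N P" unfolding J_remove[OF aP] by blast
      then show ?thesis by simp
    qed
  qed
qed

text \<open>If \<open>fprod N a\<close> lies in the prime ideal, then one of its factors does, and there is a set \<open>T\<close> of indices on which
  \<open>a\<close> is tight. The elements below \<open>a\<close> on \<open>T\<close> form a poset ideal \<open>PT\<close> that embeds into \<open>P\<close> by filling the other
  coordinates from \<open>a\<close>, so the induction hypothesis applies to \<open>PT\<close> without its top element \<open>aT\<close>. Since
  \<open>below_mult_fprod\<close> says that the linear forms from \<open>below f T a\<close> multiply \<open>fprod T aT\<close> into the ideal of that smaller
  set, \<open>annihilated_in_J\<close> places \<open>fprod T aT\<close> in it. Multiplication by the remaining factors \<open>r\<close> finishes the proof.\<close>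

lemma redundancy_holds:
  assumes "N \<subseteq> M" "lower_set N P" shows "redundancy N P"
  using assms
proof (induction "card P" arbitrary: N P rule: less_induct)
  case less
  have N: "finite N" using less.prems(1) finite_M finite_subset by blast
  have finP: "finite P" by (rule finite_lower_set[OF N less.prems(2)])
  show ?case
    unfolding redundancy_def
  proof (intro allI impI)
    fix a assume a: "maximal_in N P a" and fa: "fprod N a \<in> lin_ideal (span (below f N a))"
    have aP: "a \<in> P" using a by (simp add: maximal_in_def)
    then have aB: "a \<in> box N" using less.prems(2) by (auto simp: lower_set_def)
    then have am: "a i \<in> {1..m i}" if "i \<in> N" for i using that by (auto simp: box_def PiE_def Pi_def)
    obtain i where "i \<in> N" "lform (f i (a i)) \<in> lin_ideal (span (below f N a))"
      using prod_in_lin_ideal[OF N _ fa[unfolded fprod_def]] by auto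
    then obtain T where T: "T \<subseteq> N" "T \<noteq> {}" and tT: "\<And>j. j \<in> T \<Longrightarrow> f j (a j) \<in> span (below f T a)"
      using tight[OF less.prems(1), of a i] am by (auto simp: lform_in_lin_ideal_iff)
    have finT: "finite T" using T N finite_subset by blast
    define aT where "aT = restrict a T"
    define PT where "PT = {c \<in> box T. \<forall>i\<in>T. c i \<le> a i}"
    define ext where "ext c = (\<lambda>i. if i \<in> T then c i else a i)" for c :: "nat \<Rightarrow> nat"
    have aT: "aT \<in> PT" using T am by (auto simp: PT_def aT_def box_def)
    have lower: "lower_set T PT" unfolding lower_set_def PT_def by fastforce
    have below_T: "below f T aT = below f T a" by (rule below_cong) (simp add: aT_def)
    have ext_P: "ext c \<in> P" if "c \<in> PT" for c
    proof -
      have "ext c \<in> box N"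
        using that aB T by (auto simp: ext_def PT_def box_def PiE_def Pi_def extensional_def)
      moreover have "\<forall>i\<in>N. ext c i \<le> a i" using that by (auto simp: ext_def PT_def)
      ultimately show ?thesis using less.prems(2) aP unfolding lower_set_def by blast
    qed
    have inj: "inj_on ext PT"
    proof (rule inj_onI)
      fix c c' assume c: "c \<in> PT" "c' \<in> PT" "ext c = ext c'"
      then have "c i = c' i" if "i \<in> T" for i using fun_cong[OF c(3)[unfolded ext_def], of i] that by simp
      then show "c = c'" using c(1,2) by (intro extensionalityI[of _ T]) (auto simp: PT_def box_def PiE_def)
    qed
    have "card PT \<le> card P"
      by (rule card_inj_on_le[OF inj]) (use ext_P finP in auto)
    moreover have finPT: "finite PT" by (rule finite_lower_set[OF finT lower])
    moreover have "card (PT - {aT}) < card PT" using finPT aT by (intro psubset_card_mono) auto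
    ultimately have cardQ: "card (PT - {aT}) < card P" by simp
    have max: "maximal_in T PT aT"
      unfolding maximal_in_def
    proof (intro conjI ballI impI)
      fix c assume "c \<in> PT" "\<forall>i\<in>T. aT i \<le> c i"
      then show "c = aT"
        by (intro extensionalityI[of _ T]) (auto simp: PT_def aT_def box_def PiE_def intro: antisym)
    qed (rule aT)
    have lowerQ: "lower_set T (PT - {aT})" by (rule lower_set_remove[OF lower max])
    let ?W = "span (below f T a)"
    have fW: "f i (c i) \<in> ?W" if "c \<in> PT" "i \<in> T" for c i
    proof (cases "c i = a i")
      case False
      then have "c i < a i" "1 \<le> c i" using that by (auto simp: PT_def box_def PiE_def Pi_def le_neq_implies_less)
      then show ?thesis using that by (intro span_base) (auto simp: below_def)
    qed (use tT that in auto)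
    have "?W \<noteq> {0}"
    proof -
      obtain j where j: "j \<in> T" using T by blast
      then have "f j (a j) \<noteq> 0" using f_nonzero am T less.prems(1) by blast
      then show ?thesis using tT[OF j] by blast
    qed
    obtain \<rho> where \<rho>: "Vector_Spaces.linear scale scale \<rho>" "\<And>v. \<rho> v \<in> ?W" "\<And>v. v \<in> ?W \<Longrightarrow> \<rho> v = v"
      using projection_exists[OF subspace_span] by blast
    obtain \<psi> where \<psi>: "\<And>x y. \<psi> (x + y) = \<psi> x + \<psi> y" "\<And>x y. \<psi> (x * y) = \<psi> x * \<psi> y"
      "\<And>c. \<psi> (const c) = const c" "\<And>x. x \<in> PR d \<Longrightarrow> \<psi> x \<in> PR d" "\<And>v. \<psi> (lform v) = lform (\<rho> v)"
      using linear_induced_hom[OF \<rho>(1)] by blast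
    have \<psi>1: "\<psi> 1 = 1" using \<psi>(3)[of 1] by simp
    have "fprod T aT \<in> J T (PT - {aT})"
    proof (rule annihilated_in_J[OF finT subspace_span \<open>?W \<noteq> {0}\<close> \<rho>(2,3) \<psi> lowerQ])
      show "redundancy T P'" if "P' \<subseteq> PT - {aT}" "lower_set T P'" for P'
      proof (rule less.hyps)
        have "card P' \<le> card (PT - {aT})" using that finPT by (intro card_mono) auto
        then show "card P' < card P" using cardQ by simp
      qed (use that T less.prems in auto)
      show "\<psi> (fprod T aT) = fprod T aT"
        using fW[OF aT] by (simp add: fprod_def mult_hom_prod[of \<psi>, OF \<psi>(2) \<psi>1] \<psi>(5) \<rho>(3))
      show "lform y * fprod T aT \<in> J T (PT - {aT})" if "y \<in> ?W" for y
        using below_mult_fprod[OF finT lower aT] that below_T by simp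
    qed (use fW homogeneous_fprod[OF finT] in auto)
    define r where "r = (\<Prod>i\<in>N - T. lform (f i (a i)))"
    have fprod_ext: "fprod T c * r = fprod N (ext c)" for c
    proof -
      have "fprod N (ext c) = (\<Prod>i\<in>N - T. lform (f i (ext c i))) * (\<Prod>i\<in>T. lform (f i (ext c i)))"
        unfolding fprod_def by (rule prod.subset_diff[OF T(1) N])
      also have "\<dots> = r * fprod T c"
        unfolding r_def fprod_def by (intro arg_cong2[where f = "(*)"] prod.cong) (auto simp: ext_def)
      finally show ?thesis by (simp add: mult.commute)
    qed
    have "J T (PT - {aT}) \<subseteq> {s \<in> PR d. s * r \<in> J N (P - {a})}"
    proof (rule J_minimal[OF ideal_colon[OF ideal_J]])
      fix c assume c: "c \<in> PT - {aT}"
      have "ext c \<noteq> a"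
      proof
        assume "ext c = a"
        then have "c i = a i" if "i \<in> T" for i using fun_cong[OF \<open>ext c = a\<close>[unfolded ext_def], of i] that by simp
        then have "c = aT" using c by (intro extensionalityI[of _ T]) (auto simp: PT_def aT_def box_def PiE_def)
        then show False using c by blast
      qed
      then show "fprod T c \<in> {s \<in> PR d. s * r \<in> J N (P - {a})}"
        using ext_P c by (simp add: fprod_ext J_base)
    qed
    then have "fprod N (ext aT) \<in> J N (P - {a})"
      using \<open>fprod T aT \<in> J T (PT - {aT})\<close> by (auto simp: fprod_ext[symmetric])
    moreover have "ext aT = a" by (auto simp: ext_def aT_def)
    ultimately show "fprod N a \<in> J N (P - {a})" by simp
  qed
qed

lemma finite_below:
  assumes "finite N" shows "finite (below f N a)"
proof -
  have "below f N a \<subseteq> (\<lambda>(i, j). f i j) ` (SIGMA i:N. {..<a i})" unfolding below_def by force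
  then show ?thesis using assms by (meson finite_SigmaI finite_imageI finite_lessThan finite_subset)
qed

lemma J_lin_res:
  assumes N: "N \<subseteq> M" and P: "lower_set N P"
  shows "\<exists>\<rho> A. lin_res d (int (card N)) (J N P) \<rho> A"
  using P
proof (induction "card P" arbitrary: P rule: less_induct)
  case less
  have finN: "finite N" using N finite_M finite_subset by blast
  show ?case
  proof (cases "P = {}")
    case True
    then have "J N P = {0}" by (simp add: J_def ideal_gen_empty)
    then show ?thesis using lin_res_zero by metis
  next
    case False
    obtain a where a: "maximal_in N P a" using maximal_in_exists[OF finN less.prems False] by blast
    then have aP: "a \<in> P" by (simp add: maximal_in_def)
    have "card (P - {a}) < card P"
      using finite_lower_set[OF finN less.prems] aP by (intro psubset_card_mono) auto
    then obtain \<rho> A where A: "lin_res d (int (card N)) (J N (P - {a})) \<rho> A"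
      using less.hyps lower_set_remove[OF less.prems a] by blast
    show ?thesis
    proof (cases "fprod N a \<in> lin_ideal (span (below f N a))")
      case True
      then have "fprod N a \<in> J N (P - {a})"
        using redundancy_holds[OF N less.prems] a by (simp add: redundancy_def)
      then show ?thesis using A J_remove_redundant[OF aP] by metis
    next
      case False
      obtain \<sigma> B where B: "lin_res d 1 (lin_ideal (span (below f N a))) \<sigma> B"
        using lin_ideal_lin_res[OF finite_below[OF finN]] by blast
      show ?thesis
        unfolding J_remove[OF aP]
        by (rule lin_res_cone[OF A B fprod_PR homogeneous_fprod[OF finN] colon_J[OF finN less.prems a False]])
    qed
  qed
qed

end

section \<open>Arrangements with a generic collection of bases\<close>

theorem theorem2p1:
  fixes scale :: "'k::field \<Rightarrow> 'v::ab_group_add \<Rightarrow> 'v"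
    and d :: nat and e :: "nat \<Rightarrow> 'v"
    and n :: nat and V :: "nat \<Rightarrow> 'v set" and f :: "nat \<Rightarrow> nat \<Rightarrow> 'v"
    and P Q :: "(nat \<Rightarrow> nat) set" and a b :: "nat \<Rightarrow> nat"
  assumes "infinite (UNIV :: 'k set)"
    and "vector_space scale"
    and "ordered_basis scale d e UNIV"
    and "subspace_arrangement scale n V"
    and "generic_bases scale n V f"
    and "poset_ideal n (D_poset scale n V) P"
    and "P \<noteq> {}"
    and "maximal_element n P a"
    and "Q = P - {a}"
    and "b = (\<lambda>i. a i - 1)"
  shows "poset_ideal n (D_poset scale n V) Q \<and>
         linear_resolution d (J_ideal scale d e n f P) n \<and>
         (f_prod scale d e n f a \<notin> I_ideal scale d e n f b \<longrightarrow>
            colon d (J_ideal scale d e n f Q) (f_prod scale d e n f a) = I_ideal scale d e n f b) \<and>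
         (f_prod scale d e n f a \<in> I_ideal scale d e n f b \<longrightarrow>
            f_prod scale d e n f a \<in> J_ideal scale d e n f Q \<and>
            colon d (J_ideal scale d e n f Q) (f_prod scale d e n f a) = carrier (poly_ring d))"
proof -
  interpret vector_space scale by fact
  interpret sym_space scale d e by unfold_locales fact
  define m where "m i = dim (V i)" for i
  interpret tight_arrangement scale d e "{1..n}" m f
  proof
    fix i j assume ij: "i \<in> {1..n}" "j \<in> {1..m i}"
    have "ordered_basis scale (m i) (f i) (V i)"
      using assms(5) ij by (simp add: generic_bases_def collection_of_bases_def m_def)
    then have "independent (f i ` {1..m i})" by (simp add: ordered_basis_def)
    then show "f i j \<noteq> 0" using ij dependent_zero by (metis imageI)
  qed (use generic_tight[OF assms(5)] in \<open>auto simp: m_def\<close>)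
  have box: "D_poset scale n V = box {1..n}" by (simp add: D_poset_def box_def m_def)
  have lower: "poset_ideal n (D_poset scale n V) P' \<longleftrightarrow> lower_set {1..n} P'" for P'
    by (simp add: poset_ideal_def lower_set_def box cw_le_def)
  have P: "lower_set {1..n} P" using assms(6) lower by simp
  have a: "maximal_in {1..n} P a" using assms(8) by (simp add: maximal_element_def maximal_in_def cw_le_def)
  have fp: "f_prod scale d e n f = fprod {1..n}" by (simp add: f_prod_def fprod_def fun_eq_iff)
  have J: "J_ideal scale d e n f P' = J {1..n} P'" for P' by (simp add: J_ideal_def J_def fp)
  have "{f i j |i j. i \<in> {1..n} \<and> j \<in> {1..b i}} = below f {1..n} a"
  proof -
    have "j \<in> {1..b i} \<longleftrightarrow> 1 \<le> j \<and> j < a i" for i j by (auto simp: assms(10))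
    then show ?thesis by (simp only: below_def)
  qed
  then have I: "I_ideal scale d e n f b = lin_ideal (span (below f {1..n} a))"
    by (simp add: I_ideal_def W_span_def lin_ideal_def)
  have "linear_resolution d (J {1..n} P) n"
    using J_lin_res[OF subset_refl P] lin_res_imp_linear_resolution by auto
  moreover have "fprod {1..n} a \<in> J {1..n} Q" if "fprod {1..n} a \<in> lin_ideal (span (below f {1..n} a))"
    using redundancy_holds[OF subset_refl P] a that assms(9) by (simp add: redundancy_def)
  moreover have "colon d (J {1..n} Q) (fprod {1..n} a) = PR d" if "fprod {1..n} a \<in> J {1..n} Q"
    using ideal_PR_mult[OF ideal_J that] by (auto simp: colon_def)
  ultimately show ?thesis
    unfolding lower fp J I using lower_set_remove[OF P a] colon_J[OF _ P a] assms(9) by auto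
qed

end
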